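(* Let $n\ge 5$ be an integer and let $p$ be a real number such that $\frac{n+4}{n-4}<p<p_c$ if $n\ge 13$, and $\frac{n+4}{n-4}<p<\infty$ if $5\le n\le 12$, where for $n\ge 13$ the number $p_c$ is the unique solution in $\left(\frac{n+4}{n-4},\infty\right)$ of $$p_c\cdot\frac{4}{p_c-1}\cdot\left(\frac{4}{p_c-1}+2\right)\cdot\left(n-2-\frac{4}{p_c-1}\right)\cdot\left(n-4-\frac{4}{p_c-1}\right)=\frac{n^2(n-4)^2}{16}.$$ Let $r\mapsto u(r)$ be a radial entire solution of $$\Delta^2u=|u|^{p-1}u\quad\text{in }\mathbb{R}^n .$$ Then, as $r\to\infty$, $u(r)$ oscillates infinitely many times around the singular solution $$u_s(r)=K_0^{1/(p-1)}r^{-4/(p-1)},\qquad K_0=\frac{4}{p-1}\left(\frac{4}{p-1}+2\right)\left(n-2-\frac{4}{p-1}\right)\left(n-4-\frac{4}{p-1}\right).$$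
   Context: "Entire solution" means a solution that is defined and regular in the whole space $\mathbb{R}^n$ (including at the origin); radial means depending only on $r=|x|$. The function $u_s$ is an explicitly known radial solution of the equation on $\mathbb{R}^n\setminus\{0\}$, singular at the origin. "$u(r)$ oscillates infinitely many times around $u_s(r)$ as $r\to\infty$" means that $u-u_s$ changes sign infinitely many times as $r\to\infty$. It is known that for $n\ge 13$ the displayed equation for $p_c$ has exactly one solution in $\left(\frac{n+4}{n-4},\infty\right)$.
   Formalization: The solution u is additionally assumed to be positive at some point; without this the claim fails, for example for u = 0 and for any solution that is nonpositive everywhere, since u_s is positive. *)

theory Defs
  imports "HOL-Analysis.Analysis"
begin

definition partial_deriv :: "'n::finite \<Rightarrow> (real ^ 'n \<Rightarrow> real) \<Rightarrow> real ^ 'n \<Rightarrow> real" where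
  "partial_deriv i f x = frechet_derivative f (at x) (axis i 1)"

text \<open>\<open>C_k k f\<close>: the function \<open>f\<close> is \<open>k\<close> times continuously differentiable on the whole space.\<close>

fun C_k :: "nat \<Rightarrow> (real ^ 'n::finite \<Rightarrow> real) \<Rightarrow> bool" where
  "C_k 0 f = continuous_on UNIV f"
| "C_k (Suc k) f = ((\<forall>x. f differentiable (at x)) \<and> (\<forall>i. C_k k (partial_deriv i f)))"

definition laplacian :: "(real ^ 'n::finite \<Rightarrow> real) \<Rightarrow> real ^ 'n \<Rightarrow> real" where
  "laplacian f x = (\<Sum>i\<in>UNIV. partial_deriv i (partial_deriv i f) x)"

text \<open>Classical solutions of \<open>\<Delta>\<^sup>2 u = \<bar>u\<bar>\<^sup>p\<^sup>-\<^sup>1 u\<close> on the whole space, origin included.\<close>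

definition entire_solution :: "real \<Rightarrow> (real ^ 'n::finite \<Rightarrow> real) \<Rightarrow> bool" where
  "entire_solution p u \<longleftrightarrow>
     C_k 4 u \<and> (\<forall>x. laplacian (laplacian u) x = \<bar>u x\<bar> powr (p - 1) * u x)"

definition K0 :: "nat \<Rightarrow> real \<Rightarrow> real" where
  "K0 n p = 4 / (p - 1) * (4 / (p - 1) + 2) * (real n - 2 - 4 / (p - 1)) * (real n - 4 - 4 / (p - 1))"

definition u_s :: "nat \<Rightarrow> real \<Rightarrow> real \<Rightarrow> real" where
  "u_s n p r = K0 n p powr (1 / (p - 1)) * r powr (- 4 / (p - 1))"

text \<open>Only meaningful for \<open>n \<ge> 13\<close>, where exactly one such \<open>q\<close> exists.\<close>

definition p_crit :: "nat \<Rightarrow> real" where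
  "p_crit n = (THE q. (real n + 4) / (real n - 4) < q \<and>
     q * K0 n q = (real n)\<^sup>2 * (real n - 4)\<^sup>2 / 16)"

text \<open>The difference \<open>f - g\<close> takes strictly alternating signs along radii increasing to infinity.\<close>

definition oscillates_around_at_top :: "(real \<Rightarrow> real) \<Rightarrow> (real \<Rightarrow> real) \<Rightarrow> bool" where
  "oscillates_around_at_top f g \<longleftrightarrow>
     (\<exists>\<rho> :: nat \<Rightarrow> real. strict_mono \<rho> \<and> (\<forall>k. 0 < \<rho> k) \<and> filterlim \<rho> at_top sequentially \<and>
        (\<forall>k. (f (\<rho> k) - g (\<rho> k)) * (f (\<rho> (Suc k)) - g (\<rho> (Suc k))) < 0))"

end

theory Submission
  imports Defs
begin

text \<open>
  Write \<open>h = - \<Delta> u\<close> and \<open>m = 4 / (p - 1)\<close>.  A radial entire solution is a pair of radial Poisson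
  equations \<open>- \<Delta> u = h\<close>, \<open>- \<Delta> h = \<bar>u\<bar>\<^sup>p\<^sup>-\<^sup>1 u\<close>, each of which says how the flux
  \<open>r\<^sup>n\<^sup>-\<^sup>1 u'\<close> (resp. \<open>r\<^sup>n\<^sup>-\<^sup>1 h'\<close>) changes; every sign argument below is read off from these fluxes.

  \<^bold>\<open>Positivity.\<close> If \<open>u 0 > 0\<close> then \<open>u\<close> and \<open>h\<close> are positive everywhere and tend to \<open>0\<close>.
  At the first zero of \<open>min u h\<close> the Pohozaev function (lemma \<open>pohozaev\<close>), which is nonpositive exactly
  because \<open>p\<close> is supercritical, forbids both functions to vanish together.  It also forbids the other
  function to vanish later, so the one that changed sign keeps its new sign forever and drives \<open>u\<close> to
  \<open>\<plusminus>\<infinity>\<close>; this happens in finite radius (lemma \<open>no_positive_lower_bound\<close>), contradicting that \<open>u\<close> is entire.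

  \<^bold>\<open>No oscillation forces fast decay.\<close> Otherwise \<open>w = \<plusminus>(u - u\<^sub>s)\<close> is eventually nonnegative.  It
  satisfies \<open>\<Delta>\<^sup>2 w \<ge> \<mu> r\<^sup>-\<^sup>4 w\<close> near infinity for some \<open>\<mu>\<close> above the Hardy-Rellich constant
  \<open>n\<^sup>2 (n - 4)\<^sup>2 / 16\<close>, and \<open>p K\<^sub>0\<close> exceeding this constant is what \<open>p < p\<^sub>c\<close> means (lemma
  \<open>above_hardy_constant\<close>).  In the variable \<open>t = ln r\<close> the operator then splits as
  \<open>(D\<^sup>2 - \<sigma>\<^sup>2) (D\<^sup>2 + \<tau>\<^sup>2)\<close>: averaging against half a period of the sine of frequency \<open>\<tau>\<close> shows that a
  nonnegative \<open>w\<close> that stays bounded decays faster than the fundamental solution \<open>r\<^sup>2\<^sup>-\<^sup>n\<close> of the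
  Laplacian (lemmas \<open>spectral_decay\<close>, \<open>fast_decay\<close>).

  \<^bold>\<open>Fast decay is impossible.\<close> It gives \<open>w' \<le> 0\<close>, \<open>\<Delta> w \<ge> 0\<close>, \<open>(\<Delta> w)' \<le> 0\<close>, and these signs
  propagate from infinity all the way down to the origin (lemma \<open>backward_positive\<close>).  If \<open>w = u - u\<^sub>s\<close>,
  then \<open>u\<close> would lie above the singular \<open>u\<^sub>s\<close> near \<open>0\<close>.  If \<open>w = u\<^sub>s - u\<close>, then the flux of
  \<open>\<Delta> w\<close> would be nonpositive although it starts from \<open>0\<close> at the origin and strictly increases.

  \<^bold>\<open>Approach from below.\<close> For \<open>w = u - u\<^sub>s\<close> the inequality with \<open>\<mu> = p K\<^sub>0\<close> is convexity of the power.
  For \<open>w = u\<^sub>s - u\<close> convexity points the wrong way and \<open>u / u\<^sub>s \<rightarrow> 1\<close> is needed first.  It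
  follows from a Lyapunov function of the autonomous equation for \<open>r\<^sup>m u\<close> (lemma
  \<open>convergence_to_equilibrium\<close>), which increases from \<open>0\<close> and so rules out the equilibrium \<open>0\<close>.
\<close>


section \<open>Radial functions and their Laplacian\<close>

text \<open>
  Differentiability of the partial derivatives does not by itself mention continuity of the function;
  this closes the gap in the recursion and makes the classes nested.
\<close>

lemma C_k_Suc_imp: "C_k (Suc k) f \<Longrightarrow> C_k k f"
proof (induction k arbitrary: f)
  case 0
  then show ?case
    by (auto intro!: differentiable_imp_continuous_on simp: differentiable_on_def differentiable_at_withinI)
qed auto

lemma partial_deriv_eqI:
  assumes "(f has_derivative f') (at x)"
  shows "partial_deriv i f x = f' (axis i 1)"
  using frechet_derivative_at[OF assms] by (simp add: partial_deriv_def)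

lemma C_k_add:
  "C_k k f \<Longrightarrow> C_k k g \<Longrightarrow> C_k k (\<lambda>x. f x + g x)"
proof (induction k arbitrary: f g)
  case 0
  then show ?case by (auto intro: continuous_on_add)
next
  case (Suc k)
  have "partial_deriv i (\<lambda>x. f x + g x) = (\<lambda>x. partial_deriv i f x + partial_deriv i g x)" for i
  proof
    fix x
    have "(f has_derivative frechet_derivative f (at x)) (at x)"
      "(g has_derivative frechet_derivative g (at x)) (at x)"
      using Suc.prems by (auto simp: frechet_derivative_works[symmetric])
    from partial_deriv_eqI[OF has_derivative_add[OF this], of i]
    show "partial_deriv i (\<lambda>x. f x + g x) x = partial_deriv i f x + partial_deriv i g x"
      by (simp add: partial_deriv_def)
  qed
  with Suc show ?case by auto
qed

lemma partial_deriv_zero: "partial_deriv i (\<lambda>x. 0) = (\<lambda>x. 0)"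
  using partial_deriv_eqI[OF has_derivative_const] by (intro ext) auto

lemma C_k_zero: "C_k k (\<lambda>x. 0)"
  by (induction k) (auto simp: partial_deriv_zero)

lemma C_k_sum:
  "finite I \<Longrightarrow> (\<And>i. i \<in> I \<Longrightarrow> C_k k (f i)) \<Longrightarrow> C_k k (\<lambda>x. \<Sum>i\<in>I. f i x)"
  by (induction I rule: finite_induct) (auto simp: C_k_zero intro: C_k_add)

lemma C_k_laplacian:
  assumes "C_k (Suc (Suc k)) f" shows "C_k k (laplacian f)"
proof -
  have "laplacian f = (\<lambda>x. \<Sum>i\<in>UNIV. partial_deriv i (partial_deriv i f) x)"
    by (auto simp: laplacian_def)
  with assms show ?thesis by (auto intro!: C_k_sum)
qed

lemma ray_has_real_derivative:
  fixes f :: "real ^ 'n::finite \<Rightarrow> real"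
  assumes "f differentiable (at (r *\<^sub>R axis i 1))"
  shows "DERIV (\<lambda>s. f (s *\<^sub>R axis i 1)) r :> partial_deriv i f (r *\<^sub>R axis i 1)"
proof -
  let ?D = "frechet_derivative f (at (r *\<^sub>R axis i 1))"
  have D: "(f has_derivative ?D) (at (r *\<^sub>R axis i 1))"
    using assms by (simp add: frechet_derivative_works)
  have "((\<lambda>s::real. s *\<^sub>R (axis i 1 :: real^'n)) has_derivative (\<lambda>s. s *\<^sub>R axis i 1)) (at r)"
    by (auto intro!: derivative_eq_intros)
  from has_derivative_compose[OF this D]
  have "((\<lambda>s. f (s *\<^sub>R axis i 1)) has_derivative (\<lambda>s. ?D (s *\<^sub>R axis i 1))) (at r)" .
  moreover have "?D (s *\<^sub>R axis i 1) = partial_deriv i f (r *\<^sub>R axis i 1) * s" for s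
    using linear_scale[OF has_derivative_linear[OF D]] by (simp add: partial_deriv_def)
  ultimately show ?thesis
    by (simp add: has_field_derivative_def)
qed

text \<open>
  Restricting to a coordinate ray turns the partial derivatives of a radial function into ordinary ones,
  and away from the origin they determine all others by the chain rule through the norm.  The divergence
  form of the conclusion never divides by \<open>r\<close>.  Since the Laplacian is again a function of the norm, at
  the origin trivially so, the lemma can be iterated.
\<close>

lemma radial_laplacian:
  fixes f :: "real ^ 'n::finite \<Rightarrow> real" and j :: 'n
  assumes C2: "C_k 2 f" and rad: "\<And>x. f x = \<psi> (norm x)"
  defines "\<psi>' \<equiv> \<lambda>r. partial_deriv j f (r *\<^sub>R axis j 1)"
  shows "\<And>r. r > 0 \<Longrightarrow> DERIV \<psi> r :> \<psi>' r"
    and "\<And>r. r > 0 \<Longrightarrow> DERIV (\<lambda>r. r ^ (CARD('n) - 1) * \<psi>' r) r :>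
            r ^ (CARD('n) - 1) * laplacian f (r *\<^sub>R axis j 1)"
    and "\<And>x. laplacian f x = laplacian f (norm x *\<^sub>R axis j 1)"
    and "continuous_on UNIV \<psi>'"
    and "continuous_on {0..} \<psi>"
proof -
  define e :: "real^'n" where "e = axis j 1"
  have ne1: "norm e = 1" by (simp add: e_def norm_axis_1)
  then have ne: "norm (r *\<^sub>R e) = \<bar>r\<bar>" for r by simp
  have dif: "f differentiable (at x)" "partial_deriv i f differentiable (at x)" for i x
    using C2 by (auto simp: eval_nat_numeral)
  have cont: "continuous_on UNIV f" "continuous_on UNIV (partial_deriv j f)"
    using C2 by (auto simp: eval_nat_numeral intro!: differentiable_imp_continuous_on
      simp: differentiable_on_def differentiable_at_withinI)
  show "continuous_on UNIV \<psi>'"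
    unfolding \<psi>'_def
    by (intro continuous_on_compose2[OF cont(2)] continuous_intros) auto
  have "continuous_on {0..} (\<lambda>r. f (r *\<^sub>R e))"
    by (intro continuous_on_compose2[OF cont(1)] continuous_intros) auto
  then show "continuous_on {0..} \<psi>"
    by (rule continuous_on_eq) (auto simp: rad ne1)
  define \<psi>2 where "\<psi>2 = (\<lambda>r. partial_deriv j (partial_deriv j f) (r *\<^sub>R e))"
  have d1: "DERIV \<psi> r :> \<psi>' r" if "r > 0" for r
  proof -
    have "DERIV (\<lambda>s. f (s *\<^sub>R e)) r :> \<psi>' r"
      using ray_has_real_derivative[OF dif(1)] by (simp add: \<psi>'_def e_def)
    then show ?thesis
      by (rule has_field_derivative_transform_within_open[where S="{0<..}"])
        (use that in \<open>auto simp: rad ne1\<close>)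
  qed
  then show "\<And>r. r > 0 \<Longrightarrow> DERIV \<psi> r :> \<psi>' r" .
  have d2: "DERIV \<psi>' r :> \<psi>2 r" for r
    using ray_has_real_derivative[OF dif(2)] by (simp add: \<psi>'_def \<psi>2_def e_def)
  have nrm: "(norm has_derivative (\<lambda>y. (x \<bullet> y) / norm x)) (at x)" if "x \<noteq> 0" for x :: "real^'n"
    using has_derivative_norm[OF that] by (simp add: sgn_div_norm divide_inverse mult.commute inner_commute)
  have p1: "partial_deriv i f x = \<psi>' (norm x) * (x $ i / norm x)" if "x \<noteq> 0" for i x
  proof -
    have "(\<psi> has_derivative (\<lambda>y. \<psi>' (norm x) * y)) (at (norm x))"
      using d1[of "norm x"] that by (simp add: has_field_derivative_def)
    from has_derivative_compose[OF nrm[OF that] this]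
    have "(f has_derivative (\<lambda>y. \<psi>' (norm x) * (x \<bullet> y / norm x))) (at x)"
      using rad by presburger
    from partial_deriv_eqI[OF this, of i] show ?thesis by (simp add: inner_axis)
  qed
  have p2: "partial_deriv i (partial_deriv i f) x =
      \<psi>2 (norm x) * (x $ i)\<^sup>2 / (norm x)\<^sup>2 + \<psi>' (norm x) * (1 / norm x - (x $ i)\<^sup>2 / (norm x) ^ 3)"
    if "x \<noteq> 0" for i x
  proof -
    have "(\<psi>' has_derivative (\<lambda>y. \<psi>2 (norm x) * y)) (at (norm x))"
      using d2[of "norm x"] by (simp add: has_field_derivative_def)
    note c = has_derivative_compose[OF nrm[OF that] this]
    have "((\<lambda>x. \<psi>' (norm x) * (x $ i / norm x)) has_derivative
      (\<lambda>y. \<psi>' (norm x) * ((y $ i * norm x - x $ i * (x \<bullet> y / norm x)) / (norm x * norm x)) +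
        \<psi>2 (norm x) * (x \<bullet> y / norm x) * (x $ i / norm x))) (at x)"
      using that
      by (auto intro!: derivative_eq_intros c nrm bounded_linear_imp_has_derivative bounded_linear_vec_nth
            simp: field_simps)
    then have "(partial_deriv i f has_derivative
      (\<lambda>y. \<psi>' (norm x) * ((y $ i * norm x - x $ i * (x \<bullet> y / norm x)) / (norm x * norm x)) +
        \<psi>2 (norm x) * (x \<bullet> y / norm x) * (x $ i / norm x))) (at x)"
      by (rule has_derivative_transform_within_open[where s="- {0}"]) (use that p1 in auto)
    from partial_deriv_eqI[OF this, of i] show ?thesis
      using that by (simp add: inner_axis power2_eq_square power3_eq_cube field_simps)
  qed
  have sq: "(\<Sum>i\<in>UNIV. (x $ i)\<^sup>2) = (norm x)\<^sup>2" for x :: "real^'n"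
    by (simp add: norm_vec_def L2_set_def sum_nonneg)
  have lap: "laplacian f x = \<psi>2 (norm x) + (real CARD('n) - 1) * \<psi>' (norm x) / norm x"
    if "x \<noteq> 0" for x
  proof -
    have "laplacian f x = (\<Sum>i\<in>UNIV. (\<psi>2 (norm x) / (norm x)\<^sup>2 - \<psi>' (norm x) / (norm x) ^ 3) * (x $ i)\<^sup>2
         + \<psi>' (norm x) / norm x)"
      unfolding laplacian_def using p2[OF that] by (intro sum.cong) (auto simp: algebra_simps)
    also have "\<dots> = (\<psi>2 (norm x) / (norm x)\<^sup>2 - \<psi>' (norm x) / (norm x) ^ 3) * (norm x)\<^sup>2
        + real CARD('n) * (\<psi>' (norm x) / norm x)"
      by (simp add: sum.distrib sum_distrib_left[symmetric] sq)
    also have "\<dots> = \<psi>2 (norm x) + (real CARD('n) - 1) * \<psi>' (norm x) / norm x"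
      using that by (simp add: field_simps power2_eq_square power3_eq_cube)
    finally show ?thesis .
  qed
  show "laplacian f x = laplacian f (norm x *\<^sub>R axis j 1)" for x
    using lap[of x] lap[of "norm x *\<^sub>R axis j 1"] ne[of "norm x"]
    by (cases "x = 0") (auto simp: e_def axis_eq_0_iff)
  show "DERIV (\<lambda>r. r ^ (CARD('n) - 1) * \<psi>' r) r :>
            r ^ (CARD('n) - 1) * laplacian f (r *\<^sub>R axis j 1)" if "r > 0" for r
  proof -
    have e: "real (CARD('n) - 1) * r ^ (CARD('n) - 1 - 1) = (real CARD('n) - 1) * r ^ (CARD('n) - 1) / r"
    proof (cases "CARD('n) - 1")
      case 0
      then show ?thesis by (metis Suc_diff_1 One_nat_def diff_self mult_zero_left of_nat_1
          zero_less_card_finite of_nat_0 div_0)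
    next
      case (Suc k)
      then have "real CARD('n) - 1 = real (Suc k)"
        by (metis Suc_diff_1 add_diff_cancel_right' of_nat_Suc zero_less_card_finite add.commute)
      with Suc that show ?thesis by simp
    qed
    have "DERIV (\<lambda>r. r ^ (CARD('n) - 1) * \<psi>' r) r :>
        real (CARD('n) - 1) * r ^ (CARD('n) - 1 - 1) * \<psi>' r + r ^ (CARD('n) - 1) * \<psi>2 r"
      by (auto intro!: derivative_eq_intros d2)
    moreover have "real (CARD('n) - 1) * r ^ (CARD('n) - 1 - 1) * \<psi>' r + r ^ (CARD('n) - 1) * \<psi>2 r
       = r ^ (CARD('n) - 1) * laplacian f (r *\<^sub>R axis j 1)"
      unfolding e using lap[of "r *\<^sub>R e"] ne[of r] that
      by (auto simp: e_def axis_eq_0_iff algebra_simps)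
    ultimately show ?thesis by metis
  qed
qed

section \<open>Comparison along an interval; growth of radial functions\<close>

lemma continuous_on_of_deriv:
  fixes f :: "real \<Rightarrow> real"
  assumes "\<And>x. a \<le> x \<Longrightarrow> x \<le> b \<Longrightarrow> DERIV f x :> f' x"
  shows "continuous_on {a..b} f"
  using DERIV_atLeastAtMost_imp_continuous_on assms by blast

text \<open>
  Comparison of increments replaces integration throughout: the integrals that would occur are bounded by
  explicit primitives.
\<close>

lemma increment_mono:
  fixes f g :: "real \<Rightarrow> real"
  assumes "a \<le> b" "continuous_on {a..b} f" "continuous_on {a..b} g"
    and "\<And>x. a < x \<Longrightarrow> x < b \<Longrightarrow> DERIV f x :> f' x"
    and "\<And>x. a < x \<Longrightarrow> x < b \<Longrightarrow> DERIV g x :> g' x"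
    and "\<And>x. a < x \<Longrightarrow> x < b \<Longrightarrow> f' x \<le> g' x"
  shows "f b - f a \<le> g b - g a"
proof -
  have "g a - f a \<le> g b - f b"
  proof (rule DERIV_nonneg_imp_increasing_open[where f="\<lambda>x. g x - f x"])
    show "\<exists>y. DERIV (\<lambda>x. g x - f x) x :> y \<and> 0 \<le> y" if "a < x" "x < b" for x
      using assms(4,5,6)[OF that] by (auto intro!: exI[of _ "g' x - f' x"] derivative_intros)
  qed (use assms in \<open>auto intro!: continuous_intros\<close>)
  then show ?thesis by simp
qed

lemma nondecreasing_of_deriv:
  fixes f :: "real \<Rightarrow> real"
  assumes "a \<le> b" "continuous_on {a..b} f"
    and "\<And>x. a < x \<Longrightarrow> x < b \<Longrightarrow> DERIV f x :> f' x"
    and "\<And>x. a < x \<Longrightarrow> x < b \<Longrightarrow> 0 \<le> f' x"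
  shows "f a \<le> f b"
proof -
  have "0 - 0 \<le> f b - f a"
    by (rule increment_mono[of a b "\<lambda>_. 0" f "\<lambda>_. 0" f']) (use assms in \<open>simp_all\<close>)
  then show ?thesis by simp
qed

lemma nonincreasing_of_deriv:
  fixes f :: "real \<Rightarrow> real"
  assumes "a \<le> b" "continuous_on {a..b} f"
    and "\<And>x. a < x \<Longrightarrow> x < b \<Longrightarrow> DERIV f x :> f' x"
    and "\<And>x. a < x \<Longrightarrow> x < b \<Longrightarrow> f' x \<le> 0"
  shows "f b \<le> f a"
proof -
  have "f b - f a \<le> 0 - 0"
    by (rule increment_mono[of a b f "\<lambda>_. 0" f' "\<lambda>_. 0"]) (use assms in \<open>simp_all\<close>)
  then show ?thesis by simp
qed

lemma decreasing_of_deriv: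
  fixes f :: "real \<Rightarrow> real"
  assumes "a < b" "continuous_on {a..b} f"
    and "\<And>x. a < x \<Longrightarrow> x < b \<Longrightarrow> DERIV f x :> f' x"
    and "\<And>x. a < x \<Longrightarrow> x < b \<Longrightarrow> f' x < 0"
  shows "f b < f a"
  by (rule DERIV_neg_imp_decreasing_open[OF assms(1)]) (use assms in blast)+

text \<open>
  All continuation arguments look at the first point where a strict sign condition fails.
\<close>

lemma first_hit:
  fixes f :: "real \<Rightarrow> real"
  assumes "a \<le> b" "continuous_on {a..b} f" "f a > c" "f b \<le> c"
  shows "\<exists>r>a. r \<le> b \<and> f r = c \<and> (\<forall>s. a \<le> s \<longrightarrow> s < r \<longrightarrow> f s > c)"
proof -
  let ?S = "{a..b} \<inter> f -` {..c}"
  have "closed ?S" using assms(2) by (intro continuous_closed_preimage) auto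
  moreover have "bounded ?S" by (rule bounded_subset[of "{a..b}"]) auto
  ultimately have "compact ?S" by (simp add: compact_eq_bounded_closed)
  moreover have "b \<in> ?S" using assms(1,4) by simp
  ultimately obtain r where r: "r \<in> ?S" and min: "\<And>s. s \<in> ?S \<Longrightarrow> r \<le> s"
    using compact_attains_inf[of ?S] by (metis empty_iff)
  have above: "f s > c" if "a \<le> s" "s < r" for s
    using min[of s] r that by force
  have "a < r" using r assms(3) by (cases "a = r") auto
  moreover have "f r = c"
  proof (rule ccontr)
    assume "f r \<noteq> c"
    then have "f r < c" using r by auto
    moreover have "continuous_on {a..r} f" using r by (intro continuous_on_subset[OF assms(2)]) auto
    ultimately obtain s where s: "a \<le> s" "s \<le> r" "f s = c"
      using IVT2'[of f r c a] \<open>a < r\<close> assms(3) by force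
    then have "s < r" using \<open>f r \<noteq> c\<close> by (cases "s = r") auto
    with above[of s] s show False by auto
  qed
  ultimately show ?thesis using r above by (intro exI[of _ r]) auto
qed

text \<open>
  For large \<open>r\<close> the flux is at least a multiple of \<open>r\<^sup>n\<close>, so that \<open>y'\<close> exceeds \<open>1\<close>.
\<close>

lemma radial_growth:
  fixes y y' e :: "real \<Rightarrow> real"
  assumes n: "n \<ge> 2" and R: "R > 0" and \<kappa>: "\<kappa> > 0"
    and y: "\<And>r. r \<ge> R \<Longrightarrow> DERIV y r :> y' r"
    and flux: "\<And>r. r \<ge> R \<Longrightarrow> DERIV (\<lambda>r. r ^ (n - 1) * y' r) r :> r ^ (n - 1) * e r"
    and e: "\<And>r. r \<ge> R \<Longrightarrow> e r \<ge> \<kappa>"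
  shows "\<exists>R'\<ge>R. \<forall>r\<ge>R'. y r \<ge> A \<and> y' r > 0"
proof -
  define q where "q = (\<lambda>r. r ^ (n - 1) * y' r)"
  define C where "C = \<bar>q R\<bar> + \<kappa> * R ^ n / n"
  have C: "C \<ge> 0" using R \<kappa> by (auto simp: C_def)
  define R1 where "R1 = max (max R 1) (n * (C + 1) / \<kappa>)"
  have q: "q r \<ge> \<kappa> * r ^ n / n - C" if "r \<ge> R" for r
  proof -
    have "\<kappa> * r ^ n / n - \<kappa> * R ^ n / n \<le> q r - q R"
    proof (rule increment_mono)
      show "R \<le> r" by fact
      show "DERIV (\<lambda>r. \<kappa> * r ^ n / n) x :> \<kappa> * x ^ (n - 1)" for x
        using n by (auto intro!: derivative_eq_intros)
      show "DERIV q x :> x ^ (n - 1) * e x" if "R < x" for x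
        using flux[of x] that by (simp add: q_def)
      show "continuous_on {R..r} q"
        using flux by (intro continuous_at_imp_continuous_on ballI DERIV_isCont) (auto simp: q_def)
      show "\<kappa> * x ^ (n - 1) \<le> x ^ (n - 1) * e x" if "R < x" for x
        using mult_left_mono[OF e[of x], of "x ^ (n - 1)"] that R by (simp add: mult.commute)
    qed (use n in \<open>auto intro!: continuous_intros\<close>)
    then show ?thesis by (auto simp: C_def)
  qed
  have y1: "y' r \<ge> 1" if "r \<ge> R1" for r
  proof -
    have r: "r \<ge> R" "r \<ge> 1" "r \<ge> n * (C + 1) / \<kappa>" using that by (auto simp: R1_def)
    have rn: "r ^ n = r ^ (n - 1) * r" using n by (cases n) auto
    have "\<kappa> * r / n \<ge> C + 1" using r(3) n \<kappa> by (simp add: field_simps)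
    then have "r ^ (n - 1) * (C + 1) \<le> r ^ (n - 1) * (\<kappa> * r / n)"
      using r by (intro mult_left_mono) auto
    moreover have "C * 1 \<le> C * r ^ (n - 1)" using C r by (intro mult_left_mono) auto
    ultimately have "r ^ (n - 1) * 1 \<le> r ^ (n - 1) * y' r"
      using q[OF r(1)] by (simp add: q_def rn algebra_simps)
    then show ?thesis using r(2) by simp
  qed
  define R' where "R' = max R1 (R1 + A - y R1)"
  have R1: "R1 \<ge> R" by (simp add: R1_def)
  have "y r \<ge> A" if "r \<ge> R'" for r
  proof -
    have "r - R1 \<le> y r - y R1"
    proof (rule increment_mono[where f="\<lambda>x. x" and f'="\<lambda>_. 1" and g'=y'])
      show "R1 \<le> r" using that by (simp add: R'_def)
      show "continuous_on {R1..r} y"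
        by (rule continuous_on_of_deriv, rule y) (use R1 in auto)
      show "DERIV y x :> y' x" "1 \<le> y' x" if "R1 < x" for x
        using y[of x] y1[of x] R1 that by auto
    qed (auto intro!: continuous_intros derivative_intros)
    moreover have "r - R1 \<ge> A - y R1" using that by (simp add: R'_def)
    ultimately show ?thesis by linarith
  qed
  moreover have "y' r > 0" if "r \<ge> R'" for r using y1[of r] that by (auto simp: R'_def)
  moreover have "R \<le> R'" using R1 by (simp add: R'_def)
  ultimately show ?thesis by blast
qed

text \<open>
  The quantitative step of the blow-up argument: on \<open>[r, 2r]\<close> the weight \<open>r\<^sup>n\<^sup>-\<^sup>1\<close> varies by a
  bounded factor only, so a source of size \<open>M\<close> raises \<open>y\<close> by a multiple of \<open>M \<delta>\<^sup>2\<close>.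
\<close>

lemma radial_step:
  fixes y y' z :: "real \<Rightarrow> real"
  assumes n: "n \<ge> 1" and r: "r > 0" and \<delta>: "0 \<le> \<delta>" "\<delta> \<le> r" and M: "M \<ge> 0"
    and y: "\<And>s. r \<le> s \<Longrightarrow> s \<le> r + \<delta> \<Longrightarrow> DERIV y s :> y' s"
    and flux: "\<And>s. r \<le> s \<Longrightarrow> s \<le> r + \<delta> \<Longrightarrow>
        DERIV (\<lambda>r. r ^ (n - 1) * y' r) s :> s ^ (n - 1) * z s"
    and z: "\<And>s. r \<le> s \<Longrightarrow> s \<le> r + \<delta> \<Longrightarrow> z s \<ge> M"
    and y'0: "y' r \<ge> 0"
  shows "y (r + \<delta>) \<ge> y r + M * \<delta>\<^sup>2 / 2 ^ n"
proof -
  have q: "r ^ (n - 1) * M * (s - r) \<le> s ^ (n - 1) * y' s" if s: "r \<le> s" "s \<le> r + \<delta>" for s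
  proof -
    have "r ^ (n - 1) * M * s - r ^ (n - 1) * M * r \<le> s ^ (n - 1) * y' s - r ^ (n - 1) * y' r"
    proof (rule increment_mono[where a=r and b=s])
      show "DERIV (\<lambda>r. r ^ (n - 1) * y' r) x :> x ^ (n - 1) * z x" if "r < x" "x < s" for x
        using flux[of x] that s by auto
      show "continuous_on {r..s} (\<lambda>r. r ^ (n - 1) * y' r)"
        by (rule continuous_on_of_deriv, rule flux) (use s in auto)
      show "DERIV (\<lambda>x. r ^ (n - 1) * M * x) x :> r ^ (n - 1) * M" for x
        by (auto intro!: derivative_eq_intros)
      show "r ^ (n - 1) * M \<le> x ^ (n - 1) * z x" if "r < x" "x < s" for x
        using that s r z[of x] M by (intro mult_mono power_mono) auto
    qed (use s in \<open>auto intro!: continuous_intros\<close>)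
    moreover have "0 \<le> r ^ (n - 1) * y' r" using y'0 r by auto
    ultimately show ?thesis by (simp add: right_diff_distrib)
  qed
  have y'1: "y' s \<ge> M * (s - r) / 2 ^ (n - 1)" if s: "r \<le> s" "s \<le> r + \<delta>" for s
  proof -
    have "s ^ (n - 1) \<le> (2 * r) ^ (n - 1)" using s r \<delta> by (intro power_mono) auto
    then have "s ^ (n - 1) * (M * (s - r)) \<le> (2 * r) ^ (n - 1) * (M * (s - r))"
      using M s by (intro mult_right_mono) auto
    also have "\<dots> = 2 ^ (n - 1) * (r ^ (n - 1) * M * (s - r))" by (simp add: power_mult_distrib)
    also have "\<dots> \<le> 2 ^ (n - 1) * (s ^ (n - 1) * y' s)" using q[OF s] by simp
    finally have "s ^ (n - 1) * (M * (s - r)) \<le> s ^ (n - 1) * (2 ^ (n - 1) * y' s)" by (simp add: mult_ac)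
    then have "M * (s - r) \<le> 2 ^ (n - 1) * y' s" using s r by simp
    then show ?thesis by (simp add: field_simps)
  qed
  have n2: "(2::real) ^ n = 2 * 2 ^ (n - 1)" using n by (cases n) auto
  have "M * (r + \<delta> - r)\<^sup>2 / 2 ^ n - M * (r - r)\<^sup>2 / 2 ^ n \<le> y (r + \<delta>) - y r"
  proof (rule increment_mono[where a=r and b="r+\<delta>" and g'=y'])
    show "DERIV (\<lambda>s. M * (s - r)\<^sup>2 / 2 ^ n) x :> M * (x - r) / 2 ^ (n - 1)" for x
      unfolding n2 by (auto intro!: derivative_eq_intros simp: field_simps)
    show "continuous_on {r..r+\<delta>} y"
      by (rule continuous_on_of_deriv, rule y) auto
    show "DERIV y x :> y' x" "M * (x - r) / 2 ^ (n - 1) \<le> y' x"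
      if "r < x" "x < r + \<delta>" for x
      using y[of x] y'1[of x] that by auto
  qed (use \<delta> in \<open>auto intro!: continuous_intros\<close>)
  then show ?thesis by simp
qed

section \<open>Radial Poisson equations, finite-radius blow-up and the Pohozaev inequality\<close>

text \<open>
  The solution may vanish before its positivity is known, so the derivative is needed at \<open>0\<close> as well.
\<close>

lemma DERIV_abs_powr:
  fixes x q :: real assumes q: "q > 0"
  shows "DERIV (\<lambda>x. \<bar>x\<bar> powr (q + 1)) x :> (q + 1) * (\<bar>x\<bar> powr (q - 1) * x)"
proof -
  consider "x > 0" | "x < 0" | "x = 0" by linarith
  then show ?thesis
  proof cases
    case 1
    have "DERIV (\<lambda>x. x powr (q + 1)) x :> (q + 1) * x powr q"
      using 1 by (auto intro!: derivative_eq_intros)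
    moreover have "x powr (q - 1) * x = x powr q"
      using 1 by (simp add: powr_mult_base mult.commute)
    ultimately show ?thesis using 1
      by (auto intro!: has_field_derivative_transform_within_open[where S="{0<..}" and f="\<lambda>x. x powr (q + 1)"])
  next
    case 2
    have "DERIV (\<lambda>x. (- x) powr (q + 1)) x :> (q + 1) * (- x) powr q * (- 1)"
      using 2 by (auto intro!: derivative_eq_intros)
    moreover have "(- x) powr (q - 1) * x = (- x) powr q * (- 1)"
      using powr_mult_base[of "- x" "q - 1"] 2 by (simp add: mult.commute)
    ultimately show ?thesis using 2
      by (auto intro!: has_field_derivative_transform_within_open[where S="{..<0}" and f="\<lambda>x. (- x) powr (q + 1)"])
  next
    case 3
    have "((\<lambda>h::real. \<bar>h\<bar> powr (q + 1) / h) \<longlongrightarrow> 0) (at 0)"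
    proof (rule tendsto_rabs_zero_cancel)
      have "((\<lambda>h::real. \<bar>h\<bar> powr q) \<longlongrightarrow> 0 powr q) (at 0)"
        using q by (intro tendsto_powr' tendsto_rabs_zero) (auto intro!: tendsto_eq_intros)
      then have "((\<lambda>h::real. \<bar>h\<bar> powr q) \<longlongrightarrow> 0) (at 0)" by simp
      moreover have "\<bar>\<bar>h\<bar> powr (q + 1) / h\<bar> = \<bar>h\<bar> powr q" for h :: real
        by (cases "h = 0") (auto simp: abs_divide powr_add)
      ultimately show "((\<lambda>h::real. \<bar>\<bar>h\<bar> powr (q + 1) / h\<bar>) \<longlongrightarrow> 0) (at 0)" by simp
    qed
    then show ?thesis using 3 q by (simp add: DERIV_def)
  qed
qed


text \<open>
  The equation \<open>- \<Delta> y = z\<close> for radial functions that are regular at the origin.  Continuity of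
  \<open>y'\<close> at \<open>0\<close> is how regularity enters: it makes the flux start from \<open>0\<close>.
\<close>

locale radial_poisson =
  fixes n :: nat and y y' z :: "real \<Rightarrow> real"
  assumes n_ge: "n \<ge> 5"
    and cont: "continuous_on {0..} y" and cont': "continuous_on {0..} y'"
    and deriv: "r > 0 \<Longrightarrow> DERIV y r :> y' r"
    and flux: "r > 0 \<Longrightarrow> DERIV (\<lambda>r. r ^ (n - 1) * y' r) r :> - (r ^ (n - 1) * z r)"
begin

lemma uminus: "radial_poisson n (\<lambda>r. - y r) (\<lambda>r. - y' r) (\<lambda>r. - z r)"
proof
  show "DERIV (\<lambda>r. r ^ (n - 1) * - y' r) r :> - (r ^ (n - 1) * - z r)" if "r > 0" for r
    using flux[OF that, THEN DERIV_minus] by simp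
qed (auto intro!: n_ge continuous_intros cont cont' deriv DERIV_minus)

lemma flux_cont: "continuous_on {0..} (\<lambda>r. r ^ (n - 1) * y' r)"
  by (intro continuous_intros cont')

lemma flux_antimono:
  assumes "0 \<le> a" "a \<le> b" "\<And>x. a < x \<Longrightarrow> x < b \<Longrightarrow> z x \<ge> 0"
  shows "b ^ (n - 1) * y' b \<le> a ^ (n - 1) * y' a"
  by (rule nonincreasing_of_deriv[OF assms(2) continuous_on_subset[OF flux_cont] flux])
    (use assms in auto)

lemma flux_strict_antimono:
  assumes "0 \<le> a" "a < b" "\<And>x. a < x \<Longrightarrow> x < b \<Longrightarrow> z x > 0"
  shows "b ^ (n - 1) * y' b < a ^ (n - 1) * y' a"
  by (rule decreasing_of_deriv[OF assms(2) continuous_on_subset[OF flux_cont] flux])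
    (use assms in auto)

lemma antimono:
  assumes "0 \<le> a" "a \<le> b" "\<And>x. a < x \<Longrightarrow> x < b \<Longrightarrow> y' x \<le> 0"
  shows "y b \<le> y a"
  by (rule nonincreasing_of_deriv[OF assms(2) continuous_on_subset[OF cont] deriv])
    (use assms in auto)

lemma strict_antimono:
  assumes "0 \<le> a" "a < b" "\<And>x. a < x \<Longrightarrow> x < b \<Longrightarrow> y' x < 0"
  shows "y b < y a"
  by (rule decreasing_of_deriv[OF assms(2) continuous_on_subset[OF cont] deriv])
    (use assms in auto)

lemma deriv_sign:
  assumes "r > 0"
  shows "r ^ (n - 1) * y' r \<le> 0 \<longleftrightarrow> y' r \<le> 0" "r ^ (n - 1) * y' r < 0 \<longleftrightarrow> y' r < 0"
  using mult_le_cancel_left_pos[OF zero_less_power[OF assms], of "n - 1" "y' r" 0]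
    mult_less_cancel_left_pos[OF zero_less_power[OF assms], of "n - 1" "y' r" 0] by simp_all

lemma deriv_nonpos:
  assumes "0 \<le> a" "a < b" "a ^ (n - 1) * y' a \<le> 0" "\<And>x. a < x \<Longrightarrow> x < b \<Longrightarrow> z x \<ge> 0"
  shows "y' b \<le> 0"
  using flux_antimono[of a b] assms deriv_sign(1)[of b] by simp

lemma deriv_neg:
  assumes "0 \<le> a" "a < b" "a ^ (n - 1) * y' a \<le> 0" "\<And>x. a < x \<Longrightarrow> x < b \<Longrightarrow> z x > 0"
  shows "y' b < 0"
  using flux_strict_antimono[of a b] assms deriv_sign(2)[of b] by simp

lemma flux_zero: "0 ^ (n - 1) * y' 0 = 0"
  using n_ge by simp

lemma unbounded_below:
  assumes "R \<ge> 0" "\<kappa> > 0" "\<And>r. r \<ge> R \<Longrightarrow> z r \<ge> \<kappa>"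
  shows "\<exists>R'\<ge>R. \<forall>r\<ge>R'. y r \<le> A \<and> y' r < 0"
proof -
  have "\<exists>R'\<ge>R + 1. \<forall>r\<ge>R'. - y r \<ge> - A \<and> - y' r > 0"
  proof (rule radial_growth[where n=n and e=z])
    show "DERIV (\<lambda>r. r ^ (n - 1) * - y' r) r :> r ^ (n - 1) * z r" if "R + 1 \<le> r" for r
      using flux[of r, THEN DERIV_minus] that assms by simp
    show "DERIV (\<lambda>r. - y r) r :> - y' r" if "R + 1 \<le> r" for r
      using deriv[of r, THEN DERIV_minus] that assms by simp
  qed (use n_ge assms in auto)
  then obtain R' where "R' \<ge> R + 1" "\<forall>r\<ge>R'. - y r \<ge> - A \<and> - y' r > 0" by blast
  then show ?thesis by (intro exI[of _ R']) auto
qed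

end

locale radial_profile =
  fixes n :: nat and p :: real and u u' h h' :: "real \<Rightarrow> real"
  assumes u_poisson: "radial_poisson n u u' h"
    and h_poisson: "radial_poisson n h h' (\<lambda>r. \<bar>u r\<bar> powr (p - 1) * u r)"
    and supercritical: "(real n + 4) / (real n - 4) < p"
begin

sublocale U: radial_poisson n u u' h by (rule u_poisson)
sublocale H: radial_poisson n h h' "\<lambda>r. \<bar>u r\<bar> powr (p - 1) * u r" by (rule h_poisson)

lemma p_gt_1: "p > 1"
proof -
  have "1 < (real n + 4) / (real n - 4)" using U.n_ge by (simp add: field_simps)
  with supercritical show ?thesis by linarith
qed

lemma pow_pos: "x > 0 \<Longrightarrow> \<bar>x\<bar> powr (p - 1) * x = x powr p"
  using powr_mult_base[of x "p - 1"] by (simp add: mult.commute)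

lemma profile_uminus: "radial_profile n p (\<lambda>r. - u r) (\<lambda>r. - u' r) (\<lambda>r. - h r) (\<lambda>r. - h' r)"
  using U.uminus H.uminus supercritical by unfold_locales (auto simp: radial_poisson_def)

text \<open>
  A lower bound \<open>c > 0\<close> forces \<open>h \<rightarrow> - \<infinity>\<close> and then \<open>u \<rightarrow> \<infinity>\<close>.  Two steps of length \<open>\<delta>\<close> give
  \<open>u (r + 2 \<delta>) \<ge> c\<^sub>n \<delta>\<^sup>4 (u r)\<^sup>p\<close>.  With \<open>\<delta> = 2\<^sup>-\<^sup>k\<close> the radii stay bounded while
  superlinearity beats the factor \<open>16\<^sup>-\<^sup>k\<close>, so \<open>u\<close> is unbounded on a compact interval.
\<close>

lemma no_positive_lower_bound:
  assumes c: "c > 0" and R: "R \<ge> 0" and lower: "\<And>r. r \<ge> R \<Longrightarrow> u r \<ge> c"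
  shows False
proof -
  have "\<exists>R'\<ge>R. \<forall>r\<ge>R'. h r \<le> - 1 \<and> h' r < 0"
  proof (rule H.unbounded_below)
    show "c powr p \<le> \<bar>u r\<bar> powr (p - 1) * u r" if "R \<le> r" for r
      using lower[OF that] c p_gt_1 by (subst pow_pos) (auto intro!: powr_mono2)
  qed (use R c in auto)
  then obtain R1 where R1: "R1 \<ge> R" and h1: "\<And>r. r \<ge> R1 \<Longrightarrow> h r \<le> - 1" "\<And>r. r \<ge> R1 \<Longrightarrow> h' r < 0"
    by blast
  \<comment> \<open>\<open>B\<^sup>p\<^sup>-\<^sup>1 = 16\<close> absorbs the loss \<open>\<delta>\<^sup>4 = 16\<^sup>-\<^sup>k\<close>, and \<open>A\<close> the dimensional constant, so that the lower
    bound \<open>A B\<^sup>k\<close> reproduces itself.\<close>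
  define B where "B = 16 powr (1 / (p - 1))"
  define A where "A = (4 ^ n * B) powr (1 / (p - 1))"
  have B: "B > 1" using p_gt_1 by (auto simp: B_def intro!: gr_one_powr)
  have A: "A > 0" using B by (simp add: A_def)
  have Bp: "B powr (p - 1) = 16" using p_gt_1 by (simp add: B_def powr_powr)
  have Ap: "A powr (p - 1) = 4 ^ n * B" using p_gt_1 B by (simp add: A_def powr_powr)
  have "\<exists>R'\<ge>R1. \<forall>r\<ge>R'. - u r \<le> - A \<and> - u' r < 0"
    using radial_poisson.unbounded_below[OF U.uminus, of R1 1 "- A"] h1 R R1 by auto
  then obtain R2 where R2: "R2 \<ge> R1" and u2: "\<And>r. r \<ge> R2 \<Longrightarrow> u r \<ge> A" "\<And>r. r \<ge> R2 \<Longrightarrow> u' r > 0"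
    by auto
  define R3 where "R3 = max R2 1"
  have R3: "R3 \<ge> 1" "R3 \<ge> R2" "R3 \<ge> R1" using R2 by (auto simp: R3_def)
  have u_mono: "u a \<le> u b" if "R3 \<le> a" "a \<le> b" for a b
  proof -
    have "- u b \<le> - u a"
      by (rule radial_poisson.antimono[OF U.uminus]) (use that R3 in \<open>auto intro!: less_imp_le u2(2)\<close>)
    then show ?thesis by simp
  qed
  have h_mono: "h b \<le> h a" if "R3 \<le> a" "a \<le> b" for a b
    by (rule H.antimono) (use that R3 in \<open>auto intro!: less_imp_le h1(2)\<close>)
  have step: "u (r + 2 * \<delta>) \<ge> u r powr p * \<delta> ^ 4 / 4 ^ n"
    if r: "r \<ge> R3" and \<delta>: "0 \<le> \<delta>" "\<delta> \<le> 1" for r \<delta>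
  proof -
    have "- h (r + \<delta>) \<ge> - h r + u r powr p * \<delta>\<^sup>2 / 2 ^ n"
    proof (rule radial_step[where z="\<lambda>r. \<bar>u r\<bar> powr (p - 1) * u r" and y="\<lambda>r. - h r" and y'="\<lambda>r. - h' r"])
      show "DERIV (\<lambda>r. - h r) s :> - h' s" if "r \<le> s" for s
        using H.deriv[of s, THEN DERIV_minus] that r R3 by simp
      show "DERIV (\<lambda>r. r ^ (n - 1) * - h' r) s :> s ^ (n - 1) * (\<bar>u s\<bar> powr (p - 1) * u s)"
        if "r \<le> s" for s
        using H.flux[of s, THEN DERIV_minus] that r R3 by simp
      show "u r powr p \<le> \<bar>u s\<bar> powr (p - 1) * u s" if "r \<le> s" for s
        using u_mono[OF r that] u2(1)[of r] u2(1)[of s] r R3 A that p_gt_1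
        by (subst pow_pos) (auto intro!: powr_mono2)
      show "0 \<le> - h' r" using h1(2)[of r] r R3 by simp
    qed (use U.n_ge r R3 \<delta> in auto)
    moreover have "- h r \<ge> 0" using h1(1)[of r] r R3 by simp
    ultimately have 1: "- h (r + \<delta>) \<ge> u r powr p * \<delta>\<^sup>2 / 2 ^ n" by linarith
    have "u (r + \<delta> + \<delta>) \<ge> u (r + \<delta>) + (u r powr p * \<delta>\<^sup>2 / 2 ^ n) * \<delta>\<^sup>2 / 2 ^ n"
    proof (rule radial_step[where z="\<lambda>r. - h r" and y'=u'])
      show "DERIV u s :> u' s" if "r + \<delta> \<le> s" for s
        using U.deriv[of s] that r R3 \<delta> by simp
      show "DERIV (\<lambda>r. r ^ (n - 1) * u' r) s :> s ^ (n - 1) * - h s"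
        if "r + \<delta> \<le> s" for s
        using U.flux[of s] that r R3 \<delta> by simp
      show "u r powr p * \<delta>\<^sup>2 / 2 ^ n \<le> - h s" if "r + \<delta> \<le> s" for s
        using 1 h_mono[of "r + \<delta>" s] that r \<delta> by auto
      show "0 \<le> u' (r + \<delta>)" using u2(2)[of "r + \<delta>"] r R3 \<delta> by simp
    qed (use U.n_ge r R3 \<delta> in auto)
    moreover have "u (r + \<delta>) \<ge> 0" using u2(1)[of "r + \<delta>"] r R3 \<delta> A by simp
    moreover have "(u r powr p * \<delta>\<^sup>2 / 2 ^ n) * \<delta>\<^sup>2 / 2 ^ n = u r powr p * \<delta> ^ 4 / 4 ^ n"
    proof -
      have "(4::real) ^ n = 2 ^ n * 2 ^ n" by (simp flip: power_mult_distrib)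
      then show ?thesis by (simp add: power2_eq_square power4_eq_xxxx)
    qed
    moreover have "r + \<delta> + \<delta> = r + 2 * \<delta>" by simp
    ultimately show ?thesis by (metis add_increasing order_trans order_refl)
  qed
  define \<rho> where "\<rho> = (\<lambda>k::nat. R3 + 4 - 4 / 2 ^ k)"
  have \<rho>: "\<rho> k \<ge> R3" "\<rho> k \<le> R3 + 4" for k by (auto simp: \<rho>_def field_simps)
  have lower_\<rho>: "u (\<rho> k) \<ge> A * B ^ k" for k
  proof (induction k)
    case 0
    show ?case using u2(1)[of R3] R3 by (simp add: \<rho>_def)
  next
    case (Suc k)
    have Bk: "(B ^ k) powr (p - 1) = 16 ^ k"
    proof -
      have "(B ^ k) powr (p - 1) = (B powr real k) powr (p - 1)" using B by (simp add: powr_realpow)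
      also have "\<dots> = (B powr (p - 1)) powr real k" by (simp only: powr_powr mult.commute)
      finally show ?thesis by (simp add: Bp powr_realpow)
    qed
    have pos: "A * B ^ k > 0" using A B by simp
    have "A * B ^ Suc k = (A * B ^ k) * ((4 ^ n * B) * 16 ^ k) * (1 / 2 ^ k) ^ 4 / 4 ^ n"
    proof -
      have "((1::real) / 2 ^ k) ^ 4 = 1 / 16 ^ k"
        by (simp add: power_divide power_mult[symmetric] mult.commute[of k]) (simp add: power_mult)
      then show ?thesis by simp
    qed
    also have "\<dots> = (A * B ^ k) powr p * (1 / 2 ^ k) ^ 4 / 4 ^ n"
      using pow_pos[OF pos] pos A B Bk by (simp add: powr_mult Ap mult_ac)
    also have "\<dots> \<le> u (\<rho> k) powr p * (1 / 2 ^ k) ^ 4 / 4 ^ n"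
      using Suc pos p_gt_1 by (intro divide_right_mono mult_right_mono powr_mono2) auto
    also have "\<dots> \<le> u (\<rho> k + 2 * (1 / 2 ^ k))"
      by (rule step) (use \<rho> in auto)
    also have "\<rho> k + 2 * (1 / 2 ^ k) = \<rho> (Suc k)" by (simp add: \<rho>_def field_simps)
    finally show ?case .
  qed
  obtain k where "u (R3 + 4) / A < B ^ k" using real_arch_pow[OF B] by blast
  then have "u (R3 + 4) < A * B ^ k" using A by (simp add: field_simps)
  also have "\<dots> \<le> u (\<rho> k)" by (rule lower_\<rho>)
  also have "\<dots> \<le> u (R3 + 4)" by (rule u_mono) (use \<rho> in auto)
  finally show False by simp
qed

text \<open>
  The derivative of the left-hand side is
  \<open>(n / (p + 1) - (n - 4) / 2) r\<^sup>n\<^sup>-\<^sup>1 \<bar>u\<bar>\<^sup>p\<^sup>+\<^sup>1\<close>: the weights \<open>n / 2\<close> and \<open>(n - 4) / 2\<close> of the two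
  boundary terms add up to \<open>n - 2\<close>, which removes the \<open>u' h'\<close> term, and the first removes \<open>h\<^sup>2\<close>.
  Supercriticality is the negativity of the remaining coefficient.
\<close>

lemma pohozaev:
  assumes r: "r \<ge> 0"
  shows "r ^ n * (u' r * h' r + (h r)\<^sup>2 / 2 + \<bar>u r\<bar> powr (p + 1) / (p + 1))
     + real n / 2 * (r ^ (n - 1) * u' r * h r) + (real n - 4) / 2 * (r ^ (n - 1) * u r * h' r) \<le> 0"
proof -
  define q where "q = (\<lambda>r. r ^ (n - 1) * u' r)"
  define k where "k = (\<lambda>r. r ^ (n - 1) * h' r)"
  define S where "S = (\<lambda>r. \<bar>u r\<bar> powr (p - 1) * u r)"
  define P where "P = (\<lambda>r. r ^ n * (u' r * h' r + (h r)\<^sup>2 / 2 + \<bar>u r\<bar> powr (p + 1) / (p + 1))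
     + real n / 2 * (r ^ (n - 1) * u' r * h r) + (real n - 4) / 2 * (r ^ (n - 1) * u r * h' r))"
  obtain l where n: "n = Suc (Suc (Suc l))" using U.n_ge by (intro that[of "n - 3"]) auto
  have "P r \<le> P 0"
  proof (rule nonincreasing_of_deriv[OF r])
    show "continuous_on {0..r} P"
      unfolding P_def using p_gt_1
      by (intro continuous_intros continuous_on_subset[OF U.cont] continuous_on_subset[OF H.cont]
        continuous_on_subset[OF U.cont'] continuous_on_subset[OF H.cont'] continuous_on_powr') auto
    show "DERIV P x :> (real n / (p + 1) - (real n - 4) / 2) * x ^ (n - 1) * \<bar>u x\<bar> powr (p + 1)"
      if "0 < x" for x
    proof -
      note du = U.deriv[OF that] and dh = H.deriv[OF that]
      have dq: "DERIV q x :> - (x ^ (n - 1) * h x)" using U.flux[OF that] by (simp add: q_def)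
      have dk: "DERIV k x :> - (x ^ (n - 1) * S x)" using H.flux[OF that] by (simp add: k_def S_def)
      have dF: "DERIV (\<lambda>r. \<bar>u r\<bar> powr (p + 1)) x :> (p + 1) * S x * u' x"
        using DERIV_chain2[OF DERIV_abs_powr[of p "u x"] du] p_gt_1 by (simp add: S_def mult_ac)
      have su: "S x * u x = \<bar>u x\<bar> powr (p + 1)"
      proof (cases "u x = 0")
        case False
        have "\<bar>u x\<bar> powr (p + 1) = \<bar>u x\<bar> powr (p - 1) * \<bar>u x\<bar> powr 2"
          by (subst powr_add[symmetric]) (simp add: add.commute)
        also have "\<bar>u x\<bar> powr 2 = u x * u x" using False by (simp add: powr_numeral power2_eq_square)
        finally show ?thesis by (simp add: S_def)
      qed (simp add: S_def)
      \<comment> \<open>The product \<open>r\<^sup>n u' h'\<close> is rewritten through the two fluxes, whose derivatives are known.\<close>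
      let ?Q = "\<lambda>r. q r * k r / r ^ Suc l + r ^ n * ((h r)\<^sup>2 / 2 + \<bar>u r\<bar> powr (p + 1) / (p + 1))
        + real n / 2 * (q r * h r) + (real n - 4) / 2 * (u r * k r)"
      have d1: "DERIV (\<lambda>r. q r * k r / r ^ Suc l) x :>
          ((- (x ^ (n - 1) * h x) * k x + - (x ^ (n - 1) * S x) * q x) * x ^ Suc l
            - q x * k x * (real (Suc l) * x ^ l)) / (x ^ Suc l * x ^ Suc l)"
      proof (rule DERIV_divide[OF DERIV_mult[OF dq dk]])
        show "DERIV (\<lambda>r. r ^ Suc l) x :> real (Suc l) * x ^ l"
          using DERIV_pow[of "Suc l" x] by simp
      qed (use that in simp)
      have d2: "DERIV (\<lambda>r. r ^ n * ((h r)\<^sup>2 / 2 + \<bar>u r\<bar> powr (p + 1) / (p + 1))) x :>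
          real n * x ^ (n - 1) * ((h x)\<^sup>2 / 2 + \<bar>u x\<bar> powr (p + 1) / (p + 1))
            + (h x * h' x + S x * u' x) * x ^ n"
      proof (rule DERIV_mult)
        show "DERIV (\<lambda>r. r ^ n) x :> real n * x ^ (n - 1)"
          using DERIV_pow[of n x] by simp
        show "DERIV (\<lambda>r. (h r)\<^sup>2 / 2 + \<bar>u r\<bar> powr (p + 1) / (p + 1)) x :>
           h x * h' x + S x * u' x"
        proof (rule DERIV_cong[OF DERIV_add[OF _ DERIV_cdivide[OF dF]]])
          show "DERIV (\<lambda>r. (h r)\<^sup>2 / 2) x :> h x * h' x"
            by (auto intro!: derivative_eq_intros dh)
        qed (use p_gt_1 in simp)
      qed
      note dQ = DERIV_add[OF DERIV_add[OF DERIV_add[OF d1 d2] DERIV_cmult[OF DERIV_mult[OF dq dh], of "real n / 2"]]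
        DERIV_cmult[OF DERIV_mult[OF du dk], of "(real n - 4) / 2"]]
      have "DERIV ?Q x :> (real n / (p + 1) - (real n - 4) / 2) * x ^ (n - 1) * \<bar>u x\<bar> powr (p + 1)"
      proof (rule DERIV_cong[OF dQ])
        define X where "X = x ^ l"
        have X: "X \<noteq> 0" "x \<noteq> 0" using that by (auto simp: X_def)
        have px: "x ^ Suc l = x * X" "x ^ (n - 1) = x * x * X" "x ^ n = x * x * x * X" "x ^ l = X"
          by (simp_all add: n X_def)
        have rn: "real (Suc l) = real n - 2" by (simp add: n)
        show "((- (x ^ (n - 1) * h x) * k x + - (x ^ (n - 1) * S x) * q x) * x ^ Suc l
            - q x * k x * (real (Suc l) * x ^ l)) / (x ^ Suc l * x ^ Suc l)
          + (real n * x ^ (n - 1) * ((h x)\<^sup>2 / 2 + \<bar>u x\<bar> powr (p + 1) / (p + 1))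
            + (h x * h' x + S x * u' x) * x ^ n)
          + real n / 2 * (- (x ^ (n - 1) * h x) * h x + h' x * q x)
          + (real n - 4) / 2 * (u' x * k x + - (x ^ (n - 1) * S x) * u x)
          = (real n / (p + 1) - (real n - 4) / 2) * x ^ (n - 1) * \<bar>u x\<bar> powr (p + 1)"
          unfolding q_def k_def su[symmetric] px rn using X p_gt_1
          by (simp add: divide_simps power2_eq_square) algebra
      qed
      then show ?thesis
        by (rule has_field_derivative_transform_within_open[where S="{0<..}"])
          (use that in \<open>auto simp: P_def q_def k_def n field_simps\<close>)
    qed
    have "real n / (p + 1) \<le> (real n - 4) / 2"
      using supercritical p_gt_1 U.n_ge by (simp add: field_simps)
    then show "(real n / (p + 1) - (real n - 4) / 2) * x ^ (n - 1) * \<bar>u x\<bar> powr (p + 1) \<le> 0"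
      if "0 < x" for x
      using that by (intro mult_nonpos_nonneg) auto
  qed
  moreover have "P 0 = 0" by (simp add: P_def n)
  ultimately have "P r \<le> 0" by simp
  then show ?thesis unfolding P_def .
qed

end

section \<open>Positivity and decay of entire solutions\<close>

context radial_poisson begin

lemma nonincreasing_from:
  assumes "0 \<le> a" "a \<le> b" "a ^ (n - 1) * y' a \<le> 0" "\<And>x. a < x \<Longrightarrow> x < b \<Longrightarrow> z x \<ge> 0"
  shows "y b \<le> y a"
  by (rule antimono[OF assms(1,2)], rule deriv_nonpos[OF assms(1) _ assms(3)]) (use assms(4) in auto)

lemma nondecreasing_from:
  assumes "0 \<le> a" "a \<le> b" "a ^ (n - 1) * y' a \<ge> 0" "\<And>x. a < x \<Longrightarrow> x < b \<Longrightarrow> z x \<le> 0"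
  shows "y a \<le> y b"
  using radial_poisson.nonincreasing_from[OF uminus, of a b] assms by simp

lemma zero_power_dim [simp]: "0 ^ (n - Suc 0) = (0::real)"
  using n_ge by simp

text \<open>
  Over a short interval the equation gains the square of its length.  This gives uniqueness at the
  singular point \<open>r = 0\<close>, where a Gronwall argument for the first-order system is not available.
\<close>

lemma small_above:
  assumes a: "0 \<le> a" and M: "M \<ge> 0" and y: "y a \<le> 0" "a ^ (n - 1) * y' a \<le> 0"
    and z: "\<And>x. a < x \<Longrightarrow> x < b \<Longrightarrow> - M \<le> z x" and r: "a \<le> r" "r \<le> b"
  shows "y r \<le> M * (b - a)\<^sup>2"
proof -
  have y': "y' x \<le> M * (b - a)" if x: "a < x" "x < b" for x
  proof -
    have "x ^ (n - 1) * y' x - a ^ (n - 1) * y' a \<le> (M * x ^ (n - 1)) * x - (M * x ^ (n - 1)) * a"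
    proof (rule increment_mono[OF _ continuous_on_subset[OF flux_cont] _ flux])
      show "DERIV (\<lambda>s. (M * x ^ (n - 1)) * s) t :> (M * x ^ (n - 1))" for t
        by (auto intro!: derivative_eq_intros)
      show "- (t ^ (n - 1) * z t) \<le> M * x ^ (n - 1)" if t: "a < t" "t < x" for t
      proof -
        have "t ^ (n - 1) * (- z t) \<le> t ^ (n - 1) * M" using t a x z[of t] by (intro mult_left_mono) auto
        also have "\<dots> \<le> x ^ (n - 1) * M" using t a M by (intro mult_right_mono power_mono) auto
        finally show ?thesis by (simp add: mult.commute)
      qed
    qed (use a x in \<open>auto intro!: continuous_intros\<close>)
    then have "x ^ (n - 1) * y' x \<le> x ^ (n - 1) * (M * (x - a))"
      using y(2) by (simp add: algebra_simps)
    then have "y' x \<le> M * (x - a)" using a x by simp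
    also have "\<dots> \<le> M * (b - a)" using M x by (intro mult_left_mono) auto
    finally show ?thesis .
  qed
  have "y r - y a \<le> M * (b - a) * r - M * (b - a) * a"
  proof (rule increment_mono[OF _ continuous_on_subset[OF cont] _ deriv])
    show "DERIV (\<lambda>s. M * (b - a) * s) t :> M * (b - a)" for t
      by (auto intro!: derivative_eq_intros)
  qed (use a r y' in \<open>auto intro!: continuous_intros\<close>)
  also have "\<dots> = M * (b - a) * (r - a)" by (simp add: algebra_simps)
  also have "\<dots> \<le> M * (b - a) * (b - a)" using M r by (intro mult_left_mono) auto
  finally show ?thesis using y(1) by (simp add: power2_eq_square mult.assoc)
qed

lemma small_abs:
  assumes a: "0 \<le> a" and M: "M \<ge> 0" and y: "y a = 0" "a ^ (n - 1) * y' a = 0"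
    and z: "\<And>x. a < x \<Longrightarrow> x < b \<Longrightarrow> \<bar>z x\<bar> \<le> M" and r: "a \<le> r" "r \<le> b"
  shows "\<bar>y r\<bar> \<le> M * (b - a)\<^sup>2"
proof -
  have "y r \<le> M * (b - a)\<^sup>2"
  proof (rule small_above[OF a M eq_refl[OF y(1)] eq_refl[OF y(2)] _ r])
    show "- M \<le> z x" if "a < x" "x < b" for x using z[OF that] by linarith
  qed
  moreover have "- y r \<le> M * (b - a)\<^sup>2"
  proof (rule radial_poisson.small_above[OF uminus a M _ _ _ r])
    show "- M \<le> - z x" if "a < x" "x < b" for x using z[OF that] by linarith
    show "- y a \<le> 0" "a ^ (n - 1) * - y' a \<le> 0" unfolding mult_minus_right y by simp_all
  qed
  ultimately show ?thesis by linarith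
qed

lemma vanishing:
  assumes a: "0 \<le> a" and y0: "y 0 = 0" and z: "\<And>x. 0 < x \<Longrightarrow> x < a \<Longrightarrow> z x = 0" and r: "0 \<le> r" "r \<le> a"
  shows "y r = 0" "r ^ (n - 1) * y' r = 0"
proof -
  have "\<bar>y r\<bar> \<le> 0 * (r - 0)\<^sup>2"
    by (rule small_abs) (use y0 z r flux_zero in auto)
  then show "y r = 0" by simp
  have "r ^ (n - 1) * y' r \<le> 0"
    using flux_antimono[of 0 r] z r flux_zero by simp
  moreover have "r ^ (n - 1) * - y' r \<le> 0"
    using radial_poisson.flux_antimono[OF uminus, of 0 r] z r flux_zero by simp
  ultimately show "r ^ (n - 1) * y' r = 0" by simp
qed

lemma deriv_nonpos_at_first_zero:
  assumes "a < r" "0 < r" "y r = 0" "\<And>s. a \<le> s \<Longrightarrow> s < r \<Longrightarrow> y s > 0"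
  shows "y' r \<le> 0"
proof (rule ccontr)
  assume "\<not> y' r \<le> 0"
  then obtain d where d: "d > 0" "\<And>h. h > 0 \<Longrightarrow> h < d \<Longrightarrow> y (r - h) < y r"
    using DERIV_pos_inc_left[OF deriv[OF assms(2)]] by auto
  define t where "t = min (d / 2) (r - a)"
  have "y (r - t) < y r" using d assms by (intro d(2)) (auto simp: t_def)
  moreover have "y (r - t) > 0" using d assms by (intro assms(4)) (auto simp: t_def)
  ultimately show False using assms(3) by simp
qed

end

context radial_profile begin

lemma source_pos:
  "u r > 0 \<Longrightarrow> \<bar>u r\<bar> powr (p - 1) * u r > 0"
  by auto

text \<open>
  On an interval of length \<open>\<delta> \<le> 1/2\<close> behind the infimum \<open>a\<close> of the nonzero points, two applications of the smallness
  estimate bound the maximum of \<open>\<bar>u\<bar>\<close> by \<open>\<delta>\<^sup>4\<close> times itself.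
\<close>

lemma trivial_of_zero_data:
  assumes "u 0 = 0" "h 0 = 0" "r \<ge> 0"
  shows "u r = 0"
proof (rule ccontr)
  assume nz: "u r \<noteq> 0"
  define Z where "Z = {t. 0 \<le> t \<and> u t \<noteq> 0}"
  define a where "a = Inf Z"
  have ne: "Z \<noteq> {}" and bdd: "bdd_below Z" using nz assms by (auto simp: Z_def)
  have a0: "a \<ge> 0" using ne by (auto simp: a_def Z_def intro!: cInf_greatest)
  have below: "u t = 0" if "0 \<le> t" "t < a" for t
    using cInf_lower[OF _ bdd, of t] that by (force simp: Z_def a_def)
  have h0: "h t = 0" "t ^ (n - 1) * h' t = 0" if "0 \<le> t" "t \<le> a" for t
    using H.vanishing[of a t] a0 assms(2) below that by auto
  have u0: "u t = 0" "t ^ (n - 1) * u' t = 0" if "0 \<le> t" "t \<le> a" for t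
    using U.vanishing[of a t] a0 assms(1) h0 that by auto
  have "continuous (at a within {0..}) u"
    using U.cont a0 by (simp add: continuous_on_eq_continuous_within)
  then obtain d where d: "d > 0" "\<And>t. t \<ge> 0 \<Longrightarrow> \<bar>t - a\<bar> < d \<Longrightarrow> \<bar>u t\<bar> < 1"
    unfolding continuous_within_eps_delta using u0[of a] a0
    by (auto simp: dist_real_def elim!: allE[of _ 1])
  define \<delta> where "\<delta> = min (d / 2) (1 / 2)"
  have \<delta>: "\<delta> > 0" "\<delta> < d" "\<delta> \<le> 1 / 2" using d by (auto simp: \<delta>_def)
  have "\<exists>s\<in>{a..a+\<delta>}. \<forall>t\<in>{a..a+\<delta>}. \<bar>u t\<bar> \<le> \<bar>u s\<bar>"
    using \<delta> a0 by (intro continuous_attains_sup continuous_intros continuous_on_subset[OF U.cont]) auto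
  then obtain s where s: "s \<in> {a..a+\<delta>}" "\<And>t. t \<in> {a..a+\<delta>} \<Longrightarrow> \<bar>u t\<bar> \<le> \<bar>u s\<bar>" by blast
  have S: "\<bar>\<bar>u t\<bar> powr (p - 1) * u t\<bar> \<le> \<bar>u s\<bar>" if "a < t" "t < a + \<delta>" for t
  proof -
    have "\<bar>u t\<bar> powr (p - 1) \<le> 1" using d(2)[of t] that a0 \<delta> p_gt_1 by (intro powr_le1) auto
    then have "\<bar>u t\<bar> powr (p - 1) * \<bar>u t\<bar> \<le> 1 * \<bar>u t\<bar>" by (intro mult_right_mono) auto
    also have "\<dots> \<le> \<bar>u s\<bar>" using s(2)[of t] that by simp
    finally show ?thesis by (simp add: abs_mult)
  qed
  have hs: "\<bar>h t\<bar> \<le> \<bar>u s\<bar> * (a + \<delta> - a)\<^sup>2" if "a \<le> t" "t \<le> a + \<delta>" for t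
    by (rule H.small_abs[OF a0]) (use h0[of a] S a0 that in auto)
  have "\<bar>u s\<bar> \<le> (\<bar>u s\<bar> * (a + \<delta> - a)\<^sup>2) * (a + \<delta> - a)\<^sup>2"
    by (rule U.small_abs[OF a0]) (use u0[of a] hs s(1) a0 in auto)
  moreover have "\<delta>\<^sup>2 \<le> (1 / 2)\<^sup>2" using \<delta> by (intro power_mono) auto
  then have "\<delta>\<^sup>2 * \<delta>\<^sup>2 \<le> (1 / 2)\<^sup>2 * (1 / 2)\<^sup>2" by (intro mult_mono) auto
  then have "\<bar>u s\<bar> * (\<delta>\<^sup>2 * \<delta>\<^sup>2) \<le> \<bar>u s\<bar> * (1 / 16)" by (intro mult_left_mono) (auto simp: power2_eq_square)
  ultimately have "u s = 0" by (simp add: mult.assoc)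
  then have zero: "u t = 0" if "0 \<le> t" "t \<le> a + \<delta>" for t
    using s(2)[of t] u0(1)[of t] that by (cases "t \<le> a") auto
  obtain t where "t \<in> Z" "t < a + \<delta>" using cInf_lessD[OF ne, of "a + \<delta>"] \<delta> by (auto simp: a_def)
  with zero[of t] show False by (auto simp: Z_def)
qed

text \<open>
  With such data the signs reinforce each other: \<open>u\<close> increases while \<open>h \<le> 0\<close>, and \<open>h\<close> decreases
  while \<open>u \<ge> 0\<close>.  So whichever of \<open>u 0\<close> and \<open>h 0\<close> is nonzero keeps its size, and \<open>u\<close> blows up.
\<close>

lemma no_nonneg_nonpos_data:
  assumes u0: "u 0 \<ge> 0" and h0: "h 0 \<le> 0" and nontriv: "u 0 \<noteq> 0 \<or> h 0 \<noteq> 0"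
  shows False
proof (cases "u 0 > 0")
  case True
  have "u 0 / 2 \<le> u r" if r: "r \<ge> 0" for r
  proof (rule ccontr)
    assume "\<not> u 0 / 2 \<le> u r"
    then obtain s where s: "0 < s" "u s = u 0 / 2" "\<And>t. 0 \<le> t \<Longrightarrow> t < s \<Longrightarrow> u t > u 0 / 2"
      using first_hit[of 0 r u "u 0 / 2"] r True continuous_on_subset[OF U.cont, of "{0..r}"] by auto
    have "h t \<le> 0" if "0 \<le> t" "t < s" for t
    proof -
      have "h t \<le> h 0"
      proof (rule H.nonincreasing_from)
        show "0 \<le> \<bar>u x\<bar> powr (p - 1) * u x" if "0 < x" "x < t" for x
          using s(3)[of x] True that \<open>t < s\<close> by simp
      qed (use that H.flux_zero in auto)
      then show ?thesis using h0 by simp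
    qed
    then have "u 0 \<le> u s" by (intro U.nondecreasing_from) (use s U.flux_zero in auto)
    with s True show False by simp
  qed
  then show False using no_positive_lower_bound[of "u 0 / 2" 0] True by auto
next
  case False
  with assms have h0: "h 0 < 0" by auto
  have "h r \<le> h 0 / 2" if r: "r \<ge> 0" for r
  proof (rule ccontr)
    assume "\<not> h r \<le> h 0 / 2"
    moreover have "continuous_on {0..r} (\<lambda>r. - h r)"
      by (intro continuous_intros continuous_on_subset[OF H.cont]) auto
    ultimately obtain s where s: "0 < s" "- h s = - h 0 / 2" "\<And>t. 0 \<le> t \<Longrightarrow> t < s \<Longrightarrow> - h t > - h 0 / 2"
      using first_hit[of 0 r "\<lambda>r. - h r" "- h 0 / 2"] r h0 by auto
    have "u t \<ge> 0" if "0 \<le> t" "t < s" for t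
    proof -
      have "u 0 \<le> u t"
      proof (rule U.nondecreasing_from)
        show "h x \<le> 0" if "0 < x" "x < t" for x
          using s(3)[of x] h0 that \<open>t < s\<close> by simp
      qed (use that U.flux_zero in auto)
      then show ?thesis using u0 by simp
    qed
    then have "h s \<le> h 0" by (intro H.nonincreasing_from) (use s H.flux_zero in auto)
    with s h0 show False by simp
  qed
  then obtain R where "R \<ge> 0" "\<forall>r\<ge>R. - u r \<le> - 1"
    using radial_poisson.unbounded_below[OF U.uminus, of 0 "- h 0 / 2" "- 1"] h0 by auto
  then show False using no_positive_lower_bound[of 1 R] by auto
qed

text \<open>
  All surviving terms of the Pohozaev function are products of numbers of equal sign, so it would be
  positive.  The next lemma is the same with the roles of \<open>u\<close> and \<open>h\<close> exchanged.
\<close>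

lemma no_zero_of_u_after_h:
  assumes "r > 0" "u r = 0" "h r \<le> 0" "u' r \<le> 0" "h' r \<le> 0" "h r < 0 \<or> u' r < 0 \<and> h' r < 0"
  shows False
proof -
  have "0 < u' r * h' r + (h r)\<^sup>2 / 2"
    using assms(6)
  proof
    assume "h r < 0"
    then show ?thesis using assms by (intro add_nonneg_pos mult_nonpos_nonpos) auto
  next
    assume "u' r < 0 \<and> h' r < 0"
    then show ?thesis by (intro add_pos_nonneg mult_neg_neg) auto
  qed
  then have "0 < r ^ n * (u' r * h' r + (h r)\<^sup>2 / 2)" using assms(1) by simp
  moreover have "0 \<le> real n / 2 * (r ^ (n - 1) * (u' r * h r))"
    using assms by (intro mult_nonneg_nonneg mult_nonpos_nonpos) auto
  ultimately show False using pohozaev[of r] assms(1,2) by (simp add: mult.assoc)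
qed

lemma no_zero_of_h_after_u:
  assumes "r > 0" "h r = 0" "u r < 0" "u' r \<le> 0" "h' r \<le> 0"
  shows False
proof -
  have "0 < u' r * h' r + \<bar>u r\<bar> powr (p + 1) / (p + 1)"
    using assms p_gt_1 by (intro add_nonneg_pos mult_nonpos_nonpos) auto
  then have "0 < r ^ n * (u' r * h' r + \<bar>u r\<bar> powr (p + 1) / (p + 1))" using assms(1) by simp
  moreover have "0 \<le> (real n - 4) / 2 * (r ^ (n - 1) * (u r * h' r))"
    using assms U.n_ge by (intro mult_nonneg_nonneg mult_nonpos_nonpos) auto
  ultimately show False using pohozaev[of r] assms(1,2) by (simp add: mult.assoc)
qed

text \<open>
  Three cases at the first zero \<open>a\<close> of \<open>min u h\<close>, where both derivatives are already negative: a common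
  zero contradicts the Pohozaev inequality; if only \<open>h\<close> vanishes, \<open>u\<close> can never vanish afterwards and is
  driven to \<open>\<infinity>\<close>; if only \<open>u\<close> vanishes, \<open>h\<close> can never vanish afterwards and \<open>u\<close> stays below a
  negative constant.
\<close>

lemma positive:
  assumes u0: "u 0 > 0" and r: "r \<ge> 0"
  shows "u r > 0 \<and> h r > 0"
proof (rule ccontr)
  assume neg: "\<not> (u r > 0 \<and> h r > 0)"
  have h0: "h 0 > 0" using no_nonneg_nonpos_data u0 by fastforce
  define f where "f = (\<lambda>r. min (u r) (h r))"
  have "continuous_on {0..r} f" unfolding f_def
    by (intro continuous_on_min continuous_on_subset[OF U.cont] continuous_on_subset[OF H.cont]) auto
  then obtain a where a: "a > 0" "f a = 0" "\<And>s. 0 \<le> s \<Longrightarrow> s < a \<Longrightarrow> f s > 0"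
    using first_hit[of 0 r f 0] r neg u0 h0 by (auto simp: f_def min_le_iff_disj)
  have pos: "u s > 0" "h s > 0" if "0 \<le> s" "s < a" for s using a(3)[OF that] by (auto simp: f_def)
  have ua: "u' a < 0" by (rule U.deriv_neg[of 0]) (use a pos U.flux_zero in auto)
  have ha: "h' a < 0" by (rule H.deriv_neg[of 0]) (use a pos H.flux_zero in \<open>auto intro!: source_pos\<close>)
  have fua: "a ^ (n - 1) * u' a \<le> 0" and fha: "a ^ (n - 1) * h' a \<le> 0"
    using ua ha a(1) U.deriv_sign(1)[of a] H.deriv_sign(1)[of a] by auto
  consider "u a = 0" "h a = 0" | "u a > 0" "h a = 0" | "u a = 0" "h a > 0"
  proof -
    have "u a \<ge> 0" "h a \<ge> 0" "u a = 0 \<or> h a = 0"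
      using a(2) by (auto simp: f_def min_def split: if_splits)
    then show ?thesis using that by (metis less_eq_real_def)
  qed
  then show False
  proof cases
    case 1
    then show False using no_zero_of_u_after_h[of a] a ua ha by auto
  next
    case 2
    have upos: "u s > 0" if s: "s \<ge> a" for s
    proof (rule ccontr)
      assume "\<not> u s > 0"
      moreover have "continuous_on {a..s} u" using a by (intro continuous_on_subset[OF U.cont]) auto
      ultimately obtain b where b: "a < b" "u b = 0" "\<And>s. a \<le> s \<Longrightarrow> s < b \<Longrightarrow> u s > 0"
        using first_hit[of a s u 0] s 2 by auto
      have h'neg: "h' x < 0" if "a < x" "x \<le> b" for x
        by (rule H.deriv_neg[of a]) (use a b fha that in \<open>auto intro!: source_pos\<close>)
      have "h b < h a" by (rule H.strict_antimono) (use a b h'neg in auto)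
      moreover have "u' b \<le> 0" by (rule U.deriv_nonpos_at_first_zero[of a]) (use a b in auto)
      ultimately show False using no_zero_of_u_after_h[of b] h'neg[of b] a b 2 by auto
    qed
    have h'neg: "h' x < 0" if "a < x" for x
      by (rule H.deriv_neg[of a]) (use a upos fha that in \<open>auto intro!: source_pos\<close>)
    have "h (a + 1) < h a" by (rule H.strict_antimono) (use a h'neg in auto)
    moreover have "h s \<le> h (a + 1)" if "s \<ge> a + 1" for s
      by (rule H.antimono) (use a that in \<open>auto intro!: less_imp_le h'neg\<close>)
    ultimately obtain R where "R \<ge> a + 1" "\<forall>r\<ge>R. - u r \<le> - 1"
      using radial_poisson.unbounded_below[OF U.uminus, of "a + 1" "- h (a + 1)" "- 1"] 2 a by auto
    then show False using no_positive_lower_bound[of 1 R] a by auto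
  next
    case 3
    have hpos: "h s > 0" if s: "s \<ge> a" for s
    proof (rule ccontr)
      assume "\<not> h s > 0"
      moreover have "continuous_on {a..s} h" using a by (intro continuous_on_subset[OF H.cont]) auto
      ultimately obtain b where b: "a < b" "h b = 0" "\<And>s. a \<le> s \<Longrightarrow> s < b \<Longrightarrow> h s > 0"
        using first_hit[of a s h 0] s 3 by auto
      have u'neg: "u' x < 0" if "a < x" "x \<le> b" for x
        by (rule U.deriv_neg[of a]) (use a b fua that in auto)
      have "u b < u a" by (rule U.strict_antimono) (use a b u'neg in auto)
      moreover have "h' b \<le> 0" by (rule H.deriv_nonpos_at_first_zero[of a]) (use a b in auto)
      ultimately show False using no_zero_of_h_after_u[of b] u'neg[of b] a b 3 by auto
    qed
    have u'neg: "u' x < 0" if "a < x" for x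
      by (rule U.deriv_neg[of a]) (use a hpos fua that in auto)
    have "u (a + 1) < u a" by (rule U.strict_antimono) (use a u'neg in auto)
    moreover have "u s \<le> u (a + 1)" if "s \<ge> a + 1" for s
      by (rule U.antimono) (use a that in \<open>auto intro!: less_imp_le u'neg\<close>)
    ultimately show False
      using radial_profile.no_positive_lower_bound[OF profile_uminus, of "- u (a + 1)" "a + 1"] 3 a by auto
  qed
qed

lemma deriv_neg_both:
  assumes u0: "u 0 > 0" and r: "r > 0"
  shows "u' r < 0" "h' r < 0"
proof -
  show "u' r < 0" by (rule U.deriv_neg[of 0]) (use positive[OF u0] r U.flux_zero in auto)
  show "h' r < 0" by (rule H.deriv_neg[of 0]) (use positive[OF u0] r H.flux_zero in \<open>auto intro!: source_pos\<close>)
qed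

lemma tendsto_zero:
  assumes u0: "u 0 > 0"
  shows "(u \<longlongrightarrow> 0) at_top" "(h \<longlongrightarrow> 0) at_top"
proof -
  note pos = positive[OF u0]
  have anti: "u b \<le> u a" "h b \<le> h a" if "0 \<le> a" "a \<le> b" for a b
    by (rule U.antimono H.antimono; use that in \<open>auto intro!: less_imp_le deriv_neg_both[OF u0]\<close>)+
  show "(u \<longlongrightarrow> 0) at_top"
  proof (rule tendstoI)
    fix e :: real assume e: "e > 0"
    then obtain R where R: "R \<ge> 0" "u R < e" using no_positive_lower_bound[of e 0] by force
    show "\<forall>\<^sub>F r in at_top. dist (u r) 0 < e"
      using eventually_ge_at_top[of R]
    proof eventually_elim
      case (elim r)
      then show ?case using anti(1)[of R r] R pos[of r] by auto
    qed
  qed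
  show "(h \<longlongrightarrow> 0) at_top"
  proof (rule tendstoI)
    fix e :: real assume e: "e > 0"
    have "\<exists>R\<ge>0. h R < e"
    proof (rule ccontr)
      assume "\<not> (\<exists>R\<ge>0. h R < e)"
      then obtain R where "R \<ge> 0" "\<forall>r\<ge>R. u r \<le> 0"
        using U.unbounded_below[of 0 e 0] e by force
      then show False using pos[of R] by force
    qed
    then obtain R where R: "R \<ge> 0" "h R < e" by blast
    show "\<forall>\<^sub>F r in at_top. dist (h r) 0 < e"
      using eventually_ge_at_top[of R]
    proof eventually_elim
      case (elim r)
      then show ?case using anti(2)[of R r] R pos[of r] by auto
    qed
  qed
qed

end

section \<open>A positive supersolution above the Hardy-Rellich constant\<close>

text \<open>
  Integrating \<open>W'' + \<tau>\<^sup>2 W = V\<close> against \<open>sin (\<tau> (t - s))\<close> over one half period leaves only the two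
  boundary values of \<open>W\<close>, with the same sign, and the weight is nonnegative.
\<close>

lemma half_period_above:
  fixes W W1 V :: "real \<Rightarrow> real"
  assumes \<tau>: "\<tau> > 0"
    and W: "\<And>t. DERIV W t :> W1 t"
    and W1: "\<And>t. DERIV W1 t :> V t - \<tau>\<^sup>2 * W t"
    and V: "\<And>t. s \<le> t \<Longrightarrow> t \<le> s + pi / \<tau> \<Longrightarrow> M \<le> V t"
  shows "2 * M / \<tau>\<^sup>2 \<le> W s + W (s + pi / \<tau>)"
proof -
  define \<Phi> where "\<Phi> = (\<lambda>t. W1 t * sin (\<tau> * (t - s)) - \<tau> * W t * cos (\<tau> * (t - s)))"
  have \<Phi>': "DERIV \<Phi> t :> V t * sin (\<tau> * (t - s))" for t
    unfolding \<Phi>_def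
    by (rule derivative_eq_intros W W1 refl | simp)+ (simp add: algebra_simps power2_eq_square)
  have g': "DERIV (\<lambda>t. - (M / \<tau>) * cos (\<tau> * (t - s))) t :> M * sin (\<tau> * (t - s))" for t
    using \<tau> by (auto intro!: derivative_eq_intros)
  have "- (M / \<tau>) * cos (\<tau> * (s + pi / \<tau> - s)) - (- (M / \<tau>) * cos (\<tau> * (s - s)))
      \<le> \<Phi> (s + pi / \<tau>) - \<Phi> s"
  proof (rule increment_mono[OF _ _ _ g' \<Phi>'])
    show "continuous_on {s..s + pi / \<tau>} \<Phi>"
      by (rule continuous_on_of_deriv, rule \<Phi>')
    show "M * sin (\<tau> * (t - s)) \<le> V t * sin (\<tau> * (t - s))" if "s < t" "t < s + pi / \<tau>" for t
    proof (rule mult_right_mono)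
      show "0 \<le> sin (\<tau> * (t - s))" using that \<tau> by (intro sin_ge_zero) (auto simp: field_simps)
    qed (use V that in auto)
  qed (use \<tau> in \<open>auto intro!: continuous_intros\<close>)
  then have "2 * M / \<tau> \<le> \<tau> * (W s + W (s + pi / \<tau>))"
    using \<tau> by (simp add: \<Phi>_def algebra_simps)
  then show ?thesis using \<tau> by (simp add: field_simps power2_eq_square)
qed

lemma half_period_below:
  fixes W W1 V :: "real \<Rightarrow> real"
  assumes \<tau>: "\<tau> > 0"
    and W: "\<And>t. DERIV W t :> W1 t"
    and W1: "\<And>t. DERIV W1 t :> V t - \<tau>\<^sup>2 * W t"
    and V: "\<And>t. s \<le> t \<Longrightarrow> t \<le> s + pi / \<tau> \<Longrightarrow> V t \<le> M"
  shows "W s + W (s + pi / \<tau>) \<le> 2 * M / \<tau>\<^sup>2"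
proof -
  have "2 * (- M) / \<tau>\<^sup>2 \<le> - W s + - W (s + pi / \<tau>)"
  proof (rule half_period_above[OF \<tau>])
    show "DERIV (\<lambda>t. - W t) t :> - W1 t" for t by (rule DERIV_minus[OF W])
    show "DERIV (\<lambda>t. - W1 t) t :> - V t - \<tau>\<^sup>2 * - W t" for t
      using DERIV_minus[OF W1] by simp
    show "- M \<le> - V t" if "s \<le> t" "t \<le> s + pi / \<tau>" for t using V[OF that] by simp
  qed
  then show ?thesis by simp
qed

text \<open>
  With \<open>W t = e\<^sup>\<gamma>\<^sup>t w (e\<^sup>t)\<close> the radial bilaplacian factors into four first-order operators with
  constant coefficients, whose roots are \<open>\<gamma>\<close>, \<open>\<gamma> + 2 - N\<close>, \<open>\<gamma> + 2\<close>, \<open>\<gamma> + 4 - N\<close>.  The functions \<open>A\<close>, \<open>Z\<close>,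
  \<open>B\<close> are the intermediate quantities: up to sign and weight, the flux of \<open>w\<close>, its Laplacian, and the flux of
  its Laplacian.
\<close>

locale emden_fowler =
  fixes N \<gamma> :: real and W A Z B X :: "real \<Rightarrow> real"
  assumes dW: "\<And>t. DERIV W t :> \<gamma> * W t - A t"
    and dA: "\<And>t. DERIV A t :> (\<gamma> + 2 - N) * A t + Z t"
    and dZ: "\<And>t. DERIV Z t :> (\<gamma> + 2) * Z t - B t"
    and dB: "\<And>t. DERIV B t :> (\<gamma> + 4 - N) * B t + X t"

text \<open>
  For \<open>\<gamma> = (N - 4) / 2\<close> the roots are \<open>\<plusminus>\<gamma>\<close> and \<open>\<plusminus>(\<gamma> + 2)\<close>, so
  \<open>D\<^sup>4 - (\<gamma>\<^sup>2 + (\<gamma> + 2)\<^sup>2) D\<^sup>2 + \<gamma>\<^sup>2 (\<gamma> + 2)\<^sup>2 - \<mu> = (D\<^sup>2 - \<sigma>\<^sup>2) (D\<^sup>2 + \<tau>\<^sup>2)\<close>, with \<open>\<tau>\<close> real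
  precisely because \<open>\<mu>\<close> is above \<open>\<gamma>\<^sup>2 (\<gamma> + 2)\<^sup>2\<close>, and with \<open>\<sigma> > \<gamma> + 2\<close>.  Hence \<open>V = W'' + \<tau>\<^sup>2 W\<close>
  satisfies \<open>V'' \<ge> \<sigma>\<^sup>2 V\<close>: either \<open>V\<close> grows like \<open>e\<^sup>\<sigma>\<^sup>t\<close>, or it is bounded above by a multiple of
  \<open>e\<^sup>-\<^sup>\<sigma>\<^sup>t\<close>.  Half-period averages transfer both alternatives to \<open>W\<close>, and the growth hypothesis excludes
  the first.
\<close>

lemma (in emden_fowler) spectral_decay:
  assumes \<gamma>: "\<gamma> > 0" and N: "N = 2 * \<gamma> + 4"
    and lam: "\<mu> > \<gamma>\<^sup>2 * (\<gamma> + 2)\<^sup>2"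
    and super: "\<And>t. t \<ge> T \<Longrightarrow> X t \<ge> \<mu> * W t"
    and nonneg: "\<And>t. t \<ge> T \<Longrightarrow> W t \<ge> 0"
    and growth: "\<And>t. t \<ge> T \<Longrightarrow> W t \<le> C * exp ((\<gamma> + 2) * t)"
  shows "\<exists>\<sigma>>\<gamma> + 2. \<exists>C. \<forall>t\<ge>T. W t \<le> C * exp (- \<sigma> * t)"
proof -
  define b where "b = \<gamma> + 2"
  define S where "S = \<gamma>\<^sup>2 + b\<^sup>2"
  define x where "x = (sqrt (S\<^sup>2 + 4 * (\<mu> - \<gamma>\<^sup>2 * b\<^sup>2)) - S) / 2"
  have S: "S \<ge> 0" by (simp add: S_def)
  have lam': "\<mu> - \<gamma>\<^sup>2 * b\<^sup>2 > 0" using lam by (simp add: b_def)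
  have "sqrt (S\<^sup>2) < sqrt (S\<^sup>2 + 4 * (\<mu> - \<gamma>\<^sup>2 * b\<^sup>2))" using lam' by (intro real_sqrt_less_mono) simp
  then have x: "x > 0" using S by (simp add: x_def)
  have "(2 * x + S)\<^sup>2 = S\<^sup>2 + 4 * (\<mu> - \<gamma>\<^sup>2 * b\<^sup>2)"
  proof -
    have "2 * x + S = sqrt (S\<^sup>2 + 4 * (\<mu> - \<gamma>\<^sup>2 * b\<^sup>2))" by (simp add: x_def field_simps)
    then show ?thesis using lam' by simp
  qed
  then have xS: "x * (S + x) = \<mu> - \<gamma>\<^sup>2 * b\<^sup>2" by (simp add: power2_eq_square algebra_simps)
  define \<tau> where "\<tau> = sqrt x"
  define \<sigma> where "\<sigma> = sqrt (S + x)"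
  have \<tau>: "\<tau> > 0" "\<tau>\<^sup>2 = x" using x by (auto simp: \<tau>_def)
  have \<sigma>2: "\<sigma>\<^sup>2 = S + x" using x S by (auto simp: \<sigma>_def)
  have b: "b > 0" using \<gamma> by (simp add: b_def)
  have "sqrt (b\<^sup>2) < \<sigma>" unfolding \<sigma>_def using x by (intro real_sqrt_less_mono) (simp add: S_def add_nonneg_pos)
  then have \<sigma>: "\<sigma> > b" "\<sigma> > 0" using b by auto
  define W1 where "W1 = (\<lambda>t. \<gamma> * W t - A t)"
  define V where "V = (\<lambda>t. (\<gamma>\<^sup>2 + x) * W t + 2 * A t - Z t)"
  define V1 where "V1 = (\<lambda>t. (\<gamma>\<^sup>2 + x) * (\<gamma> * W t - A t) + 2 * (Z t - b * A t) - (b * Z t - B t))"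
  have dA': "DERIV A t :> Z t - b * A t" for t
    using dA[of t] by (simp add: N b_def algebra_simps)
  have dZ': "DERIV Z t :> b * Z t - B t" for t
    using dZ[of t] by (simp add: b_def)
  have dB': "DERIV B t :> X t - \<gamma> * B t" for t
    using dB[of t] by (simp add: N algebra_simps)
  have dW1: "DERIV W t :> W1 t" for t using dW by (simp add: W1_def)
  have dW1': "DERIV W1 t :> V t - \<tau>\<^sup>2 * W t" for t
    unfolding W1_def \<tau>(2)
    by (rule derivative_eq_intros dW dA' refl)+
      (simp add: V_def b_def algebra_simps power2_eq_square)
  have dV: "DERIV V t :> V1 t" for t
    unfolding V_def by (rule derivative_eq_intros dW dA' dZ' refl)+ (simp add: V1_def)
  have dV1: "DERIV V1 t :> \<sigma>\<^sup>2 * V t + (X t - \<mu> * W t)" for t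
  proof -
    have lam_eq: "\<mu> = \<gamma>\<^sup>2 * b\<^sup>2 + x * (S + x)" using xS by simp
    show ?thesis
      unfolding V1_def \<sigma>2
      by (rule derivative_eq_intros dW dA' dZ' dB' refl)+
        (simp add: V_def lam_eq S_def b_def algebra_simps power2_eq_square)
  qed
  \<comment> \<open>\<open>V'' - \<sigma>\<^sup>2 V \<ge> 0\<close> is split once more: \<open>(D - \<sigma>) Y \<ge> 0\<close> with \<open>Y = (D + \<sigma>) V\<close>.\<close>
  define Y where "Y = (\<lambda>t. V1 t + \<sigma> * V t)"
  have dY: "DERIV (\<lambda>t. exp (- \<sigma> * t) * Y t) t :> exp (- \<sigma> * t) * (X t - \<mu> * W t)" for t
    unfolding Y_def
    by (rule derivative_eq_intros dV dV1 refl)+ (simp add: algebra_simps power2_eq_square)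
  have dVe: "DERIV (\<lambda>t. exp (\<sigma> * t) * V t) t :> exp (\<sigma> * t) * Y t" for t
    unfolding Y_def
    by (rule derivative_eq_intros dV refl)+ (simp add: algebra_simps)
  define L where "L = pi / \<tau>"
  have L: "L > 0" using \<tau> by (simp add: L_def)
  have Y_nonpos: "Y t0 \<le> 0" if t0: "t0 \<ge> T" for t0
  proof (rule ccontr)
    assume "\<not> Y t0 \<le> 0"
    define c where "c = exp (- \<sigma> * t0) * Y t0"
    have c: "c > 0" using \<open>\<not> Y t0 \<le> 0\<close> by (simp add: c_def)
    have Yc: "exp (- \<sigma> * t) * Y t \<ge> c" if "t \<ge> t0" for t
      unfolding c_def
    proof (rule nondecreasing_of_deriv[OF that _ dY])
      show "continuous_on {t0..t} (\<lambda>t. exp (- \<sigma> * t) * Y t)"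
        by (rule continuous_on_of_deriv, rule dY)
      show "0 \<le> exp (- \<sigma> * s) * (X s - \<mu> * W s)" if "t0 < s" for s
        using super[of s] that t0 by simp
    qed
    define D where "D = c / (2 * \<sigma>) * exp (2 * \<sigma> * t0) - exp (\<sigma> * t0) * V t0"
    have Vlow: "V t \<ge> c / (2 * \<sigma>) * exp (\<sigma> * t) - \<bar>D\<bar> * exp (- \<sigma> * t0)" if t: "t \<ge> t0" for t
    proof -
      have "c / (2 * \<sigma>) * exp (2 * \<sigma> * t) - c / (2 * \<sigma>) * exp (2 * \<sigma> * t0)
          \<le> exp (\<sigma> * t) * V t - exp (\<sigma> * t0) * V t0"
      proof (rule increment_mono[OF t _ _ _ dVe])
        show "continuous_on {t0..t} (\<lambda>t. exp (\<sigma> * t) * V t)"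
          by (rule continuous_on_of_deriv, rule dVe)
        show "DERIV (\<lambda>t. c / (2 * \<sigma>) * exp (2 * \<sigma> * t)) s :> c * exp (2 * \<sigma> * s)" for s
          using \<sigma> by (auto intro!: derivative_eq_intros)
        show "c * exp (2 * \<sigma> * s) \<le> exp (\<sigma> * s) * Y s" if "t0 < s" for s
        proof -
          have "c * exp (2 * \<sigma> * s) \<le> (exp (- \<sigma> * s) * Y s) * exp (2 * \<sigma> * s)"
            using Yc[of s] that by (intro mult_right_mono) auto
          also have "\<dots> = exp (- \<sigma> * s + 2 * \<sigma> * s) * Y s" by (simp only: exp_add mult_ac)
          finally show ?thesis by simp
        qed
      qed (use \<sigma> in \<open>auto intro!: continuous_intros\<close>)
      then have "c / (2 * \<sigma>) * exp (2 * \<sigma> * t) - \<bar>D\<bar> \<le> exp (\<sigma> * t) * V t" by (simp add: D_def)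
      then have "exp (- \<sigma> * t) * (c / (2 * \<sigma>) * exp (2 * \<sigma> * t) - \<bar>D\<bar>) \<le> exp (- \<sigma> * t) * (exp (\<sigma> * t) * V t)"
        by (intro mult_left_mono) auto
      also have "\<dots> = exp (- \<sigma> * t + \<sigma> * t) * V t" by (simp only: exp_add mult.assoc)
      also have "exp (- \<sigma> * t) * (c / (2 * \<sigma>) * exp (2 * \<sigma> * t) - \<bar>D\<bar>)
        = c / (2 * \<sigma>) * exp (- \<sigma> * t + 2 * \<sigma> * t) - \<bar>D\<bar> * exp (- \<sigma> * t)"
        by (simp only: exp_add right_diff_distrib mult_ac)
      finally have "c / (2 * \<sigma>) * exp (\<sigma> * t) - \<bar>D\<bar> * exp (- \<sigma> * t) \<le> V t" by simp
      moreover have "\<bar>D\<bar> * exp (- \<sigma> * t) \<le> \<bar>D\<bar> * exp (- \<sigma> * t0)"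
        using t \<sigma> by (intro mult_left_mono) auto
      ultimately show ?thesis by linarith
    qed
    define K1 where "K1 = 2 * (c / (2 * \<sigma>)) / x"
    define K2 where "K2 = 2 * (\<bar>D\<bar> * exp (- \<sigma> * t0)) / x"
    define K3 where "K3 = \<bar>C\<bar> * (1 + exp (b * L))"
    have K: "K1 > 0" "K2 \<ge> 0" "K3 \<ge> 0" using c \<sigma> x by (auto simp: K1_def K2_def K3_def)
    have key: "K1 * exp (\<sigma> * s) - K2 \<le> K3 * exp (b * s)" if s: "s \<ge> t0" for s
    proof -
      have "2 * (c / (2 * \<sigma>) * exp (\<sigma> * s) - \<bar>D\<bar> * exp (- \<sigma> * t0)) / \<tau>\<^sup>2 \<le> W s + W (s + pi / \<tau>)"
      proof (rule half_period_above[OF \<tau>(1) dW1 dW1'])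
        fix t assume t: "s \<le> t" "t \<le> s + pi / \<tau>"
        have "c / (2 * \<sigma>) * exp (\<sigma> * s) \<le> c / (2 * \<sigma>) * exp (\<sigma> * t)"
          using t c \<sigma> by (intro mult_left_mono) auto
        then show "c / (2 * \<sigma>) * exp (\<sigma> * s) - \<bar>D\<bar> * exp (- \<sigma> * t0) \<le> V t"
          using Vlow[of t] t s by linarith
      qed
      also have "2 * (c / (2 * \<sigma>) * exp (\<sigma> * s) - \<bar>D\<bar> * exp (- \<sigma> * t0)) / \<tau>\<^sup>2 = K1 * exp (\<sigma> * s) - K2"
        by (simp only: \<tau>(2) K1_def K2_def right_diff_distrib diff_divide_distrib) simp
      also have "W s + W (s + pi / \<tau>) \<le> C * exp (b * s) + C * exp (b * (s + L))"
        using growth[of s] growth[of "s + L"] s t0 L by (simp add: b_def L_def)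
      also have "\<dots> = C * ((1 + exp (b * L)) * exp (b * s))" by (simp add: algebra_simps exp_add)
      also have "\<dots> \<le> \<bar>C\<bar> * ((1 + exp (b * L)) * exp (b * s))" by (intro mult_right_mono) (auto simp: add_nonneg_nonneg)
      finally show ?thesis by (simp add: K3_def mult.assoc)
    qed
    define s where "s = max t0 0 + (K2 + K3) / (K1 * (\<sigma> - b))"
    have q: "(K2 + K3) / (K1 * (\<sigma> - b)) \<ge> 0" using K \<sigma> by auto
    then have s: "s \<ge> t0" "s \<ge> 0" by (auto simp: s_def)
    have "exp (\<sigma> * s) = exp (b * s) * exp ((\<sigma> - b) * s)" by (simp add: algebra_simps flip: exp_add)
    moreover have "K2 \<le> K2 * exp (b * s)" using K b s mult_left_mono[of 1 "exp (b * s)" K2] by simp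
    ultimately have "exp (b * s) * (K1 * exp ((\<sigma> - b) * s)) \<le> exp (b * s) * (K2 + K3)"
      using key[OF s(1)] by (simp add: algebra_simps)
    then have "K1 * exp ((\<sigma> - b) * s) \<le> K2 + K3" by simp
    moreover have "K1 * (1 + (\<sigma> - b) * s) \<le> K1 * exp ((\<sigma> - b) * s)"
      using K exp_ge_add_one_self by (intro mult_left_mono) auto
    moreover have "K1 * (\<sigma> - b) * s \<ge> K1 * (\<sigma> - b) * ((K2 + K3) / (K1 * (\<sigma> - b)))"
      using K \<sigma> by (intro mult_left_mono) (auto simp: s_def)
    moreover have "K1 * (\<sigma> - b) * ((K2 + K3) / (K1 * (\<sigma> - b))) = K2 + K3" using K \<sigma> by simp
    ultimately show False using K by (simp add: algebra_simps)
  qed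
  define E where "E = exp (\<sigma> * T) * V T"
  have Vup: "V t \<le> \<bar>E\<bar> * exp (- \<sigma> * t)" if t: "t \<ge> T" for t
  proof -
    have "exp (\<sigma> * t) * V t \<le> E"
      unfolding E_def
    proof (rule nonincreasing_of_deriv[OF t _ dVe])
      show "continuous_on {T..t} (\<lambda>t. exp (\<sigma> * t) * V t)"
        by (rule continuous_on_of_deriv, rule dVe)
      show "exp (\<sigma> * s) * Y s \<le> 0" if "T < s" for s
        using Y_nonpos[of s] that by (simp add: mult_nonneg_nonpos)
    qed
    then have "exp (- \<sigma> * t) * (exp (\<sigma> * t) * V t) \<le> exp (- \<sigma> * t) * \<bar>E\<bar>" by (intro mult_left_mono) auto
    moreover have "exp (- \<sigma> * t) * (exp (\<sigma> * t) * V t) = V t"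
      by (simp add: exp_minus field_simps)
    ultimately show ?thesis by (metis mult.commute)
  qed
  have "W s \<le> 2 * \<bar>E\<bar> / x * exp (- \<sigma> * s)" if s: "s \<ge> T" for s
  proof -
    have "W s + W (s + pi / \<tau>) \<le> 2 * (\<bar>E\<bar> * exp (- \<sigma> * s)) / \<tau>\<^sup>2"
    proof (rule half_period_below[OF \<tau>(1) dW1 dW1'])
      fix t assume t: "s \<le> t" "t \<le> s + pi / \<tau>"
      have "\<bar>E\<bar> * exp (- \<sigma> * t) \<le> \<bar>E\<bar> * exp (- \<sigma> * s)" using t \<sigma> by (intro mult_left_mono) auto
      then show "V t \<le> \<bar>E\<bar> * exp (- \<sigma> * s)" using Vup[of t] t s by linarith
    qed
    moreover have "W (s + pi / \<tau>) \<ge> 0" using nonneg[of "s + L"] s L by (simp add: L_def)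
    ultimately show ?thesis by (simp add: \<tau>)
  qed
  moreover have "\<sigma> > \<gamma> + 2" using \<sigma> by (simp add: b_def)
  ultimately show ?thesis by blast
qed

section \<open>Fast decay and its backward propagation\<close>

lemma tail_lower_bound:
  fixes y y' :: "real \<Rightarrow> real"
  assumes r0: "r0 > 0" and \<beta>: "\<beta> > 0"
    and y: "\<And>r. r \<ge> r0 \<Longrightarrow> DERIV y r :> y' r"
    and y': "\<And>r. r \<ge> r0 \<Longrightarrow> y' r \<le> - c * r powr (- \<beta> - 1)"
    and lim: "(y \<longlongrightarrow> 0) at_top" and r: "r \<ge> r0"
  shows "c / \<beta> * r powr (- \<beta>) \<le> y r"
proof -
  define f where "f = (\<lambda>r. y r - c / \<beta> * r powr (- \<beta>))"
  have f': "DERIV f s :> y' s + c * s powr (- \<beta> - 1)" if "s \<ge> r0" for s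
    unfolding f_def using that r0 \<beta> by (auto intro!: derivative_eq_intros y)
  have anti: "f s \<le> f r" if "s \<ge> r" for s
  proof (rule nonincreasing_of_deriv[OF that _ f'])
    show "continuous_on {r..s} f"
      by (rule continuous_on_of_deriv, rule f') (use r in auto)
    show "y' x + c * x powr (- \<beta> - 1) \<le> 0" if "r < x" for x using y'[of x] that r by simp
  qed (use r in auto)
  have "((\<lambda>r::real. r powr (- \<beta>)) \<longlongrightarrow> 0) at_top"
    using \<beta> by (intro tendsto_neg_powr filterlim_ident) auto
  then have "(f \<longlongrightarrow> 0 - c / \<beta> * 0) at_top"
    unfolding f_def by (intro tendsto_intros lim)
  then have lim_f: "(f \<longlongrightarrow> 0) at_top" by simp
  have "0 \<le> f r"
    by (rule tendsto_upperbound[OF lim_f]) (auto intro: eventually_mono[OF eventually_ge_at_top anti])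
  then show ?thesis by (simp add: f_def)
qed

text \<open>
  The equation \<open>\<Delta>\<^sup>2 w = e\<close> with \<open>k = - \<Delta> w\<close>, on the punctured space: differences with the
  singular solution are of this form.
\<close>

locale radial_bilaplacian =
  fixes n :: nat and w w' k k' e :: "real \<Rightarrow> real"
  assumes dim_ge: "n \<ge> 5"
    and dw: "r > 0 \<Longrightarrow> DERIV w r :> w' r"
    and dq: "r > 0 \<Longrightarrow> DERIV (\<lambda>r. r ^ (n - 1) * w' r) r :> - (r ^ (n - 1) * k r)"
    and dk: "r > 0 \<Longrightarrow> DERIV k r :> k' r"
    and dl: "r > 0 \<Longrightarrow> DERIV (\<lambda>r. r ^ (n - 1) * k' r) r :> - (r ^ (n - 1) * e r)"
begin

lemma cont_on:
  assumes "a > 0"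
  shows "continuous_on {a..b} w" "continuous_on {a..b} k"
    "continuous_on {a..b} (\<lambda>r. r ^ (n - 1) * w' r)" "continuous_on {a..b} (\<lambda>r. r ^ (n - 1) * k' r)"
  by (rule continuous_on_of_deriv, rule dw dk dq dl; use assms in simp)+

lemma exp_dim: "exp t ^ (n - 1) = exp ((real n - 1) * t)"
  using dim_ge by (simp add: exp_of_nat_mult[symmetric] of_nat_diff)

lemma emden_fowler:
  "emden_fowler (real n) \<gamma> (\<lambda>t. exp (\<gamma> * t) * w (exp t))
     (\<lambda>t. - (exp ((\<gamma> + 2 - real n) * t) * (exp t ^ (n - 1) * w' (exp t))))
     (\<lambda>t. exp ((\<gamma> + 2) * t) * k (exp t))
     (\<lambda>t. - (exp ((\<gamma> + 4 - real n) * t) * (exp t ^ (n - 1) * k' (exp t))))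
     (\<lambda>t. exp ((\<gamma> + 4) * t) * e (exp t))"
proof -
  have c: "exp ((\<gamma> + c - real n) * t) * (exp t ^ (n - 1) * y) = exp ((\<gamma> + c - 1) * t) * y" for c y t :: real
    unfolding exp_dim by (simp add: mult_exp_exp algebra_simps mult.assoc[symmetric])
  have shift: "exp ((\<gamma> + c) * t) * y = (exp ((\<gamma> + c - real n) * t) * (exp t ^ (n - 1) * y)) * exp t"
    for c y t :: real
    unfolding c by (simp add: mult_exp_exp algebra_simps)
  have E: "DERIV (\<lambda>t. exp (c * t)) t :> c * exp (c * t)" for c t :: real
    by (auto intro!: derivative_eq_intros)
  have gen: "- (g * a * (x * y) + - (x * z) * E * a) = g * - (a * (x * y)) + a * (x * z) * E"
    for g a x y z E :: real by (simp add: algebra_simps)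
  note W = DERIV_chain2[OF dw[OF exp_gt_zero] DERIV_exp]
  note Q = DERIV_chain2[OF dq[OF exp_gt_zero] DERIV_exp]
  note K = DERIV_chain2[OF dk[OF exp_gt_zero] DERIV_exp]
  note LL = DERIV_chain2[OF dl[OF exp_gt_zero] DERIV_exp]
  show ?thesis
  proof (standard, goal_cases)
    case (1 t)
    show ?case
      by (rule DERIV_cong[OF DERIV_mult[OF E W]]) (simp only: c, simp add: mult_exp_exp algebra_simps)
  next
    case (2 t)
    show ?case
      unfolding shift[of 2]
      by (rule DERIV_cong[OF DERIV_minus[OF DERIV_mult[OF E Q]]]) (simp only: gen)
  next
    case (3 t)
    show ?case
      by (rule DERIV_cong[OF DERIV_mult[OF E K]]) (simp only: c, simp add: mult_exp_exp algebra_simps)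
  next
    case (4 t)
    show ?case
      unfolding shift[of 4]
      by (rule DERIV_cong[OF DERIV_minus[OF DERIV_mult[OF E LL]]]) (simp only: gen)
  qed
qed

lemma fast_decay:
  assumes mu: "\<mu> > ((real n - 4) / 2)\<^sup>2 * (real n / 2)\<^sup>2" and R: "R \<ge> 1"
    and super: "\<And>r. r \<ge> R \<Longrightarrow> \<mu> * w r \<le> r ^ 4 * e r"
    and bounds: "\<And>r. r \<ge> R \<Longrightarrow> 0 \<le> w r" "\<And>r. r \<ge> R \<Longrightarrow> w r \<le> 1"
  shows "\<exists>\<alpha>>real n - 2. \<exists>C. \<forall>r\<ge>R. w r \<le> C * r powr (- \<alpha>)"
proof -
  define \<gamma> where "\<gamma> = (real n - 4) / 2"
  have g2: "\<gamma> + 2 = real n / 2" by (simp add: \<gamma>_def field_simps)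
  have "\<exists>\<sigma>>\<gamma> + 2. \<exists>C. \<forall>t\<ge>ln R. exp (\<gamma> * t) * w (exp t) \<le> C * exp (- \<sigma> * t)"
  proof (rule emden_fowler.spectral_decay[OF emden_fowler])
    show "\<gamma> > 0" "real n = 2 * \<gamma> + 4" using dim_ge by (auto simp: \<gamma>_def field_simps)
    show "\<gamma>\<^sup>2 * (\<gamma> + 2)\<^sup>2 < \<mu>" using mu unfolding g2 by (simp add: \<gamma>_def)
    fix t assume lt: "ln R \<le> t"
    have "exp (ln R) \<le> exp t" using lt by simp
    moreover have "0 \<le> ln R" using R by simp
    ultimately have t: "R \<le> exp t" "t \<ge> 0" using R lt by (simp, linarith)
    have "exp (\<gamma> * t) * (\<mu> * w (exp t)) \<le> exp (\<gamma> * t) * (exp t ^ 4 * e (exp t))"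
      using super[OF t(1)] by (intro mult_left_mono) auto
    also have "\<dots> = exp ((\<gamma> + 4) * t) * e (exp t)"
      by (simp add: mult_exp_exp algebra_simps exp_of_nat_mult[symmetric] mult.assoc[symmetric])
    finally show "\<mu> * (exp (\<gamma> * t) * w (exp t)) \<le> exp ((\<gamma> + 4) * t) * e (exp t)" by (simp add: mult_ac)
    show "0 \<le> exp (\<gamma> * t) * w (exp t)" using bounds t by simp
    have "exp (\<gamma> * t) * w (exp t) \<le> exp ((\<gamma> + 2) * t) * 1"
      using bounds t by (intro mult_mono) (auto intro!: mult_right_mono)
    then show "exp (\<gamma> * t) * w (exp t) \<le> 1 * exp ((\<gamma> + 2) * t)" by simp
  qed
  then obtain \<sigma> C where \<sigma>: "\<sigma> > \<gamma> + 2" and C: "\<And>t. t \<ge> ln R \<Longrightarrow> exp (\<gamma> * t) * w (exp t) \<le> C * exp (- \<sigma> * t)"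
    by blast
  have "w r \<le> C * r powr (- (\<gamma> + \<sigma>))" if r: "r \<ge> R" for r
  proof -
    have r0: "r > 0" using r R by simp
    have "exp (\<gamma> * ln r) * w r \<le> C * exp (- \<sigma> * ln r)" using C[of "ln r"] r r0 R by simp
    then have "r powr \<gamma> * w r \<le> C * r powr (- \<sigma>)" using r0 by (simp add: powr_def)
    then have "r powr (- \<gamma>) * (r powr \<gamma> * w r) \<le> r powr (- \<gamma>) * (C * r powr (- \<sigma>))"
      by (intro mult_left_mono) auto
    moreover have "r powr (- \<gamma>) * (r powr \<gamma> * w r) = w r"
      using r0 by (simp add: powr_minus)
    moreover have "r powr (- \<gamma>) * (C * r powr (- \<sigma>)) = C * r powr (- (\<gamma> + \<sigma>))"
      by (simp add: powr_add[symmetric] mult_ac)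
    ultimately show ?thesis by simp
  qed
  moreover have "\<gamma> + \<sigma> > real n - 2" using \<sigma> by (simp add: \<gamma>_def field_simps)
  ultimately show ?thesis by blast
qed

lemma deriv_le_of_flux_le:
  assumes "r > 0" "r ^ (n - 1) * y \<le> c"
  shows "y \<le> c * r powr (- (real n - 2) - 1)"
proof -
  have "r powr (- (real n - 2) - 1) = 1 / r ^ (n - 1)"
    using assms(1) dim_ge by (simp add: powr_realpow[symmetric] of_nat_diff powr_minus[symmetric] inverse_eq_divide[symmetric])
  moreover have "y \<le> c / r ^ (n - 1)" using assms by (simp add: pos_le_divide_eq mult.commute)
  ultimately show ?thesis by simp
qed

text \<open>
  If the flux of \<open>k\<close> were negative somewhere it would stay below a negative constant, \<open>k\<close> would
  be at least a multiple of \<open>r\<^sup>2\<^sup>-\<^sup>n\<close> and \<open>w\<close> at least a multiple of \<open>r\<^sup>4\<^sup>-\<^sup>n\<close>, more than the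
  decay of \<open>w\<close> allows.  The other two signs follow because \<open>k\<close> and \<open>w\<close> tend to \<open>0\<close>.
\<close>

lemma decay_signs:
  assumes R: "R > 0" and lim: "(w \<longlongrightarrow> 0) at_top" "(k \<longlongrightarrow> 0) at_top"
    and e: "\<And>r. r \<ge> R \<Longrightarrow> 0 \<le> e r" and w: "\<And>r. r \<ge> R \<Longrightarrow> 0 \<le> w r"
    and \<alpha>: "\<alpha> > real n - 2" and decay: "\<And>r. r \<ge> R \<Longrightarrow> w r \<le> C * r powr (- \<alpha>)"
    and r: "r \<ge> R"
  shows "w' r \<le> 0" "k r \<le> 0" "k' r \<ge> 0"
proof -
  have l_anti: "b ^ (n - 1) * k' b \<le> a ^ (n - 1) * k' a" if "R \<le> a" "a \<le> b" for a b
    by (rule nonincreasing_of_deriv[OF that(2) cont_on(4) dl]) (use that R e in auto)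
  have l_nonneg: "0 \<le> a ^ (n - 1) * k' a" if a: "a \<ge> R" for a
  proof (rule ccontr)
    define c where "c = - (a ^ (n - 1) * k' a)"
    assume "\<not> 0 \<le> a ^ (n - 1) * k' a"
    then have c: "c > 0" by (simp add: c_def)
    have a0: "a > 0" using a R by simp
    have n: "real n - 2 > 0" "real n - 4 > 0" using dim_ge by auto
    define c1 where "c1 = c / (real n - 2)"
    have c1: "c1 > 0" using c n by (simp add: c1_def)
    have klow: "c1 * s powr (- (real n - 2)) \<le> k s" if "s \<ge> a" for s
      unfolding c1_def
    proof (rule tail_lower_bound[OF a0 n(1) dk _ lim(2) that])
      show "k' x \<le> - c * x powr (- (real n - 2) - 1)" if "x \<ge> a" for x
        by (rule deriv_le_of_flux_le) (use l_anti[of a x] that a a0 in \<open>auto simp: c_def\<close>)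
    qed (use a0 in auto)
    define q where "q = (\<lambda>r. r ^ (n - 1) * w' r)"
    have qup: "q s - q a \<le> - (c1 / 2) * s\<^sup>2 - (- (c1 / 2) * a\<^sup>2)" if s: "s \<ge> a" for s
      unfolding q_def
    proof (rule increment_mono[OF s cont_on(3)[OF a0] _ dq])
      show "DERIV (\<lambda>r. - (c1 / 2) * r\<^sup>2) x :> - c1 * x" for x
        by (auto intro!: derivative_eq_intros)
      show "- (x ^ (n - 1) * k x) \<le> - c1 * x" if x: "a < x" for x
      proof -
        have "x ^ (n - 1) * (c1 * x powr (- (real n - 2))) \<le> x ^ (n - 1) * k x"
          using klow[of x] x a0 by (intro mult_left_mono) auto
        moreover have "x ^ (n - 1) * x powr (- (real n - 2)) = x"
        proof -
          have "x ^ (n - 1) = x powr (real n - 1)"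
            using x a0 dim_ge by (simp add: powr_realpow[symmetric] of_nat_diff)
          then show ?thesis using x a0 by (simp add: powr_add[symmetric])
        qed
        ultimately show ?thesis by (simp add: mult.left_commute mult.commute)
      qed
    qed (use a0 in \<open>auto intro!: continuous_intros\<close>)
    define D where "D = q a + (c1 / 2) * a\<^sup>2"
    define s0 where "s0 = max (max a 1) (4 * \<bar>D\<bar> / c1)"
    have s0: "s0 \<ge> a" "s0 \<ge> 1" "s0 \<ge> 4 * \<bar>D\<bar> / c1" by (auto simp: s0_def)
    have qneg: "q s \<le> - (c1 / 4) * s\<^sup>2" if s: "s \<ge> s0" for s
    proof -
      have "q s \<le> D - (c1 / 2) * s\<^sup>2" using qup[of s] s s0 by (simp add: D_def)
      moreover have "4 * \<bar>D\<bar> \<le> c1 * s"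
        using s s0 c1 pos_divide_le_eq[of c1 "4 * \<bar>D\<bar>" s] by (simp add: mult.commute)
      moreover have "c1 * s * 1 \<le> c1 * s * s" using s s0 c1 by (intro mult_left_mono) auto
      ultimately show ?thesis by (simp add: power2_eq_square)
    qed
    have wlow: "(c1 / 4) / (real n - 4) * s powr (- (real n - 4)) \<le> w s" if "s \<ge> s0" for s
    proof (rule tail_lower_bound[OF _ n(2) dw _ lim(1) that])
      show "w' x \<le> - (c1 / 4) * x powr (- (real n - 4) - 1)" if "x \<ge> s0" for x
      proof -
        have x: "x > 0" using that s0 by simp
        have "w' x \<le> - (c1 / 4) * x\<^sup>2 * x powr (- (real n - 2) - 1)"
          by (rule deriv_le_of_flux_le[OF x]) (use qneg[OF that] in \<open>simp add: q_def\<close>)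
        also have "x\<^sup>2 = x powr 2" using x by (simp add: powr_numeral)
        also have "- (c1 / 4) * x powr 2 * x powr (- (real n - 2) - 1) = - (c1 / 4) * x powr (- (real n - 4) - 1)"
          by (simp add: powr_add[symmetric] mult.assoc)
        finally show ?thesis .
      qed
    qed (use s0 in auto)
    define K where "K = (c1 / 4) / (real n - 4)"
    have K: "K > 0" using c1 n by (simp add: K_def)
    define s where "s = max s0 (\<bar>C\<bar> / K + 1)"
    have s: "s \<ge> s0" "s \<ge> 1" "s > \<bar>C\<bar> / K" using s0 by (auto simp: s_def)
    have "K * s powr (- (real n - 4)) \<le> \<bar>C\<bar> * s powr (- \<alpha>)"
    proof -
      have "C * s powr (- \<alpha>) \<le> \<bar>C\<bar> * s powr (- \<alpha>)" by (intro mult_right_mono) auto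
      moreover have "w s \<le> C * s powr (- \<alpha>)" using decay[of s] s s0 a by simp
      moreover have "K * s powr (- (real n - 4)) \<le> w s" using wlow[OF s(1)] unfolding K_def .
      ultimately show ?thesis by linarith
    qed
    also have "\<dots> \<le> \<bar>C\<bar> * s powr (- (real n - 4) - 1)"
      using s \<alpha> by (intro mult_left_mono powr_mono) auto
    also have "\<dots> = \<bar>C\<bar> / s * s powr (- (real n - 4))"
    proof -
      have "s powr (x - 1) = s powr x / s" for x using s by (simp add: powr_diff)
      then show ?thesis by (simp only: times_divide_eq_right times_divide_eq_left)
    qed
    finally have le: "K * s powr (- (real n - 4)) \<le> \<bar>C\<bar> / s * s powr (- (real n - 4))" .
    have "K \<le> \<bar>C\<bar> / s" by (rule mult_right_le_imp_le[OF le]) (use s in simp)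
    then show False using s K by (simp add: field_simps)
  qed
  have k'_nonneg: "k' s \<ge> 0" if "s \<ge> R" for s
    using l_nonneg[OF that] that R mult_le_cancel_left_pos[OF zero_less_power, of s "n - 1" 0 "k' s"] by simp
  have k_nonpos: "k s \<le> 0" if s: "s \<ge> R" for s
  proof (rule tendsto_lowerbound[OF lim(2)])
    show "\<forall>\<^sub>F x in at_top. k s \<le> k x"
      using eventually_ge_at_top[of s]
    proof eventually_elim
      case (elim x)
      show ?case
        by (rule nondecreasing_of_deriv[OF elim cont_on(2) dk]) (use s R k'_nonneg in auto)
    qed
  qed simp
  have q_mono: "a ^ (n - 1) * w' a \<le> b ^ (n - 1) * w' b" if "R \<le> a" "a \<le> b" for a b
    by (rule nondecreasing_of_deriv[OF that(2) cont_on(3) dq])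
      (use that R k_nonpos in \<open>auto intro!: mult_nonneg_nonpos\<close>)
  have w'_nonpos: "w' s \<le> 0" if s: "s \<ge> R" for s
  proof (rule ccontr)
    assume neg: "\<not> w' s \<le> 0"
    have pos: "w' x > 0" if "x \<ge> s" for x
    proof -
      have "0 < s ^ (n - 1) * w' s" using neg s R by simp
      also have "\<dots> \<le> x ^ (n - 1) * w' x" using q_mono s that by auto
      finally show ?thesis
        using s R that mult_less_cancel_left_pos[OF zero_less_power, of x "n - 1" 0 "w' x"] by simp
    qed
    have mono: "w a < w b" if "s \<le> a" "a < b" for a b
    proof -
      have "- w b < - w a"
      proof (rule decreasing_of_deriv[OF that(2)])
        show "continuous_on {a..b} (\<lambda>r. - w r)" by (intro continuous_intros cont_on(1)) (use that s R in auto)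
        show "DERIV (\<lambda>r. - w r) x :> - w' x" if "a < x" for x
          using DERIV_minus[OF dw[of x]] that \<open>s \<le> a\<close> s R by simp
        show "- w' x < 0" if "a < x" for x using pos[of x] that \<open>s \<le> a\<close> by simp
      qed
      then show ?thesis by simp
    qed
    have "w (s + 1) \<le> 0"
    proof (rule tendsto_lowerbound[OF lim(1)])
      show "\<forall>\<^sub>F x in at_top. w (s + 1) \<le> w x"
        using eventually_gt_at_top[of "s + 1"] by eventually_elim (use mono in \<open>auto intro!: less_imp_le\<close>)
    qed simp
    moreover have "w s < w (s + 1)" by (rule mono) auto
    ultimately show False using w[OF s] by simp
  qed
  show "w' r \<le> 0" "k r \<le> 0" "k' r \<ge> 0" using w'_nonpos k_nonpos k'_nonneg r by auto
qed

text \<open>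
  Towards the origin, \<open>e \<ge> 0\<close> preserves \<open>k' \<ge> 0\<close>, which preserves \<open>k \<le> 0\<close>, which preserves \<open>w' \<le> 0\<close>.
\<close>

lemma backward_monotone:
  assumes end_: "w' R \<le> 0" "k R \<le> 0" "k' R \<ge> 0" and r: "0 < r" "r \<le> R"
    and e: "\<And>x. r < x \<Longrightarrow> x < R \<Longrightarrow> 0 \<le> e x"
  shows "w R \<le> w r" "0 \<le> r ^ (n - 1) * k' r"
proof -
  have l: "0 \<le> s ^ (n - 1) * k' s" if s: "r \<le> s" "s \<le> R" for s
  proof -
    have "R ^ (n - 1) * k' R \<le> s ^ (n - 1) * k' s"
      by (rule nonincreasing_of_deriv[OF s(2) cont_on(4) dl]) (use s r e in auto)
    then show ?thesis using end_ r by (smt (verit) mult_nonneg_nonneg zero_le_power)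
  qed
  have k: "k s \<le> 0" if s: "r \<le> s" "s \<le> R" for s
  proof -
    have "k s \<le> k R"
    proof (rule nondecreasing_of_deriv[OF s(2) cont_on(2) dk])
      show "0 \<le> k' x" if "s < x" "x < R" for x
        using l[of x] s r that mult_le_cancel_left_pos[OF zero_less_power, of x "n - 1" 0 "k' x"] by simp
    qed (use s r in auto)
    then show ?thesis using end_ by simp
  qed
  have q: "s ^ (n - 1) * w' s \<le> 0" if s: "r \<le> s" "s \<le> R" for s
  proof -
    have "s ^ (n - 1) * w' s \<le> R ^ (n - 1) * w' R"
      by (rule nondecreasing_of_deriv[OF s(2) cont_on(3) dq])
        (use s r k in \<open>auto intro!: mult_nonneg_nonpos\<close>)
    also have "\<dots> \<le> 0" using end_ r by (intro mult_nonneg_nonpos) auto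
    finally show ?thesis .
  qed
  show "w R \<le> w r"
  proof (rule nonincreasing_of_deriv[OF r(2) cont_on(1) dw])
    show "w' x \<le> 0" if "r < x" "x < R" for x
      using q[of x] r that mult_le_cancel_left_pos[OF zero_less_power, of x "n - 1" "w' x" 0] by simp
  qed (use r in auto)
  show "0 \<le> r ^ (n - 1) * k' r" using l[of r] r by simp
qed

lemma backward_positive:
  assumes R: "R > 0" and end_: "w R > 0" "w' R \<le> 0" "k R \<le> 0" "k' R \<ge> 0"
    and e: "\<And>x. 0 < x \<Longrightarrow> x < R \<Longrightarrow> 0 \<le> w x \<Longrightarrow> 0 \<le> e x" and r: "0 < r" "r \<le> R"
  shows "w R \<le> w r" "0 \<le> r ^ (n - 1) * k' r"
proof -
  have pos: "w s > 0" if s: "0 < s" "s \<le> R" for s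
  proof (rule ccontr)
    assume "\<not> w s > 0"
    \<comment> \<open>The last zero before \<open>R\<close> is the first one after reflection.\<close>
    moreover have "continuous_on {- R..- s} (\<lambda>x. w (- x))"
      by (rule continuous_on_compose2[OF cont_on(1)[OF s(1), of R]]) (auto intro!: continuous_intros)
    ultimately have "\<exists>x>- R. x \<le> - s \<and> w (- x) = 0 \<and> (\<forall>y. - R \<le> y \<longrightarrow> y < x \<longrightarrow> w (- y) > 0)"
      using first_hit[of "- R" "- s" "\<lambda>x. w (- x)" 0] s end_ by auto
    then obtain x where x: "- R < x" "x \<le> - s" "w (- x) = 0" "\<And>y. - R \<le> y \<Longrightarrow> y < x \<Longrightarrow> w (- y) > 0"
      by blast
    have "w R \<le> w (- x)"
    proof (rule backward_monotone[OF end_(2-4)])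
      show "0 \<le> e y" if "- x < y" "y < R" for y
        using e[of y] x(4)[of "- y"] that x s by auto
    qed (use x s in auto)
    with x end_ show False by simp
  qed
  have ee: "0 \<le> e x" if "r < x" "x < R" for x using e[of x] pos[of x] that r by auto
  show "w R \<le> w r" "0 \<le> r ^ (n - 1) * k' r"
    using backward_monotone[OF end_(2-4) r ee] by auto
qed

lemma vanishing_on_tail:
  assumes R: "R > 0" and w0: "\<And>r. r > R \<Longrightarrow> w r = 0" and r: "r > R"
  shows "r ^ (n - 1) * w' r = 0" "k r = 0" "r ^ (n - 1) * k' r = 0"
proof -
  have local: "d = 0" if "DERIV f x :> d" "\<And>s. s > R \<Longrightarrow> f s = 0" "x > R"
    for f :: "real \<Rightarrow> real" and d x
  proof -
    have "DERIV (\<lambda>_. 0) x :> d"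
      by (rule has_field_derivative_transform_within_open[OF that(1), of "{R<..}"]) (use that in auto)
    then show ?thesis using DERIV_unique DERIV_const by blast
  qed
  have q: "s ^ (n - 1) * w' s = 0" if "s > R" for s
    using local[OF dw w0 that] that R by simp
  have k: "k s = 0" if "s > R" for s
    using local[OF dq q that] that R by simp
  have "k' r = 0" using local[OF dk k r] r R by simp
  then show "r ^ (n - 1) * w' r = 0" "k r = 0" "r ^ (n - 1) * k' r = 0" using q k r by auto
qed

text \<open>
  Gronwall's inequality for the sum of squares of \<open>w\<close>, \<open>k\<close> and the two fluxes; away from the origin the
  coefficients of the first-order system are bounded.
\<close>

lemma backward_uniqueness:
  assumes \<epsilon>: "\<epsilon> > 0" "\<epsilon> \<le> R" and L: "L \<ge> 0"
    and zero: "w R = 0" "R ^ (n - 1) * w' R = 0" "k R = 0" "R ^ (n - 1) * k' R = 0"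
    and lip: "\<And>r. \<epsilon> \<le> r \<Longrightarrow> r \<le> R \<Longrightarrow> \<bar>e r\<bar> \<le> L * \<bar>w r\<bar>"
  shows "w \<epsilon> = 0"
proof -
  define q where "q = (\<lambda>r. r ^ (n - 1) * w' r)"
  define l where "l = (\<lambda>r. r ^ (n - 1) * k' r)"
  define Q where "Q = (\<lambda>r. (w r)\<^sup>2 + (q r)\<^sup>2 + (k r)\<^sup>2 + (l r)\<^sup>2)"
  define M where "M = max (R ^ (n - 1)) (1 / \<epsilon> ^ (n - 1))"
  define Q' where "Q' = (\<lambda>r. 2 * (w r * w' r) + 2 * (q r * - (r ^ (n - 1) * k r)) + 2 * (k r * k' r)
      + 2 * (l r * - (r ^ (n - 1) * e r)))"
  define c where "c = M * (2 + L)"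
  have dQ: "DERIV Q r :> Q' r" if "r > 0" for r
    unfolding Q_def Q'_def q_def l_def
    by (rule derivative_eq_intros dw dk dq dl that refl | simp)+
  have Q'_ge: "- (c * Q r) \<le> Q' r" if r: "\<epsilon> \<le> r" "r \<le> R" for r
  proof -
    have pw: "0 < r ^ (n - 1)" "r ^ (n - 1) \<le> M" "1 / r ^ (n - 1) \<le> M"
    proof -
      show "0 < r ^ (n - 1)" using r \<epsilon> by simp
      have "r ^ (n - 1) \<le> R ^ (n - 1)" using r \<epsilon> by (intro power_mono) auto
      then show "r ^ (n - 1) \<le> M" by (simp add: M_def)
      have "1 / r ^ (n - 1) \<le> 1 / \<epsilon> ^ (n - 1)" using r \<epsilon> by (intro divide_left_mono power_mono) auto
      then show "1 / r ^ (n - 1) \<le> M" by (simp add: M_def)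
    qed
    have M0: "M \<ge> 0" using pw by linarith
    have am: "2 * (x * y * m) \<le> M * (x\<^sup>2 + y\<^sup>2)" if "0 \<le> m" "m \<le> M" for x y m
    proof -
      have "2 * (x * y) * m \<le> (x\<^sup>2 + y\<^sup>2) * m" using that sum_squares_bound[of x y] by (intro mult_right_mono) auto
      also have "\<dots> \<le> (x\<^sup>2 + y\<^sup>2) * M" using that by (intro mult_left_mono) auto
      finally show ?thesis by (simp add: mult_ac)
    qed
    have w': "w' r = q r * (1 / r ^ (n - 1))" and k': "k' r = l r * (1 / r ^ (n - 1))"
      using r \<epsilon> by (auto simp: q_def l_def)
    have 1: "- (2 * (w r * w' r)) \<le> M * ((w r)\<^sup>2 + (q r)\<^sup>2)"
      using am[of "1 / r ^ (n - 1)" "- w r" "q r"] pw by (simp add: w')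
    have 2: "2 * (q r * (r ^ (n - 1) * k r)) \<le> M * ((q r)\<^sup>2 + (k r)\<^sup>2)"
      using am[of "r ^ (n - 1)" "q r" "k r"] pw by (simp add: mult_ac)
    have 3: "- (2 * (k r * k' r)) \<le> M * ((k r)\<^sup>2 + (l r)\<^sup>2)"
      using am[of "1 / r ^ (n - 1)" "- k r" "l r"] pw by (simp add: k')
    have "2 * (l r * (r ^ (n - 1) * e r)) \<le> 2 * (\<bar>l r\<bar> * (r ^ (n - 1) * (L * \<bar>w r\<bar>)))"
    proof -
      have "l r * (r ^ (n - 1) * e r) \<le> \<bar>l r\<bar> * (r ^ (n - 1) * \<bar>e r\<bar>)"
        using pw by (metis abs_ge_self abs_mult abs_of_pos)
      also have "\<dots> \<le> \<bar>l r\<bar> * (r ^ (n - 1) * (L * \<bar>w r\<bar>))"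
        using pw lip[OF r] by (intro mult_left_mono) auto
      finally show ?thesis by simp
    qed
    also have "\<dots> = L * (2 * (\<bar>l r\<bar> * \<bar>w r\<bar> * r ^ (n - 1)))" by (simp add: mult_ac)
    also have "\<dots> \<le> L * (M * (\<bar>l r\<bar>\<^sup>2 + \<bar>w r\<bar>\<^sup>2))"
      using am[of "r ^ (n - 1)" "\<bar>l r\<bar>" "\<bar>w r\<bar>"] pw L by (intro mult_left_mono) auto
    finally have 4: "2 * (l r * (r ^ (n - 1) * e r)) \<le> L * (M * ((l r)\<^sup>2 + (w r)\<^sup>2))" by simp
    have "0 \<le> L * M * ((q r)\<^sup>2 + (k r)\<^sup>2)" "0 \<le> M * ((w r)\<^sup>2 + (l r)\<^sup>2)" using L M0 by auto
    with 1 2 3 4 show ?thesis by (simp add: Q'_def Q_def c_def algebra_simps)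
  qed
  have "exp (c * \<epsilon>) * Q \<epsilon> \<le> exp (c * R) * Q R"
  proof (rule nondecreasing_of_deriv[OF \<epsilon>(2)])
    show d: "DERIV (\<lambda>r. exp (c * r) * Q r) r :> exp (c * r) * (c * Q r + Q' r)"
      if "\<epsilon> < r" for r
      by (rule derivative_eq_intros dQ refl)+ (use that \<epsilon> in \<open>auto simp: algebra_simps\<close>)
    show "continuous_on {\<epsilon>..R} (\<lambda>r. exp (c * r) * Q r)"
      by (intro continuous_intros continuous_at_imp_continuous_on ballI DERIV_isCont[OF dQ]) (use \<epsilon> in auto)
    show "0 \<le> exp (c * r) * (c * Q r + Q' r)" if "\<epsilon> < r" "r < R" for r
      using Q'_ge[of r] that by simp
  qed
  moreover have "Q R = 0" using zero by (simp add: Q_def q_def l_def)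
  ultimately have "Q \<epsilon> \<le> 0" by (simp add: mult_le_0_iff)
  moreover have "(w \<epsilon>)\<^sup>2 \<le> Q \<epsilon>" by (simp add: Q_def)
  ultimately have "(w \<epsilon>)\<^sup>2 \<le> 0" by linarith
  then show ?thesis by simp
qed

end

section \<open>Convergence to the equilibrium of the autonomous equation\<close>

text \<open>
  If \<open>\<bar>y\<bar>\<close> reached \<open>\<epsilon>\<close> at late times, it would stay above \<open>\<epsilon> / 2\<close> for a fixed duration \<open>d\<close>, and \<open>G\<close> would
  then gain a fixed amount \<open>\<eta>\<close> each time, although it is within \<open>\<eta>\<close> of its supremum.
\<close>

lemma barbalat:
  fixes G g y y' :: "real \<Rightarrow> real"
  assumes G: "\<And>t. t \<ge> T \<Longrightarrow> DERIV G t :> g t"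
    and y: "\<And>t. t \<ge> T \<Longrightarrow> DERIV y t :> y' t"
    and L: "\<And>t. t \<ge> T \<Longrightarrow> \<bar>y' t\<bar> \<le> L"
    and M: "\<And>t. t \<ge> T \<Longrightarrow> G t \<le> M"
    and c: "c > 0" and g: "\<And>t. t \<ge> T \<Longrightarrow> c * (y t)\<^sup>2 \<le> g t"
  shows "(y \<longlongrightarrow> 0) at_top"
proof (rule tendstoI)
  fix \<epsilon> :: real assume \<epsilon>: "\<epsilon> > 0"
  have L0: "L \<ge> 0" using L[of T] by simp
  define d where "d = \<epsilon> / (2 * (L + 1))"
  have d: "d > 0" using \<epsilon> L0 by (simp add: d_def)
  have Ld: "L * d \<le> \<epsilon> / 2" using \<epsilon> L0 by (simp add: d_def field_simps)
  define S where "S = Sup (G ` {T..})"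
  have bdd: "bdd_above (G ` {T..})" using M by (auto simp: bdd_above_def)
  define \<eta> where "\<eta> = c * (\<epsilon> / 2)\<^sup>2 * d"
  have \<eta>: "\<eta> > 0" using c \<epsilon> d by (simp add: \<eta>_def)
  obtain T1 where T1: "T1 \<ge> T" "G T1 > S - \<eta>"
    using less_cSupD[of "G ` {T..}" "S - \<eta>"] \<eta> by (auto simp: S_def)
  have mono: "G s \<le> G t" if "T \<le> s" "s \<le> t" for s t
  proof (rule nondecreasing_of_deriv[OF that(2) _ G])
    show "continuous_on {s..t} G"
      by (rule continuous_on_of_deriv, rule G) (use that in auto)
    show "0 \<le> g x" if "s < x" for x
    proof -
      have "0 \<le> c * (y x)\<^sup>2" using c by simp
      also have "\<dots> \<le> g x" using g[of x] that \<open>T \<le> s\<close> by simp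
      finally show ?thesis .
    qed
  qed (use that in auto)
  have small: "\<bar>y t\<bar> < \<epsilon>" if t: "t \<ge> T1" for t
  proof (rule ccontr)
    assume big: "\<not> \<bar>y t\<bar> < \<epsilon>"
    have half: "\<bar>y s\<bar> \<ge> \<epsilon> / 2" if s: "t \<le> s" "s \<le> t + d" for s
    proof -
      have cont: "continuous_on {t..s} y"
        by (rule continuous_on_of_deriv, rule y) (use t T1 in auto)
      have "y s - y t \<le> L * s - L * t"
        by (rule increment_mono[OF s(1) cont _ y])
          (use t T1 L in \<open>auto intro!: continuous_intros derivative_eq_intros simp: abs_le_iff\<close>)
      moreover have "(- L) * s - (- L) * t \<le> y s - y t"
      proof (rule increment_mono[OF s(1) _ cont _ y])
        show "DERIV (\<lambda>x. (- L) * x) x :> - L" for x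
          by (auto intro!: derivative_eq_intros)
        show "- L \<le> y' x" if "t < x" for x using L[of x] that t T1 by (simp add: abs_le_iff)
      qed (use t T1 in \<open>auto intro!: continuous_intros\<close>)
      moreover have "L * (s - t) \<le> L * d" using s L0 by (intro mult_left_mono) auto
      ultimately show ?thesis using big Ld by (simp add: algebra_simps)
    qed
    have "c * (\<epsilon> / 2)\<^sup>2 * (t + d) - c * (\<epsilon> / 2)\<^sup>2 * t \<le> G (t + d) - G t"
    proof (rule increment_mono[OF _ _ _ _ G])
      show "DERIV (\<lambda>x. c * (\<epsilon> / 2)\<^sup>2 * x) x :> c * (\<epsilon> / 2)\<^sup>2" for x
        by (auto intro!: derivative_eq_intros)
      show "continuous_on {t..t + d} G"
        by (rule continuous_on_of_deriv, rule G) (use t T1 in auto)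
      show "c * (\<epsilon> / 2)\<^sup>2 \<le> g x" if "t < x" "x < t + d" for x
      proof -
        have "(\<epsilon> / 2)\<^sup>2 \<le> \<bar>y x\<bar>\<^sup>2" using half[of x] that \<epsilon> by (intro power_mono) auto
        then have "c * (\<epsilon> / 2)\<^sup>2 \<le> c * (y x)\<^sup>2" using c by simp
        also have "\<dots> \<le> g x" using g[of x] that t T1 by simp
        finally show ?thesis .
      qed
    qed (use d t T1 in \<open>auto intro!: continuous_intros\<close>)
    then have "\<eta> \<le> G (t + d) - G t" by (simp add: \<eta>_def algebra_simps)
    moreover have "G T1 \<le> G t" using mono[of T1 t] T1 t by simp
    moreover have "G (t + d) \<le> S" unfolding S_def using bdd t T1 d by (intro cSup_upper) auto
    ultimately show False using T1 by linarith
  qed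
  show "\<forall>\<^sub>F t in at_top. dist (y t) 0 < \<epsilon>"
    using eventually_ge_at_top[of T1] by eventually_elim (use small in simp)
qed

text \<open>
  Variation of constants, as monotonicity of \<open>e\<^sup>\<kappa>\<^sup>t (y - M / \<kappa>)\<close>.
\<close>

lemma bounded_of_damped:
  fixes y g :: "real \<Rightarrow> real"
  assumes \<kappa>: "\<kappa> > 0" and y: "\<And>t. DERIV y t :> - \<kappa> * y t + g t"
    and g: "\<And>t. t \<ge> T \<Longrightarrow> g t \<le> M"
  shows "\<exists>C. \<forall>t\<ge>T. y t \<le> C"
proof (intro exI allI impI)
  fix t assume t: "t \<ge> T"
  define c where "c = M / \<kappa>"
  have c: "\<kappa> * c = M" using \<kappa> by (simp add: c_def)
  have f': "DERIV (\<lambda>t. exp (\<kappa> * t) * (y t - c)) x :> exp (\<kappa> * x) * (g x - M)" for x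
    unfolding c[symmetric] by (rule derivative_eq_intros y refl)+ (simp add: algebra_simps)
  have "exp (\<kappa> * t) * (y t - c) \<le> exp (\<kappa> * T) * (y T - c)"
  proof (rule nonincreasing_of_deriv[OF t _ f'])
    show "continuous_on {T..t} (\<lambda>t. exp (\<kappa> * t) * (y t - c))"
      by (rule continuous_on_of_deriv, rule f')
    show "exp (\<kappa> * x) * (g x - M) \<le> 0" if "T < x" for x
      using g[of x] that by (simp add: mult_nonneg_nonpos)
  qed
  also have "\<dots> \<le> exp (\<kappa> * T) * \<bar>y T - c\<bar>" by (intro mult_left_mono) auto
  also have "\<dots> \<le> exp (\<kappa> * t) * \<bar>y T - c\<bar>" using t \<kappa> by (intro mult_right_mono) auto
  finally have "y t - c \<le> \<bar>y T - c\<bar>" by simp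
  then show "y t \<le> c + \<bar>y T - c\<bar>" by simp
qed

definition bounded_from :: "real \<Rightarrow> (real \<Rightarrow> real) \<Rightarrow> bool" where
  "bounded_from T f \<longleftrightarrow> (\<exists>C. \<forall>t\<ge>T. \<bar>f t\<bar> \<le> C)"

lemma bounded_from_add: "bounded_from T f \<Longrightarrow> bounded_from T g \<Longrightarrow> bounded_from T (\<lambda>t. f t + g t)"
  unfolding bounded_from_def by (metis abs_triangle_ineq add_mono order_trans)

lemma bounded_from_mult: "bounded_from T f \<Longrightarrow> bounded_from T g \<Longrightarrow> bounded_from T (\<lambda>t. f t * g t)"
proof -
  assume "bounded_from T f" "bounded_from T g"
  then obtain C D where CD: "\<And>t. t \<ge> T \<Longrightarrow> \<bar>f t\<bar> \<le> C" "\<And>t. t \<ge> T \<Longrightarrow> \<bar>g t\<bar> \<le> D"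
    unfolding bounded_from_def by blast
  have "\<bar>f t * g t\<bar> \<le> C * D" if "t \<ge> T" for t
    unfolding abs_mult
    by (rule mult_mono[OF CD(1)[OF that] CD(2)[OF that]]) (use CD(1)[OF that] abs_ge_zero[of "f t"] in linarith, simp)
  then show ?thesis unfolding bounded_from_def by blast
qed

lemma bounded_from_const: "bounded_from T (\<lambda>t. c)"
  unfolding bounded_from_def by auto

lemma bounded_from_minus: "bounded_from T f \<Longrightarrow> bounded_from T g \<Longrightarrow> bounded_from T (\<lambda>t. f t - g t)"
  using bounded_from_add[of T f "\<lambda>t. (- 1) * g t"] bounded_from_mult[OF bounded_from_const[of T "- 1"], of g] by simp

lemmas bounded_from_intros = bounded_from_add bounded_from_mult bounded_from_const bounded_from_minus

text \<open>
  The nonlinearity \<open>K\<^sup>p\<^sup>-\<^sup>1 x - x\<^sup>p\<close> controls the squared distance to its zero \<open>K\<close>; away from \<open>0\<close> this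
  is the mean value theorem for \<open>x\<^sup>p\<^sup>-\<^sup>1\<close>.  The minimum covers both monotonicities of \<open>x\<^sup>p\<^sup>-\<^sup>2\<close>.
\<close>

lemma powr_gap:
  fixes K w p x :: real
  assumes p: "p > 1" and w: "0 < w" and x: "w \<le> x" "x \<le> K"
  shows "w * (p - 1) * min (w powr (p - 2)) (K powr (p - 2)) / K * (K - x)\<^sup>2 \<le> K powr (p - 1) * x - x powr p"
proof (cases "x = K")
  case True
  then have "x powr p = x powr (p - 1) * x" using w x powr_mult_base[of x "p - 1"] by (simp add: mult.commute)
  with True show ?thesis by simp
next
  case False
  then have xK: "x < K" using x by simp
  define c where "c = min (w powr (p - 2)) (K powr (p - 2))"
  have c: "c > 0" using w x by (auto simp: c_def)
  have "\<exists>\<xi>. x < \<xi> \<and> \<xi> < K \<and> K powr (p - 1) - x powr (p - 1) = (K - x) * ((p - 1) * \<xi> powr (p - 1 - 1))"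
    by (rule MVT2[OF xK]) (use w x p in \<open>auto intro!: derivative_eq_intros\<close>)
  then obtain \<xi> where \<xi>: "x < \<xi>" "\<xi> < K"
    and mv: "K powr (p - 1) - x powr (p - 1) = (K - x) * ((p - 1) * \<xi> powr (p - 2))" by auto
  have "c \<le> \<xi> powr (p - 2)"
  proof (cases "p \<ge> 2")
    case True
    then have "w powr (p - 2) \<le> \<xi> powr (p - 2)" using w x \<xi> by (intro powr_mono2) auto
    then show ?thesis by (simp add: c_def)
  next
    case False
    then have "K powr (p - 2) \<le> \<xi> powr (p - 2)" using w x \<xi> by (intro powr_mono2') auto
    then show ?thesis by (simp add: c_def)
  qed
  then have "(K - x) * ((p - 1) * c) \<le> (K - x) * ((p - 1) * \<xi> powr (p - 2))"
    using p xK by (intro mult_left_mono) auto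
  then have 1: "(K - x) * ((p - 1) * c) \<le> K powr (p - 1) - x powr (p - 1)" by (simp add: mv)
  have "(K - x) / K \<le> 1" using w x by simp
  then have "w * ((K - x) * ((p - 1) * c)) * ((K - x) / K) \<le> w * ((K - x) * ((p - 1) * c)) * 1"
    using w x p c by (intro mult_left_mono) auto
  also have "\<dots> \<le> x * (K powr (p - 1) - x powr (p - 1))"
    using 1 w x p c xK by (simp only: mult_1_right) (intro mult_mono, auto)
  also have "\<dots> = K powr (p - 1) * x - x powr p"
    using w x powr_mult_base[of x "p - 1"] by (simp add: algebra_simps)
  finally show ?thesis by (simp add: c_def power2_eq_square mult_ac)
qed

text \<open>
  Written out, the equation is \<open>D\<^sup>4 W + K3 D\<^sup>3 W + K2 D\<^sup>2 W + K1 D W + K\<^sup>p\<^sup>-\<^sup>1 W = W\<^sup>p\<close>, and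
  supercriticality \<open>2 \<gamma> < N - 4\<close> means \<open>K3 > 0 > K1\<close>.  So the energy \<open>E\<close> increases, with
  \<open>E' = K3 W''\<^sup>2 - K1 W'\<^sup>2\<close>, from its limit \<open>0\<close> at \<open>- \<infinity>\<close>.  All quantities are bounded at
  \<open>+ \<infinity>\<close>, hence \<open>W'\<close> and \<open>W''\<close> tend to \<open>0\<close>; the energy being positive, \<open>W\<close> stays away from \<open>0\<close>.
  Finally the equation exhibits \<open>K\<^sup>p\<^sup>-\<^sup>1 W - W\<^sup>p \<ge> 0\<close> as the derivative of a bounded function, which forces
  \<open>K - W\<close> to \<open>0\<close>.
\<close>

lemma (in emden_fowler) convergence_to_equilibrium:
  assumes \<gamma>: "\<gamma> > 0" "2 * \<gamma> < N - 4" and p: "p > 1" and K: "K > 0"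
    and Kp: "K powr (p - 1) = \<gamma> * (\<gamma> + 2) * (N - 2 - \<gamma>) * (N - 4 - \<gamma>)"
    and X: "\<And>t. X t = W t powr p"
    and pos: "\<And>t. W t > 0" "\<And>t. A t \<ge> 0" "\<And>t. Z t \<ge> 0" "\<And>t. B t \<ge> 0"
    and upper: "\<And>t. t \<ge> T \<Longrightarrow> W t \<le> K"
    and bot: "(W \<longlongrightarrow> 0) at_bot" "(A \<longlongrightarrow> 0) at_bot" "(Z \<longlongrightarrow> 0) at_bot" "(B \<longlongrightarrow> 0) at_bot"
    and top: "((\<lambda>t. exp (- (\<gamma> + 2) * t) * Z t) \<longlongrightarrow> 0) at_top"
  shows "(W \<longlongrightarrow> K) at_top"
proof -
  define \<alpha> where "\<alpha> = \<gamma> + 2 - N"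
  define \<beta> where "\<beta> = \<gamma> + 2"
  define \<delta> where "\<delta> = \<gamma> + 4 - N"
  define k0 where "k0 = K powr (p - 1)"
  have k0: "k0 > 0" using K by (simp add: k0_def)
  have k0_eq: "k0 = \<gamma> * \<beta> * \<alpha> * \<delta>" unfolding k0_def Kp by (simp add: \<alpha>_def \<beta>_def \<delta>_def algebra_simps)
  note dA' = dA[folded \<alpha>_def] and dZ' = dZ[folded \<beta>_def] and dB' = dB[folded \<delta>_def]
  \<comment> \<open>\<open>B\<close> and \<open>A\<close> are damped forward in time; \<open>Z\<close> is not, and is bounded by integrating from \<open>+ \<infinity>\<close>.\<close>
  have bW: "bounded_from T W"
    unfolding bounded_from_def using upper pos(1) by (intro exI[of _ K]) (auto simp: less_imp_le)
  have bX: "X t \<le> K powr p" if "t \<ge> T" for t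
    unfolding X using upper[OF that] pos(1)[of t] p by (intro powr_mono2) auto
  have "\<exists>C. \<forall>t\<ge>T. B t \<le> C"
  proof (rule bounded_of_damped)
    show "- \<delta> > 0" using \<gamma> by (simp add: \<delta>_def)
    show "DERIV B t :> - (- \<delta>) * B t + X t" for t using dB' by simp
  qed (use bX in auto)
  then obtain CB where CB: "\<And>t. t \<ge> T \<Longrightarrow> B t \<le> CB" by blast
  have CZ: "Z t \<le> CB / \<beta>" if t: "t \<ge> T" for t
  proof -
    define f where "f = (\<lambda>t. exp (- \<beta> * t) * (Z t - CB / \<beta>))"
    have b: "\<beta> > 0" using \<gamma> by (simp add: \<beta>_def)
    have f': "DERIV f t :> exp (- \<beta> * t) * (CB - B t)" for t
      unfolding f_def by (rule derivative_eq_intros dZ' refl)+ (use b in \<open>simp add: algebra_simps\<close>)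
    have mono: "f t \<le> f s" if "t \<le> s" for s
    proof (rule nondecreasing_of_deriv[OF that _ f'])
      show "continuous_on {t..s} f"
        by (rule continuous_on_of_deriv, rule f')
      show "0 \<le> exp (- \<beta> * x) * (CB - B x)" if "t < x" for x using CB[of x] that t by simp
    qed
    have "((\<lambda>t. exp (- \<beta> * t)) \<longlongrightarrow> 0) at_top"
      by (rule filterlim_compose[OF exp_at_bot], rule filterlim_tendsto_neg_mult_at_bot[OF tendsto_const _ filterlim_ident])
        (use b in simp)
    then have "((\<lambda>t. exp (- \<beta> * t) * Z t - exp (- \<beta> * t) * (CB / \<beta>)) \<longlongrightarrow> 0 - 0 * (CB / \<beta>)) at_top"
      by (intro tendsto_intros top[folded \<beta>_def])
    then have lim: "(f \<longlongrightarrow> 0) at_top" by (simp add: f_def algebra_simps)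
    have "f t \<le> 0"
      by (rule tendsto_lowerbound[OF lim]) (auto intro: eventually_mono[OF eventually_ge_at_top mono])
    then show ?thesis by (simp add: f_def mult_le_0_iff)
  qed
  have "\<exists>C. \<forall>t\<ge>T. A t \<le> C"
  proof (rule bounded_of_damped)
    show "- \<alpha> > 0" using \<gamma> by (simp add: \<alpha>_def)
    show "DERIV A t :> - (- \<alpha>) * A t + Z t" for t using dA' by simp
  qed (use CZ in auto)
  then obtain CA where CA: "\<And>t. t \<ge> T \<Longrightarrow> A t \<le> CA" by blast
  have bA: "bounded_from T A" unfolding bounded_from_def using CA pos(2) by (intro exI[of _ CA]) auto
  have bZ: "bounded_from T Z" unfolding bounded_from_def using CZ pos(3) by (intro exI[of _ "CB / \<beta>"]) auto
  have bB: "bounded_from T B" unfolding bounded_from_def using CB pos(4) by (intro exI[of _ CB]) auto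
  \<comment> \<open>The derivatives of \<open>W\<close> up to order four, expressed through the chain of first-order equations.\<close>
  define v1 where "v1 = (\<lambda>t. \<gamma> * W t - A t)"
  define A1 where "A1 = (\<lambda>t. \<alpha> * A t + Z t)"
  define Z1 where "Z1 = (\<lambda>t. \<beta> * Z t - B t)"
  define B1 where "B1 = (\<lambda>t. \<delta> * B t + X t)"
  define v2 where "v2 = (\<lambda>t. \<gamma> * v1 t - A1 t)"
  define A2 where "A2 = (\<lambda>t. \<alpha> * A1 t + Z1 t)"
  define v3 where "v3 = (\<lambda>t. \<gamma> * v2 t - A2 t)"
  define v4 where "v4 = (\<lambda>t. \<gamma> * v3 t - (\<alpha> * A2 t + (\<beta> * Z1 t - B1 t)))"
  have d0: "DERIV W t :> v1 t" for t using dW by (simp add: v1_def)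
  have dA1: "DERIV A t :> A1 t" for t using dA' by (simp add: A1_def)
  have dZ1: "DERIV Z t :> Z1 t" for t using dZ' by (simp add: Z1_def)
  have dB1: "DERIV B t :> B1 t" for t using dB' by (simp add: B1_def)
  have dA2: "DERIV A1 t :> A2 t" for t
    unfolding A1_def by (rule derivative_eq_intros dA1 dZ1 refl)+ (simp add: A2_def A1_def)
  have dZ2: "DERIV Z1 t :> \<beta> * Z1 t - B1 t" for t
    unfolding Z1_def by (rule derivative_eq_intros dZ1 dB1 refl)+ (simp add: Z1_def)
  have d1: "DERIV v1 t :> v2 t" for t
    unfolding v1_def by (rule derivative_eq_intros d0 dA1 refl)+ (simp add: v2_def v1_def)
  have d2: "DERIV v2 t :> v3 t" for t
    unfolding v2_def by (rule derivative_eq_intros d1 dA2 refl)+ (simp add: v3_def v2_def)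
  have dA3: "DERIV A2 t :> \<alpha> * A2 t + (\<beta> * Z1 t - B1 t)" for t
    unfolding A2_def by (rule derivative_eq_intros dA2 dZ2 refl)+ (simp add: A2_def)
  have d3: "DERIV v3 t :> v4 t" for t
    unfolding v3_def by (rule derivative_eq_intros d2 dA3 refl)+ (simp add: v4_def v3_def)
  define K1 where "K1 = - (\<gamma> * \<alpha> * \<beta> + \<gamma> * \<alpha> * \<delta> + \<gamma> * \<beta> * \<delta> + \<alpha> * \<beta> * \<delta>)"
  define K2 where "K2 = \<gamma> * \<alpha> + \<gamma> * \<beta> + \<gamma> * \<delta> + \<alpha> * \<beta> + \<alpha> * \<delta> + \<beta> * \<delta>"
  define K3 where "K3 = - (\<gamma> + \<alpha> + \<beta> + \<delta>)"
  have ode: "v4 t + K3 * v3 t + K2 * v2 t + K1 * v1 t + k0 * W t = X t" for t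
    unfolding v4_def v3_def v2_def v1_def A2_def Z1_def B1_def A1_def K3_def K2_def K1_def k0_eq
    by (simp add: algebra_simps)
  have K3: "K3 > 0" using \<gamma> by (simp add: K3_def \<alpha>_def \<beta>_def \<delta>_def)
  have K1: "K1 < 0"
  proof -
    \<comment> \<open>The roots are \<open>- c \<plusminus> a\<close> and \<open>- c \<plusminus> (a + 2)\<close>, symmetric about \<open>- c\<close>.\<close>
    define c where "c = (N - 4) / 2 - \<gamma>"
    define a where "a = (N - 4) / 2"
    have "c = a - \<gamma>" "2 * a = N - 4" by (simp_all add: c_def a_def)
    then have c: "0 < c" "c < a" using \<gamma> by linarith+
    have e: "\<gamma> = a - c" "\<alpha> = - (a + 2) - c" "\<beta> = a + 2 - c" "\<delta> = - a - c"
      by (auto simp: a_def c_def \<alpha>_def \<beta>_def \<delta>_def field_simps)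
    have "K1 = - (2 * c * ((a\<^sup>2 - c\<^sup>2) + ((a + 2)\<^sup>2 - c\<^sup>2)))"
      unfolding K1_def e by (simp add: power2_eq_square algebra_simps)
    moreover have "c\<^sup>2 < a\<^sup>2" "c\<^sup>2 < (a + 2)\<^sup>2" using c by (auto intro!: power_strict_mono)
    ultimately show ?thesis using c by (auto intro!: mult_pos_pos)
  qed
  define E where "E = (\<lambda>t. v1 t * v3 t - (v2 t)\<^sup>2 / 2 + K3 * (v1 t * v2 t) + K2 * (v1 t)\<^sup>2 / 2
    + k0 * (W t)\<^sup>2 / 2 - W t powr (p + 1) / (p + 1))"
  have dE: "DERIV E t :> K3 * (v2 t)\<^sup>2 - K1 * (v1 t)\<^sup>2" for t
  proof -
    have dP: "DERIV (\<lambda>t. W t powr (p + 1)) t :> (p + 1) * (W t powr p * v1 t)"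
      using DERIV_chain2[OF has_real_derivative_powr[OF pos(1), of "p + 1"] d0, of t] by (simp add: mult.assoc)
    have "X t = W t powr p" by (rule X)
    with ode[of t] have v4: "v4 t = W t powr p - K3 * v3 t - K2 * v2 t - K1 * v1 t - k0 * W t" by simp
    define a where "a = (1 / 2 :: real)"
    define b where "b = 1 / (p + 1)"
    have b: "b * (p + 1) = 1" using p by (simp add: b_def)
    have "E = (\<lambda>t. v1 t * v3 t - a * (v2 t * v2 t) + K3 * (v1 t * v2 t) + K2 * (a * (v1 t * v1 t))
        + k0 * (a * (W t * W t)) - b * W t powr (p + 1))"
      by (simp add: E_def a_def b_def power2_eq_square)
    moreover have "DERIV (\<lambda>t. v1 t * v3 t - a * (v2 t * v2 t) + K3 * (v1 t * v2 t) + K2 * (a * (v1 t * v1 t))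
        + k0 * (a * (W t * W t)) - b * W t powr (p + 1)) t :>
        (v2 t * v3 t + v4 t * v1 t) - a * (v3 t * v2 t + v3 t * v2 t) + K3 * (v2 t * v2 t + v3 t * v1 t)
        + K2 * (a * (v2 t * v1 t + v2 t * v1 t)) + k0 * (a * (v1 t * W t + v1 t * W t))
        - b * ((p + 1) * (W t powr p * v1 t))"
      by (intro DERIV_add DERIV_diff DERIV_cmult DERIV_mult d0 d1 d2 d3 dP)
    moreover have "(v2 t * v3 t + v4 t * v1 t) - a * (v3 t * v2 t + v3 t * v2 t) + K3 * (v2 t * v2 t + v3 t * v1 t)
        + K2 * (a * (v2 t * v1 t + v2 t * v1 t)) + k0 * (a * (v1 t * W t + v1 t * W t))
        - b * ((p + 1) * (W t powr p * v1 t)) = K3 * (v2 t)\<^sup>2 - K1 * (v1 t)\<^sup>2"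
      unfolding mult.assoc[symmetric, of b] b
      by (simp add: v4 a_def power2_eq_square algebra_simps)
    ultimately show ?thesis by metis
  qed
  have Eg: "K3 * (v2 t)\<^sup>2 - K1 * (v1 t)\<^sup>2 \<ge> K3 * (v2 t)\<^sup>2" "K3 * (v2 t)\<^sup>2 - K1 * (v1 t)\<^sup>2 \<ge> - K1 * (v1 t)\<^sup>2" for t
    using K1 K3 by (auto simp: mult_nonpos_nonneg)
  have Eg0: "K3 * (v2 t)\<^sup>2 - K1 * (v1 t)\<^sup>2 \<ge> 0" for t
  proof -
    have "0 \<le> K3 * (v2 t)\<^sup>2" using K3 by simp
    with Eg(1)[of t] show ?thesis by linarith
  qed
  have E_mono: "E s \<le> E t" if "s \<le> t" for s t
    by (rule nondecreasing_of_deriv[OF that _ dE Eg0], rule continuous_on_of_deriv, rule dE)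
  have E_bot: "(E \<longlongrightarrow> 0) at_bot"
  proof -
    have l: "(X \<longlongrightarrow> 0) at_bot" "((\<lambda>t. W t powr (p + 1)) \<longlongrightarrow> 0) at_bot"
      unfolding X using tendsto_powr'[OF bot(1) tendsto_const, of p] tendsto_powr'[OF bot(1) tendsto_const, of "p + 1"]
        p pos(1) by (auto simp: less_imp_le)
    have l1: "(v1 \<longlongrightarrow> 0) at_bot" "(A1 \<longlongrightarrow> 0) at_bot" "(Z1 \<longlongrightarrow> 0) at_bot"
      unfolding v1_def A1_def Z1_def by (rule tendsto_eq_intros bot refl | simp)+
    have l2: "(v2 \<longlongrightarrow> 0) at_bot" "(A2 \<longlongrightarrow> 0) at_bot"
      unfolding v2_def A2_def by (rule tendsto_eq_intros l1 refl | simp)+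
    have l3: "(v3 \<longlongrightarrow> 0) at_bot"
      unfolding v3_def by (rule tendsto_eq_intros l2 refl | simp)+
    have "(E \<longlongrightarrow> 0 * 0 - 0\<^sup>2 / 2 + K3 * (0 * 0) + K2 * 0\<^sup>2 / 2 + k0 * 0\<^sup>2 / 2 - 0 / (p + 1)) at_bot"
      unfolding E_def
      by (intro tendsto_add tendsto_diff tendsto_mult tendsto_divide tendsto_power tendsto_const l l1 l2 l3 bot)
        (use p in auto)
    then show ?thesis by simp
  qed
  have E_nonneg: "E t \<ge> 0" for t
    by (rule tendsto_upperbound[OF E_bot]) (auto intro: eventually_mono[OF eventually_le_at_bot E_mono])
  have E_pos: "E t > 0" for t
  proof (rule ccontr)
    assume "\<not> E t > 0"
    then have E0: "E s = 0" if "s \<le> t" for s using E_mono[OF that] E_nonneg[of s] by simp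
    have v0: "v1 s = 0" if s: "s < t" for s
    proof -
      have "DERIV (\<lambda>_. 0) s :> K3 * (v2 s)\<^sup>2 - K1 * (v1 s)\<^sup>2"
        by (rule has_field_derivative_transform_within_open[OF dE, of "{..<t}"]) (use s E0 in auto)
      then have "K3 * (v2 s)\<^sup>2 - K1 * (v1 s)\<^sup>2 = 0" using DERIV_unique DERIV_const by blast
      with Eg(2)[of s] have "- K1 * (v1 s)\<^sup>2 \<le> 0" by simp
      then show ?thesis using K1 by (simp add: zero_le_mult_iff)
    qed
    have const: "W s = W (t - 1)" if s: "s \<le> t - 1" for s
    proof (rule antisym)
      have c: "continuous_on {s..t - 1} W"
        by (rule continuous_on_of_deriv, rule d0)
      show "W s \<le> W (t - 1)" by (rule nondecreasing_of_deriv[OF s c d0]) (use v0 in auto)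
      show "W (t - 1) \<le> W s" by (rule nonincreasing_of_deriv[OF s c d0]) (use v0 in auto)
    qed
    have "W (t - 1) \<le> 0"
    proof (rule tendsto_lowerbound[OF bot(1)])
      show "\<forall>\<^sub>F s in at_bot. W (t - 1) \<le> W s"
        by (rule eventually_mono[OF eventually_le_at_bot[of "t - 1"]]) (rule eq_refl[OF const[symmetric]])
    qed simp
    with pos(1)[of "t - 1"] show False by simp
  qed
  have b1: "bounded_from T v1" "bounded_from T A1" "bounded_from T Z1"
    unfolding v1_def A1_def Z1_def by (intro bounded_from_intros bW bA bZ bB)+
  have b2: "bounded_from T v2" "bounded_from T A2"
    unfolding v2_def A2_def by (intro bounded_from_intros b1)+
  have b3: "bounded_from T v3" unfolding v3_def by (intro bounded_from_intros b2)
  have bP: "bounded_from T (\<lambda>t. W t powr (p + 1))"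
    unfolding bounded_from_def
    by (rule exI[of _ "K powr (p + 1)"]) (use upper pos(1) p in \<open>auto intro!: powr_mono2 simp: less_imp_le\<close>)
  have bE: "bounded_from T E"
    unfolding E_def power2_eq_square divide_inverse by (intro bounded_from_intros b1 b2 b3 bW bP)
  obtain CE where CE: "\<And>t. t \<ge> T \<Longrightarrow> \<bar>E t\<bar> \<le> CE" using bE unfolding bounded_from_def by blast
  obtain C1 where C1: "\<And>t. t \<ge> T \<Longrightarrow> \<bar>v1 t\<bar> \<le> C1" using b1(1) unfolding bounded_from_def by blast
  obtain C2 where C2: "\<And>t. t \<ge> T \<Longrightarrow> \<bar>v2 t\<bar> \<le> C2" using b2(1) unfolding bounded_from_def by blast
  obtain C3 where C3: "\<And>t. t \<ge> T \<Longrightarrow> \<bar>v3 t\<bar> \<le> C3" using b3 unfolding bounded_from_def by blast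
  have CE': "E t \<le> CE" if "t \<ge> T" for t using CE[OF that] by simp
  have lim1: "(v1 \<longlongrightarrow> 0) at_top"
    by (rule barbalat[OF dE d1 C2 CE' _ Eg(2)]) (use K1 in auto)
  have lim2: "(v2 \<longlongrightarrow> 0) at_top"
    by (rule barbalat[OF dE d2 C3 CE' _ Eg(1)]) (use K3 in auto)
  \<comment> \<open>The part of the energy that contains derivatives tends to \<open>0\<close>, so its potential part stays positive.\<close>
  have lim_rest: "((\<lambda>t. v1 t * v3 t - (v2 t)\<^sup>2 / 2 + K3 * (v1 t * v2 t) + K2 * (v1 t)\<^sup>2 / 2) \<longlongrightarrow> 0) at_top"
  proof -
    have "((\<lambda>t. v1 t * v3 t) \<longlongrightarrow> 0) at_top"
    proof (rule Lim_null_comparison)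
      show "\<forall>\<^sub>F t in at_top. norm (v1 t * v3 t) \<le> \<bar>v1 t\<bar> * C3"
        using eventually_ge_at_top[of T]
        by eventually_elim (use C3 in \<open>auto simp: abs_mult intro!: mult_left_mono\<close>)
      show "((\<lambda>t. \<bar>v1 t\<bar> * C3) \<longlongrightarrow> 0) at_top"
        by (rule tendsto_eq_intros lim1 refl | simp)+
    qed
    then have "((\<lambda>t. v1 t * v3 t - (v2 t)\<^sup>2 / 2 + K3 * (v1 t * v2 t) + K2 * (v1 t)\<^sup>2 / 2)
        \<longlongrightarrow> 0 - 0\<^sup>2 / 2 + K3 * (0 * 0) + K2 * 0\<^sup>2 / 2) at_top"
      by (intro tendsto_add tendsto_diff tendsto_mult tendsto_divide tendsto_power tendsto_const lim1 lim2) auto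
    then show ?thesis by simp
  qed
  define \<eta> where "\<eta> = E T"
  have \<eta>: "\<eta> > 0" using E_pos by (simp add: \<eta>_def)
  have "\<forall>\<^sub>F t in at_top. v1 t * v3 t - (v2 t)\<^sup>2 / 2 + K3 * (v1 t * v2 t) + K2 * (v1 t)\<^sup>2 / 2 < \<eta> / 2"
    using order_tendstoD(2)[OF lim_rest, of "\<eta> / 2"] \<eta> by simp
  then obtain T2 where T2: "\<And>t. t \<ge> T2 \<Longrightarrow> v1 t * v3 t - (v2 t)\<^sup>2 / 2 + K3 * (v1 t * v2 t) + K2 * (v1 t)\<^sup>2 / 2 < \<eta> / 2"
    by (auto simp: eventually_at_top_linorder)
  define T3 where "T3 = max T T2"
  have T3: "T3 \<ge> T" "T3 \<ge> T2" by (auto simp: T3_def)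
  define w where "w = sqrt (\<eta> / k0)"
  have w: "w > 0" using \<eta> k0 by (simp add: w_def)
  have low: "w \<le> W t" if t: "t \<ge> T3" for t
  proof -
    have "\<eta> \<le> E t" unfolding \<eta>_def by (rule E_mono) (use t T3 in simp)
    moreover have "W t powr (p + 1) / (p + 1) \<ge> 0" using p by simp
    ultimately have "\<eta> / 2 < k0 * (W t)\<^sup>2 / 2" using T2[of t] t T3 unfolding E_def by linarith
    then have "\<eta> / k0 < (W t)\<^sup>2" using k0 by (simp add: field_simps)
    then have "w < sqrt ((W t)\<^sup>2)" unfolding w_def by (rule real_sqrt_less_mono)
    then show ?thesis using pos(1)[of t] by simp
  qed
  define J where "J = (\<lambda>t. - (v3 t + K3 * v2 t + K2 * v1 t + K1 * W t))"
  have dJ: "DERIV J t :> k0 * W t - W t powr p" for t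
    unfolding J_def
    by (rule derivative_eq_intros d0 d1 d2 d3 refl)+ (use ode[of t] X[of t] in \<open>simp add: algebra_simps\<close>)
  have bJ: "bounded_from T (\<lambda>t. v3 t + K3 * v2 t + K2 * v1 t + K1 * W t)"
    by (intro bounded_from_intros b1 b2 b3 bW)
  then obtain CJ where CJ: "\<And>t. t \<ge> T \<Longrightarrow> \<bar>v3 t + K3 * v2 t + K2 * v1 t + K1 * W t\<bar> \<le> CJ"
    unfolding bounded_from_def by blast
  have "((\<lambda>t. K - W t) \<longlongrightarrow> 0) at_top"
  proof (rule barbalat[of T3 J _ "\<lambda>t. K - W t" "\<lambda>t. - v1 t" C1 CJ])
    show "DERIV (\<lambda>t. K - W t) t :> - v1 t" for t
      by (rule derivative_eq_intros d0 refl)+ simp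
    show "J t \<le> CJ" if "T3 \<le> t" for t using CJ[of t] that T3 by (simp add: J_def abs_le_iff)
    show "\<bar>- v1 t\<bar> \<le> C1" if "T3 \<le> t" for t using C1[of t] that T3 by simp
    show "w * (p - 1) * min (w powr (p - 2)) (K powr (p - 2)) / K * (K - W t)\<^sup>2 \<le> k0 * W t - W t powr p"
      if "T3 \<le> t" for t
      unfolding k0_def by (rule powr_gap[OF p w]) (use low[OF that] upper[of t] that T3 in auto)
    show "0 < w * (p - 1) * min (w powr (p - 2)) (K powr (p - 2)) / K"
      using w p K by simp
  qed (rule dJ)
  then show ?thesis using tendsto_diff[OF tendsto_const[of K], of "\<lambda>t. K - W t" 0] by simp
qed

section \<open>The critical exponent and the Hardy-Rellich constant\<close>

text \<open>
  In the variable \<open>m = 4 / (p - 1)\<close> both \<open>K\<^sub>0\<close> and \<open>p K\<^sub>0\<close> are polynomials, since \<open>m p = m + 4\<close>.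
\<close>

lemma K0_emden:
  assumes "p > 1" "m = 4 / (p - 1)"
  shows "K0 n p = m * (m + 2) * (real n - 2 - m) * (real n - 4 - m)"
    and "p * K0 n p = (m + 4) * (m + 2) * (real n - 2 - m) * (real n - 4 - m)"
    and "m * p = m + 4" "m > 0"
proof -
  have mp: "m * (p - 1) = 4"
    by (rule iffD1[OF nonzero_eq_divide_eq]) (use assms in simp_all)
  then show pm: "m * p = m + 4" by (simp add: algebra_simps)
  show "m > 0" using assms by simp
  show 1: "K0 n p = m * (m + 2) * (real n - 2 - m) * (real n - 4 - m)"
    using assms by (simp add: K0_def)
  show "p * K0 n p = (m + 4) * (m + 2) * (real n - 2 - m) * (real n - 4 - m)"
    unfolding 1 pm[symmetric] by simp
qed

text \<open>
  This is \<open>p K\<^sub>0\<close> minus the Hardy-Rellich constant, as a polynomial in \<open>b = n / 2\<close> and the distance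
  \<open>s = (n - 4) / 2 - m\<close> from the critical decay exponent.  The supercritical range is \<open>0 < s < b - 2\<close>.
\<close>

definition hardy_gap :: "real \<Rightarrow> real \<Rightarrow> real" where
  "hardy_gap b s = (b\<^sup>2 - s\<^sup>2) * (b\<^sup>2 - (2 - s)\<^sup>2) - b\<^sup>2 * (b - 2)\<^sup>2"

lemma hardy_gap_eq:
  assumes "p > 1"
  shows "p * K0 n p - (real n)\<^sup>2 * (real n - 4)\<^sup>2 / 16
     = hardy_gap (real n / 2) ((real n - 4) / 2 - 4 / (p - 1))"
proof -
  have "(m + 4) * (m + 2) * (N - 2 - m) * (N - 4 - m) - N\<^sup>2 * (N - 4)\<^sup>2 / 16
      = hardy_gap (N / 2) ((N - 4) / 2 - m)" for m N :: real
    by (simp add: hardy_gap_def power2_eq_square field_simps)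
  then show ?thesis unfolding K0_emden(2)[OF assms refl] .
qed

text \<open>
  The gap is symmetric about \<open>s = 1\<close>, hence a function of the square of \<open>s - 1\<close>, and in the range that matters it decreases in it.
\<close>

lemma hardy_gap_centered: "hardy_gap b (1 + y) = (b\<^sup>2 - 1 - y\<^sup>2)\<^sup>2 - 4 * y\<^sup>2 - b\<^sup>2 * (b - 2)\<^sup>2"
  by (simp add: hardy_gap_def power2_eq_square algebra_simps)

lemma hardy_gap_antimono:
  assumes "y\<^sup>2 < z\<^sup>2" "z\<^sup>2 \<le> b\<^sup>2 - 1"
  shows "hardy_gap b (1 + z) < hardy_gap b (1 + y)"
proof -
  have "(b\<^sup>2 - 1 - z\<^sup>2)\<^sup>2 \<le> (b\<^sup>2 - 1 - y\<^sup>2)\<^sup>2" using assms by (intro power_mono) auto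
  then show ?thesis using assms(1) by (simp add: hardy_gap_centered)
qed

lemma hardy_gap_small:
  assumes "b > 2" "y\<^sup>2 \<le> 1"
  shows "hardy_gap b (1 + y) > 0"
proof -
  have b4: "b\<^sup>2 > 4" using assms(1) power_strict_mono[of 2 b 2] by simp
  have "hardy_gap b (1 + y) \<ge> hardy_gap b (1 + 1)"
  proof (cases "y\<^sup>2 = 1")
    case True then show ?thesis using hardy_gap_centered[of b 1] by (simp add: hardy_gap_centered)
  next
    case False
    then show ?thesis using hardy_gap_antimono[of y 1 b] assms b4 by simp
  qed
  moreover have "hardy_gap b (1 + 1) = 4 * b\<^sup>2 * (b - 2)"
    by (simp add: hardy_gap_def power2_eq_square algebra_simps)
  moreover have "4 * b\<^sup>2 * (b - 2) > 0" using assms by simp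
  ultimately show ?thesis by linarith
qed

text \<open>
  At the end \<open>p = \<infinity>\<close> of the range the gap changes sign between the dimensions \<open>12\<close> and \<open>13\<close>.
\<close>

lemma hardy_gap_end: "hardy_gap b (b - 2) = (b - 2) * (32 * (b - 1) - b\<^sup>2 * (b - 2))"
  by (simp add: hardy_gap_def power2_eq_square algebra_simps)

lemma supercritical_exponent:
  fixes n :: nat and p :: real
  assumes n: "n \<ge> 5" and p: "(real n + 4) / (real n - 4) < p"
  shows "p > 1" "4 / (p - 1) < (real n - 4) / 2"
proof -
  have n4: "real n - 4 > 0" using n by simp
  have "1 < (real n + 4) / (real n - 4)" using n4 by (simp add: field_simps)
  then show p1: "p > 1" using p by linarith
  have "real n + 4 < p * (real n - 4)" using p n4 by (simp add: field_simps)
  then show "4 / (p - 1) < (real n - 4) / 2" using p1 by (simp add: field_simps)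
qed

lemma exponent_of_decay:
  fixes n :: nat and s :: real
  assumes n: "n \<ge> 5" and s: "0 < s" "s < (real n - 4) / 2"
  defines "q \<equiv> 1 + 4 / ((real n - 4) / 2 - s)"
  shows "(real n + 4) / (real n - 4) < q" "(real n - 4) / 2 - 4 / (q - 1) = s"
proof -
  have n4: "real n - 4 > 0" using n by simp
  have m: "(real n - 4) / 2 - s > 0" using s by simp
  define M where "M = (real n - 4) / 2 - s"
  have "4 / (q - 1) = M" using m by (simp add: q_def flip: M_def)
  then show "(real n - 4) / 2 - 4 / (q - 1) = s" by (simp add: M_def)
  have "4 / a < 4 / (a - s)" if "0 < s" "s < a" for a
    using that by (intro divide_strict_left_mono) auto
  from this[OF s] have "4 / ((real n - 4) / 2) < 4 / ((real n - 4) / 2 - s)" .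
  moreover have "(real n + 4) / (real n - 4) = 1 + 4 / ((real n - 4) / 2)" using n4 by (simp add: field_simps)
  ultimately show "(real n + 4) / (real n - 4) < q" by (simp add: q_def)
qed

text \<open>
  The gap is positive for \<open>s \<le> 2\<close> and strictly decreasing for \<open>s \<ge> 2\<close>.  For \<open>n \<le> 12\<close> it is still positive
  at the end of the range.  For \<open>n \<ge> 13\<close> it has exactly one zero \<open>c\<close>; this also shows that the definite
  description in the critical exponent denotes, and that \<open>p < p\<^sub>c\<close> means \<open>s < c\<close>.
\<close>

lemma above_hardy_constant:
  fixes n :: nat and p :: real
  assumes n: "n \<ge> 5" and p: "(real n + 4) / (real n - 4) < p" and crit: "n \<ge> 13 \<longrightarrow> p < p_crit n"
  shows "p * K0 n p > ((real n - 4) / 2)\<^sup>2 * (real n / 2)\<^sup>2"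
proof -
  define b where "b = real n / 2"
  define s where "s = (real n - 4) / 2 - 4 / (p - 1)"
  note p1 = supercritical_exponent[OF n p]
  have b: "b > 2" using n by (simp add: b_def)
  have s: "0 < s" "s < b - 2" using p1 by (auto simp: s_def b_def field_simps)
  have range: "z\<^sup>2 \<le> b\<^sup>2 - 1" if "0 \<le> z" "z \<le> b - 3" for z
  proof -
    have "z\<^sup>2 \<le> (b - 3)\<^sup>2" using that by (intro power_mono) auto
    also have "\<dots> \<le> b\<^sup>2 - 1" using that b by (simp add: power2_eq_square algebra_simps)
    finally show ?thesis .
  qed
  have "hardy_gap b s > 0"
  proof (cases "(s - 1)\<^sup>2 \<le> 1")
    case True
    then show ?thesis using hardy_gap_small[OF b, of "s - 1"] by simp
  next
    case False
    have s2: "s > 2"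
    proof (rule ccontr)
      assume "\<not> s > 2"
      then have "\<bar>s - 1\<bar> \<le> 1" using s by auto
      then have "(s - 1)\<^sup>2 \<le> 1" by (simp add: abs_square_le_1)
      with False show False by simp
    qed
    have b3: "b > 3" using s s2 by simp
    have anti: "hardy_gap b z' < hardy_gap b z" if "2 \<le> z" "z < z'" "z' \<le> b - 2" for z z'
      using hardy_gap_antimono[of "z - 1" "z' - 1" b] range[of "z' - 1"] power_strict_mono[of "z - 1" "z' - 1" 2] that
      by simp
    show ?thesis
    proof (cases "n \<ge> 13")
      case False
      then have b6: "b \<le> 6" by (simp add: b_def)
      have "b\<^sup>2 * (b - 2) \<le> 6 * b * (b - 2)"
        using b b6 by (intro mult_right_mono) (auto simp: power2_eq_square)
      also have "\<dots> < 32 * (b - 1)"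
      proof -
        have "0 \<le> (b - 3) * (6 - b)" using b3 b6 by (intro mult_nonneg_nonneg) auto
        then show ?thesis using b6 b3 by (simp add: algebra_simps)
      qed
      finally have "hardy_gap b (b - 2) > 0" using b by (simp add: hardy_gap_end)
      moreover have "hardy_gap b (b - 2) < hardy_gap b s" using anti[of s "b - 2"] s s2 by simp
      ultimately show ?thesis by simp
    next
      case True
      then have b65: "b \<ge> 13 / 2" by (simp add: b_def)
      have "hardy_gap b (b - 2) < 0"
      proof -
        have "b\<^sup>2 * (b - 2) \<ge> (13 / 2)\<^sup>2 * (b - 2)" using b65 by (intro mult_right_mono power_mono) auto
        then have "32 * (b - 1) - b\<^sup>2 * (b - 2) < 0" using b65 by (simp add: power2_eq_square)
        then show ?thesis using b by (simp add: hardy_gap_end mult_pos_neg)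
      qed
      moreover have "hardy_gap b 2 > 0" using hardy_gap_small[OF b, of 1] by simp
      moreover have "continuous_on {2..b - 2} (hardy_gap b)"
        unfolding hardy_gap_def by (intro continuous_intros)
      ultimately obtain c where c: "2 \<le> c" "c \<le> b - 2" "hardy_gap b c = 0"
        using IVT2'[of "hardy_gap b" "b - 2" 0 2] b65 by auto
      with \<open>hardy_gap b (b - 2) < 0\<close> \<open>hardy_gap b 2 > 0\<close> have c': "2 < c" "c < b - 2"
        by (auto simp: less_le)
      define q where "q = 1 + 4 / ((real n - 4) / 2 - c)"
      have q: "(real n + 4) / (real n - 4) < q" "(real n - 4) / 2 - 4 / (q - 1) = c"
        using exponent_of_decay[of n c] c' n by (auto simp: q_def b_def field_simps)
      have root_iff: "x * K0 n x = (real n)\<^sup>2 * (real n - 4)\<^sup>2 / 16 \<longleftrightarrow> (real n - 4) / 2 - 4 / (x - 1) = c"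
        if x: "(real n + 4) / (real n - 4) < x" for x
      proof -
        note x1 = supercritical_exponent[OF n x]
        define z where "z = (real n - 4) / 2 - 4 / (x - 1)"
        have z: "0 < z" "z < b - 2" using x1 by (auto simp: z_def b_def field_simps)
        have "x * K0 n x = (real n)\<^sup>2 * (real n - 4)\<^sup>2 / 16 \<longleftrightarrow> hardy_gap b z = 0"
          using hardy_gap_eq[OF x1(1), of n] unfolding b_def z_def by (metis eq_iff_diff_eq_0)
        also have "\<dots> \<longleftrightarrow> z = c"
        proof
          assume z0: "hardy_gap b z = 0"
          have "z > 2"
          proof (rule ccontr)
            assume "\<not> z > 2"
            then have "\<bar>z - 1\<bar> \<le> 1" using z by auto
            then have "(z - 1)\<^sup>2 \<le> 1" by (simp add: abs_square_le_1)
            with hardy_gap_small[OF b, of "z - 1"] z0 show False by simp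
          qed
          then show "z = c" using anti[of z c] anti[of c z] z c c' z0 by (cases z c rule: linorder_cases) auto
        qed (use c in simp)
        finally show ?thesis by (simp add: z_def)
      qed
      have "p_crit n = q"
        unfolding p_crit_def
      proof (rule the_equality)
        fix x assume x: "(real n + 4) / (real n - 4) < x \<and> x * K0 n x = (real n)\<^sup>2 * (real n - 4)\<^sup>2 / 16"
        then have "4 / (x - 1) = 4 / (q - 1)" using root_iff[of x] q by auto
        then show "x = q"
          using supercritical_exponent(1)[OF n, of x] supercritical_exponent(1)[OF n q(1)] x by (simp add: field_simps)
      qed (use q root_iff[of q] in auto)
      with crit True have "p < q" by simp
      then have "4 / (q - 1) < 4 / (p - 1)"
        using p1(1) by (intro divide_strict_left_mono mult_pos_pos) auto
      then have "s < c" using q(2) by (simp add: s_def)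
      then have "hardy_gap b c < hardy_gap b s" using anti[of s c] s2 c by simp
      with c show ?thesis by simp
    qed
  qed
  then have "p * K0 n p - (real n)\<^sup>2 * (real n - 4)\<^sup>2 / 16 > 0"
    using hardy_gap_eq[OF p1(1), of n] by (simp add: b_def s_def)
  moreover have "((real n - 4) / 2)\<^sup>2 * (real n / 2)\<^sup>2 = (real n)\<^sup>2 * (real n - 4)\<^sup>2 / 16"
    by (simp add: power_divide)
  ultimately show ?thesis by simp
qed

text \<open>
  If both strict signs occur at arbitrarily large radii, alternating radii with unit gaps can be chosen one
  after the other.
\<close>

lemma eventually_one_sign:
  fixes f g :: "real \<Rightarrow> real"
  assumes "\<not> oscillates_around_at_top f g"
  obtains R where "R > 0" "(\<forall>r\<ge>R. g r \<le> f r) \<or> (\<forall>r\<ge>R. f r \<le> g r)"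
proof -
  define d where "d = (\<lambda>r. f r - g r)"
  have "\<exists>R>0. (\<forall>r\<ge>R. 0 \<le> d r) \<or> (\<forall>r\<ge>R. d r \<le> 0)"
  proof (rule ccontr)
    assume "\<not> (\<exists>R>0. (\<forall>r\<ge>R. 0 \<le> d r) \<or> (\<forall>r\<ge>R. d r \<le> 0))"
    then have neg: "\<exists>r\<ge>R. d r < 0" and pos: "\<exists>r\<ge>R. d r > 0" if "R > 0" for R
      using that by (meson not_less)+
    define P where "P = (\<lambda>(k::nat) r. r > 0 \<and> (if even k then d r > 0 else d r < 0))"
    have "\<exists>\<rho>. \<forall>k. P k (\<rho> k) \<and> \<rho> k + 1 \<le> \<rho> (Suc k)"
    proof (rule dependent_nat_choice)
      obtain r where "r \<ge> 1" "d r > 0" using pos[OF zero_less_one] by blast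
      then show "\<exists>r. P 0 r" by (intro exI[of _ r]) (auto simp: P_def)
      show "\<exists>y. P (Suc k) y \<and> x + 1 \<le> y" if "P k x" for x k
      proof -
        have "x + 1 > 0" using that by (simp add: P_def)
        from neg[OF this] pos[OF this] obtain a b where "x + 1 \<le> a" "d a < 0" "x + 1 \<le> b" "d b > 0" by blast
        with \<open>x + 1 > 0\<close> show ?thesis
          by (intro exI[of _ "if even k then a else b"]) (auto simp: P_def)
      qed
    qed
    then obtain \<rho> where \<rho>: "\<And>k. P k (\<rho> k)" "\<And>k. \<rho> k + 1 \<le> \<rho> (Suc k)" by blast
    have "strict_mono \<rho>" using \<rho>(2) by (intro strict_monoI_Suc) (metis add.commute less_add_one order_less_le_trans)
    moreover have "filterlim \<rho> at_top sequentially"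
    proof (rule filterlim_at_top_mono[OF filterlim_real_sequentially])
      have "real k \<le> \<rho> k" for k
      proof (induction k)
        case 0 then show ?case using \<rho>(1)[of 0] by (simp add: P_def)
      next
        case (Suc k) then show ?case using \<rho>(2)[of k] by simp
      qed
      then show "\<forall>\<^sub>F k in sequentially. real k \<le> \<rho> k" by simp
    qed
    moreover have "d (\<rho> k) * d (\<rho> (Suc k)) < 0" for k
      using \<rho>(1)[of k] \<rho>(1)[of "Suc k"] by (cases "even k") (auto simp: P_def mult_pos_neg mult_neg_pos)
    moreover have "0 < \<rho> k" for k using \<rho>(1)[of k] by (simp add: P_def)
    ultimately have "oscillates_around_at_top f g"
      unfolding oscillates_around_at_top_def d_def by blast
    with assms show False by simp
  qed
  then show ?thesis using that by (auto simp: d_def)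
qed

section \<open>Comparison with the singular solution\<close>

lemma radial_bilaplacian_diff:
  assumes "radial_bilaplacian n w w' k k' e" "radial_bilaplacian n x x' l l' g"
  shows "radial_bilaplacian n (\<lambda>r. w r - x r) (\<lambda>r. w' r - x' r) (\<lambda>r. k r - l r) (\<lambda>r. k' r - l' r) (\<lambda>r. e r - g r)"
proof -
  interpret w: radial_bilaplacian n w w' k k' e by fact
  interpret x: radial_bilaplacian n x x' l l' g by fact
  show ?thesis
  proof
    fix r :: real assume r: "r > 0"
    show "DERIV (\<lambda>r. w r - x r) r :> w' r - x' r"
      by (rule DERIV_diff[OF w.dw[OF r] x.dw[OF r]])
    show "DERIV (\<lambda>r. k r - l r) r :> k' r - l' r"
      by (rule DERIV_diff[OF w.dk[OF r] x.dk[OF r]])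
    show "DERIV (\<lambda>r. r ^ (n - 1) * (w' r - x' r)) r :> - (r ^ (n - 1) * (k r - l r))"
      using DERIV_diff[OF w.dq[OF r] x.dq[OF r]] by (simp add: algebra_simps)
    show "DERIV (\<lambda>r. r ^ (n - 1) * (k' r - l' r)) r :> - (r ^ (n - 1) * (e r - g r))"
      using DERIV_diff[OF w.dl[OF r] x.dl[OF r]] by (simp add: algebra_simps)
  qed (rule w.dim_ge)
qed

text \<open>
  The exact computation \<open>- \<Delta> r\<^sup>-\<^sup>\<gamma> = \<gamma> (n - 2 - \<gamma>) r\<^sup>-\<^sup>\<gamma>\<^sup>-\<^sup>2\<close>, in flux form.
\<close>

lemma power_flux:
  fixes r :: real
  assumes n: "n \<ge> 2" and r: "r > 0"
  shows "DERIV (\<lambda>r. r ^ (n - 1) * (- \<gamma> * c * r powr (- \<gamma> - 1))) r :>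
     - (r ^ (n - 1) * (\<gamma> * (real n - 2 - \<gamma>) * c * r powr (- \<gamma> - 2)))"
proof -
  obtain l where l: "n = Suc (Suc l)" using n by (intro that[of "n - 2"]) auto
  have d: "DERIV (\<lambda>r. r powr (- \<gamma> - 1)) r :> (- \<gamma> - 1) * r powr (- \<gamma> - 2)"
    by (rule DERIV_cong[OF has_real_derivative_powr[OF r]]) (simp add: algebra_simps)
  have p: "r powr (- \<gamma> - 1) = r * r powr (- \<gamma> - 2)"
  proof -
    have "1 + (- \<gamma> - 2) = - \<gamma> - 1" by simp
    then show ?thesis using powr_mult_base[of r "- \<gamma> - 2"] r by (metis less_imp_le)
  qed
  have dp: "DERIV (\<lambda>r. r ^ (n - 1)) r :> real (n - 1) * r ^ l"
    using DERIV_pow[of "n - 1" r] by (simp add: l)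
  have "DERIV (\<lambda>r. r ^ (n - 1) * (- \<gamma> * c * r powr (- \<gamma> - 1))) r :>
     real (n - 1) * r ^ l * (- \<gamma> * c * r powr (- \<gamma> - 1)) + (- \<gamma> * c * ((- \<gamma> - 1) * r powr (- \<gamma> - 2))) * r ^ (n - 1)"
    by (rule DERIV_mult[OF dp DERIV_cmult[OF d]])
  then show ?thesis unfolding p by (rule DERIV_cong) (simp add: l algebra_simps)
qed

lemma power_deriv:
  fixes r :: real
  assumes r: "r > 0"
  shows "DERIV (\<lambda>r. c * r powr (- \<gamma>)) r :> - \<gamma> * c * r powr (- \<gamma> - 1)"
  using DERIV_cmult[OF has_real_derivative_powr[OF r, of "- \<gamma>"], of c] by (simp add: mult_ac)

lemma powr_tangent:
  fixes x y p :: real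
  assumes p: "p > 1" and xy: "0 < y" "y \<le> x"
  shows "p * y powr (p - 1) * (x - y) \<le> x powr p - y powr p"
    and "x powr p - y powr p \<le> p * x powr (p - 1) * (x - y)"
proof -
  show "p * y powr (p - 1) * (x - y) \<le> x powr p - y powr p" "x powr p - y powr p \<le> p * x powr (p - 1) * (x - y)"
  proof (atomize (full), cases "y = x")
    case False
    then have yx: "y < x" using xy by simp
    have "\<exists>\<xi>. y < \<xi> \<and> \<xi> < x \<and> x powr p - y powr p = (x - y) * (p * \<xi> powr (p - 1))"
      by (rule MVT2[OF yx has_real_derivative_powr]) (use xy in auto)
    then obtain \<xi> where \<xi>: "y < \<xi>" "\<xi> < x" "x powr p - y powr p = (x - y) * (p * \<xi> powr (p - 1))" by blast
    have "y powr (p - 1) \<le> \<xi> powr (p - 1)" "\<xi> powr (p - 1) \<le> x powr (p - 1)"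
      using xy \<xi> p by (auto intro!: powr_mono2)
    then have "(x - y) * (p * y powr (p - 1)) \<le> (x - y) * (p * \<xi> powr (p - 1))"
      "(x - y) * (p * \<xi> powr (p - 1)) \<le> (x - y) * (p * x powr (p - 1))"
      using yx p by (auto intro!: mult_left_mono)
    then show "p * y powr (p - 1) * (x - y) \<le> x powr p - y powr p \<and> x powr p - y powr p \<le> p * x powr (p - 1) * (x - y)"
      using \<xi>(3) by (simp add: mult_ac)
  qed simp
qed

lemma powr_lipschitz:
  fixes x y p M :: real
  assumes p: "p > 1" and xy: "0 < x" "x \<le> M" "0 < y" "y \<le> M"
  shows "\<bar>x powr p - y powr p\<bar> \<le> p * M powr (p - 1) * \<bar>x - y\<bar>"
proof -
  have *: "\<bar>x powr p - y powr p\<bar> \<le> p * M powr (p - 1) * \<bar>x - y\<bar>"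
    if "0 < y" "y \<le> x" "x \<le> M" for x y
  proof -
    have "y powr p \<le> x powr p" using that p by (intro powr_mono2) auto
    moreover have "p * x powr (p - 1) * (x - y) \<le> p * M powr (p - 1) * (x - y)"
      using that p by (intro mult_right_mono mult_left_mono powr_mono2) auto
    ultimately show ?thesis using powr_tangent(2)[OF p that(1,2)] that by simp
  qed
  show ?thesis using *[of x y] *[of y x] xy by (cases "x \<le> y") (auto simp: abs_minus_commute)
qed

lemma exp_weight_at_bot:
  fixes f :: "real \<Rightarrow> real"
  assumes f: "continuous_on {0..} f" and c: "c > 0"
  shows "((\<lambda>t. exp (c * t) * f (exp t)) \<longlongrightarrow> 0) at_bot"
proof -
  have "(f \<longlongrightarrow> f 0) (at 0 within {0..})" using f by (auto simp: continuous_on_def)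
  moreover have "filterlim (\<lambda>t::real. exp t) (at 0 within {0..}) at_bot"
    by (rule filterlim_at_withinI) (use exp_at_bot in auto)
  ultimately have "((\<lambda>t. f (exp t)) \<longlongrightarrow> f 0) at_bot" by (rule filterlim_compose)
  moreover have "((\<lambda>t. exp (c * t)) \<longlongrightarrow> 0) at_bot"
    by (rule filterlim_compose[OF exp_at_bot], rule filterlim_tendsto_pos_mult_at_bot[OF tendsto_const c filterlim_ident])
  ultimately have "((\<lambda>t. exp (c * t) * f (exp t)) \<longlongrightarrow> 0 * f 0) at_bot" by (intro tendsto_mult)
  then show ?thesis by simp
qed

text \<open>
  Collects the signs at one radius from which the backward argument starts.  Since \<open>w\<close> is nonincreasing
  there, it either is positive at that radius or vanishes from it on.
\<close>

lemma (in radial_bilaplacian) eventual_signs: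
  assumes mu: "\<mu> > ((real n - 4) / 2)\<^sup>2 * (real n / 2)\<^sup>2"
    and lim: "(w \<longlongrightarrow> 0) at_top" "(k \<longlongrightarrow> 0) at_top"
    and super: "\<forall>\<^sub>F r in at_top. 0 \<le> w r \<and> \<mu> * w r \<le> r ^ 4 * e r"
  obtains R where "R \<ge> 1" "w' R \<le> 0" "k R \<le> 0" "0 \<le> k' R" "w R > 0 \<or> (\<forall>r\<ge>R. w r = 0)"
proof -
  have "\<forall>\<^sub>F r in at_top. w r < 1" using order_tendstoD(2)[OF lim(1), of 1] by simp
  with super have "\<forall>\<^sub>F r in at_top. 0 \<le> w r \<and> \<mu> * w r \<le> r ^ 4 * e r \<and> w r < 1"
    by eventually_elim auto
  then obtain R0 where R0: "\<And>r. r \<ge> R0 \<Longrightarrow> 0 \<le> w r \<and> \<mu> * w r \<le> r ^ 4 * e r \<and> w r < 1"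
    by (auto simp: eventually_at_top_linorder)
  define R where "R = max R0 1"
  have R: "R \<ge> 1" by (simp add: R_def)
  have RR: "0 \<le> w r" "\<mu> * w r \<le> r ^ 4 * e r" "w r \<le> 1" if "r \<ge> R" for r
    using R0[of r] that by (auto simp: R_def less_imp_le)
  have "0 \<le> ((real n - 4) / 2)\<^sup>2 * (real n / 2)\<^sup>2" by simp
  then have mu0: "\<mu> > 0" using mu by linarith
  have e: "0 \<le> e r" if "r \<ge> R" for r
  proof -
    have "0 \<le> r ^ 4 * e r" using RR[OF that] mu0 by (meson mult_nonneg_nonneg less_imp_le order_trans)
    then show ?thesis using that R by (simp add: zero_le_mult_iff)
  qed
  obtain \<alpha> C where \<alpha>: "\<alpha> > real n - 2" and C: "\<And>r. r \<ge> R \<Longrightarrow> w r \<le> C * r powr (- \<alpha>)"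
    using fast_decay[OF mu R] RR by blast
  have signs: "w' r \<le> 0" "k r \<le> 0" "0 \<le> k' r" if "r \<ge> R" for r
    using decay_signs[OF _ lim e RR(1) \<alpha> C that] R by auto
  have "w r = 0" if r: "r \<ge> R" and w0: "\<not> w R > 0" for r
  proof -
    have "w r \<le> w R"
      by (rule nonincreasing_of_deriv[OF r cont_on(1) dw]) (use R signs in auto)
    then show ?thesis using RR(1)[OF r] w0 by simp
  qed
  then have "w R > 0 \<or> (\<forall>r\<ge>R. w r = 0)" by blast
  then show thesis using R signs[OF order_refl] by (intro that[of R])
qed

context radial_profile begin

text \<open>
  The decay exponent and amplitude of the singular solution, the solution itself, minus its Laplacian, and the
  radial derivatives of the two.
\<close>

definition m where "m = 4 / (p - 1)"
definition K where "K = K0 n p powr (1 / (p - 1))"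
definition us where "us r = K * r powr (- m)"
definition hs where "hs r = m * (real n - 2 - m) * K * r powr (- (m + 2))"
definition us' where "us' r = - m * K * r powr (- m - 1)"
definition hs' where "hs' r = - (m + 2) * (m * (real n - 2 - m) * K) * r powr (- (m + 2) - 1)"

lemma us_eq: "us r = u_s n p r"
  by (simp add: us_def u_s_def K_def m_def)

lemma m_bounds: "m > 0" "2 * m < real n - 4" "m * p = m + 4"
  using K0_emden(3,4)[OF p_gt_1 m_def] supercritical_exponent(2)[OF U.n_ge supercritical]
  by (auto simp: m_def)

lemma K0_pos: "K0 n p > 0"
  unfolding K0_emden(1)[OF p_gt_1 m_def] using m_bounds by (intro mult_pos_pos) auto

lemma K_props: "K > 0" "K powr (p - 1) = K0 n p" "K powr p = K * K0 n p"
proof -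
  show K: "K > 0" using K0_pos by (simp add: K_def)
  show 1: "K powr (p - 1) = K0 n p" using K0_pos p_gt_1 by (simp add: K_def powr_powr)
  show "K powr p = K * K0 n p" using powr_mult_base[of K "p - 1"] K 1 by simp
qed

lemma us_pos: "r > 0 \<Longrightarrow> us r > 0"
  using K_props by (simp add: us_def)

lemma us_powr: "r > 0 \<Longrightarrow> us r powr p = K0 n p * K * r powr (- (m + 4))"
  using K_props m_bounds by (simp add: us_def powr_mult powr_powr mult_ac)

lemma us_powr_pred: "r > 0 \<Longrightarrow> r ^ 4 * us r powr (p - 1) = K0 n p"
proof -
  assume r: "r > 0"
  have "m * (p - 1) = 4" using m_bounds by (simp add: algebra_simps)
  then have "us r powr (p - 1) = K0 n p * r powr (- 4)"
    using r K_props by (simp add: us_def powr_mult powr_powr)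
  moreover have "r ^ 4 * r powr (- 4) = 1"
    using r by (simp add: powr_minus powr_numeral)
  ultimately show ?thesis by simp
qed

lemma us_bilaplacian: "radial_bilaplacian n us us' hs hs' (\<lambda>r. us r powr p)"
proof
  show "n \<ge> 5" by (rule U.n_ge)
  fix r :: real assume r: "r > 0"
  have n2: "n \<ge> 2" using U.n_ge by simp
  show "DERIV us r :> us' r"
    using power_deriv[OF r, of K m] by (simp add: us_def[abs_def] us'_def)
  show "DERIV hs r :> hs' r"
    using power_deriv[OF r, of "m * (real n - 2 - m) * K" "m + 2"] unfolding hs_def[abs_def] hs'_def .
  show "DERIV (\<lambda>r. r ^ (n - 1) * us' r) r :> - (r ^ (n - 1) * hs r)"
    using power_flux[OF n2 r, of m K] by (simp add: us'_def[abs_def] hs_def)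
  have e: "us r powr p = (m + 2) * (real n - 2 - (m + 2)) * (m * (real n - 2 - m) * K) * r powr (- (m + 2) - 2)"
    unfolding us_powr[OF r] K0_emden(1)[OF p_gt_1 m_def] by (simp add: algebra_simps)
  show "DERIV (\<lambda>r. r ^ (n - 1) * hs' r) r :> - (r ^ (n - 1) * us r powr p)"
    unfolding e hs'_def using power_flux[OF n2 r, of "m + 2" "m * (real n - 2 - m) * K"] .
qed

lemma us_tendsto: "(us \<longlongrightarrow> 0) at_top" "(hs \<longlongrightarrow> 0) at_top"
proof -
  have t: "((\<lambda>r::real. c * r powr (- a)) \<longlongrightarrow> 0) at_top" if "a > 0" for a c
    by (rule tendsto_mult_right_zero[OF tendsto_neg_powr]) (use that filterlim_ident in auto)
  show "(us \<longlongrightarrow> 0) at_top" "(hs \<longlongrightarrow> 0) at_top"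
    unfolding us_def[abs_def] hs_def[abs_def] by (rule t; use m_bounds in simp)+
qed

lemma us_large_near_origin:
  assumes R: "R > 0"
  shows "\<exists>r>0. r \<le> R \<and> us r > c"
proof -
  define s where "s = (K / (\<bar>c\<bar> + 1)) powr (1 / m)"
  define r where "r = min R s"
  have s: "s > 0" using K_props by (simp add: s_def)
  have "s powr (- m) = (\<bar>c\<bar> + 1) / K"
    using m_bounds K_props by (simp add: s_def powr_powr powr_minus)
  moreover have "s powr (- m) \<le> r powr (- m)"
    using s R m_bounds by (intro powr_mono2') (auto simp: r_def)
  ultimately have "K * ((\<bar>c\<bar> + 1) / K) \<le> us r" unfolding us_def using K_props by (intro mult_left_mono) auto
  then have "\<bar>c\<bar> + 1 \<le> us r" using K_props by simp
  then show ?thesis using R s by (intro exI[of _ r]) (auto simp: r_def)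
qed

context
  assumes u0: "u 0 > 0"
begin

lemma u_pos: "r \<ge> 0 \<Longrightarrow> u r > 0"
  using positive[OF u0] by blast

lemma u_le: "r \<ge> 0 \<Longrightarrow> u r \<le> u 0"
  by (rule U.antimono) (auto intro!: less_imp_le deriv_neg_both[OF u0])

lemma u_bilaplacian: "radial_bilaplacian n u u' h h' (\<lambda>r. u r powr p)"
proof
  fix r :: real assume r: "r > 0"
  show "DERIV (\<lambda>r. r ^ (n - 1) * h' r) r :> - (r ^ (n - 1) * u r powr p)"
    using H.flux[OF r] pow_pos[OF u_pos[of r]] r by simp
qed (use U.n_ge U.deriv H.deriv U.flux in auto)

text \<open>
  By backward uniqueness \<open>u\<close> would equal the singular solution down to radii where the latter exceeds
  \<open>u 0\<close>.
\<close>

lemma not_eventually_equal: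
  assumes R: "R > 0" and eq: "\<And>r. r \<ge> R \<Longrightarrow> u r = us r"
  shows False
proof -
  interpret D: radial_bilaplacian n "\<lambda>r. u r - us r" "\<lambda>r. u' r - us' r" "\<lambda>r. h r - hs r" "\<lambda>r. h' r - hs' r"
    "\<lambda>r. u r powr p - us r powr p"
    by (rule radial_bilaplacian_diff[OF u_bilaplacian us_bilaplacian])
  obtain \<epsilon> where \<epsilon>: "\<epsilon> > 0" "\<epsilon> \<le> R" "us \<epsilon> > u 0" using us_large_near_origin[OF R] by blast
  define M where "M = us \<epsilon>"
  have us_le: "us r \<le> M" if "r \<ge> \<epsilon>" for r
    unfolding M_def us_def using that \<epsilon> m_bounds K_props by (intro mult_left_mono powr_mono2') auto
  note van = D.vanishing_on_tail[OF R, of "R + 1"]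
  have "u \<epsilon> - us \<epsilon> = 0"
  proof (rule D.backward_uniqueness[of \<epsilon> "R + 1" "p * M powr (p - 1)"])
    show "\<bar>u r powr p - us r powr p\<bar> \<le> p * M powr (p - 1) * \<bar>u r - us r\<bar>" if "\<epsilon> \<le> r" for r
      by (rule powr_lipschitz[OF p_gt_1]) (use that \<epsilon> us_le[OF that] u_le[of r] u_pos[of r] us_pos[of r] M_def in auto)
  qed (use \<epsilon> p_gt_1 eq van in auto)
  then show False using \<epsilon> u_le[of \<epsilon>] by simp
qed

text \<open>
  Convexity of the power gives the supersolution inequality with the full constant \<open>p K\<^sub>0\<close>.  If the
  difference is positive at \<open>R\<close>, it stays above that value down to the origin, where \<open>u\<close> is bounded.
\<close>

lemma not_eventually_above:
  assumes crit: "p * K0 n p > ((real n - 4) / 2)\<^sup>2 * (real n / 2)\<^sup>2"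
    and above: "\<And>r. r \<ge> R0 \<Longrightarrow> us r \<le> u r"
  shows False
proof -
  interpret D: radial_bilaplacian n "\<lambda>r. u r - us r" "\<lambda>r. u' r - us' r" "\<lambda>r. h r - hs r" "\<lambda>r. h' r - hs' r"
    "\<lambda>r. u r powr p - us r powr p"
    by (rule radial_bilaplacian_diff[OF u_bilaplacian us_bilaplacian])
  have lim: "((\<lambda>r. u r - us r) \<longlongrightarrow> 0) at_top" "((\<lambda>r. h r - hs r) \<longlongrightarrow> 0) at_top"
    using tendsto_diff[OF tendsto_zero(1)[OF u0] us_tendsto(1)] tendsto_diff[OF tendsto_zero(2)[OF u0] us_tendsto(2)]
    by simp_all
  have "\<forall>\<^sub>F r in at_top. 0 \<le> u r - us r \<and> p * K0 n p * (u r - us r) \<le> r ^ 4 * (u r powr p - us r powr p)"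
    using eventually_ge_at_top[of R0] eventually_gt_at_top[of 0]
  proof eventually_elim
    case (elim r)
    have "p * K0 n p * (u r - us r) = r ^ 4 * (p * us r powr (p - 1) * (u r - us r))"
      unfolding us_powr_pred[OF elim(2), symmetric] by (simp add: mult_ac)
    also have "\<dots> \<le> r ^ 4 * (u r powr p - us r powr p)"
      by (intro mult_left_mono powr_tangent(1)[OF p_gt_1]) (use above[OF elim(1)] us_pos[OF elim(2)] in auto)
    finally show ?case using above[OF elim(1)] by simp
  qed
  from D.eventual_signs[OF crit lim this] obtain R where R: "R \<ge> 1"
    and signs: "u' R - us' R \<le> 0" "h R - hs R \<le> 0" "0 \<le> h' R - hs' R"
    and alt: "u R - us R > 0 \<or> (\<forall>r\<ge>R. u r - us r = 0)" .
  show False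
  proof (cases "u R - us R > 0")
    case True
    obtain r where r: "r > 0" "r \<le> R" "us r > u 0" using us_large_near_origin[of R] R by auto
    have "u R - us R \<le> u r - us r"
    proof (rule D.backward_positive(1)[OF _ True])
      show "0 \<le> u x powr p - us x powr p" if "0 < x" "0 \<le> u x - us x" for x
        using that us_pos[OF that(1)] p_gt_1 powr_mono2[of p "us x" "u x"] by simp
    qed (use R signs r in auto)
    with True r u_le[of r] show False by simp
  next
    case False
    then have "u r = us r" if "r \<ge> R" for r using alt that by auto
    then show False using not_eventually_equal[of R] R by simp
  qed
qed

text \<open>
  The whole chain of functions vanishes as \<open>t \<rightarrow> - \<infinity>\<close> because \<open>u\<close> and \<open>h\<close> are regular at the origin; this
  is where the energy gets its initial value \<open>0\<close>.
\<close>

lemma asymptotic_of_below: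
  assumes R: "R > 0" and below: "\<And>r. r \<ge> R \<Longrightarrow> u r \<le> us r"
  shows "((\<lambda>r. r powr m * u r) \<longlongrightarrow> K) at_top"
proof -
  interpret u: radial_bilaplacian n u u' h h' "\<lambda>r. u r powr p" by (rule u_bilaplacian)
  have e: "exp ((m + c - real n) * t) * (exp t ^ (n - 1) * y) = exp ((m + c - 1) * t) * y" for c y t :: real
    unfolding u.exp_dim by (simp add: mult_exp_exp algebra_simps mult.assoc[symmetric])
  interpret ef: emden_fowler "real n" m "\<lambda>t. exp (m * t) * u (exp t)"
    "\<lambda>t. - (exp ((m + 2 - real n) * t) * (exp t ^ (n - 1) * u' (exp t)))"
    "\<lambda>t. exp ((m + 2) * t) * h (exp t)"
    "\<lambda>t. - (exp ((m + 4 - real n) * t) * (exp t ^ (n - 1) * h' (exp t)))"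
    "\<lambda>t. exp ((m + 4) * t) * u (exp t) powr p"
    by (rule u.emden_fowler)
  have "((\<lambda>t. exp (m * t) * u (exp t)) \<longlongrightarrow> K) at_top"
  proof (rule ef.convergence_to_equilibrium[where p=p and T="ln R"])
    show "K powr (p - 1) = m * (m + 2) * (real n - 2 - m) * (real n - 4 - m)"
      using K_props K0_emden(1)[OF p_gt_1 m_def] by simp
    show "exp ((m + 4) * t) * u (exp t) powr p = (exp (m * t) * u (exp t)) powr p" for t
    proof -
      have "p * (m * t) = (m + 4) * t" using m_bounds(3) by (metis mult.assoc mult.commute)
      then have "exp (m * t) powr p = exp ((m + 4) * t)" by (simp add: powr_def)
      then show ?thesis using u_pos[of "exp t"] by (simp add: powr_mult)
    qed
    show "exp (m * t) * u (exp t) \<le> K" if "ln R \<le> t" for t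
    proof -
      have "exp (ln R) \<le> exp t" using that by simp
      then have "u (exp t) \<le> us (exp t)" using R by (intro below) simp
      then have "exp (m * t) * u (exp t) \<le> exp (m * t) * us (exp t)" by (intro mult_left_mono) auto
      also have "\<dots> = K" by (simp add: us_def powr_def mult_exp_exp)
      finally show ?thesis .
    qed
    show "0 < exp (m * t) * u (exp t)" "0 \<le> exp ((m + 2) * t) * h (exp t)" for t
      using positive[OF u0, of "exp t"] by auto
    show "0 \<le> - (exp ((m + 2 - real n) * t) * (exp t ^ (n - 1) * u' (exp t)))"
      "0 \<le> - (exp ((m + 4 - real n) * t) * (exp t ^ (n - 1) * h' (exp t)))" for t
      using deriv_neg_both[OF u0, of "exp t"] by (auto simp: mult_le_0_iff less_imp_le)
    show "((\<lambda>t. exp (m * t) * u (exp t)) \<longlongrightarrow> 0) at_bot" "((\<lambda>t. exp ((m + 2) * t) * h (exp t)) \<longlongrightarrow> 0) at_bot"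
      using m_bounds by (auto intro!: exp_weight_at_bot U.cont H.cont)
    have "((\<lambda>t. exp ((m + 2 - 1) * t) * u' (exp t)) \<longlongrightarrow> 0) at_bot" "((\<lambda>t. exp ((m + 4 - 1) * t) * h' (exp t)) \<longlongrightarrow> 0) at_bot"
      using m_bounds by (auto intro!: exp_weight_at_bot U.cont' H.cont')
    then show "((\<lambda>t. - (exp ((m + 2 - real n) * t) * (exp t ^ (n - 1) * u' (exp t)))) \<longlongrightarrow> 0) at_bot"
      "((\<lambda>t. - (exp ((m + 4 - real n) * t) * (exp t ^ (n - 1) * h' (exp t)))) \<longlongrightarrow> 0) at_bot"
      unfolding e by (auto dest: tendsto_minus)
    have "((\<lambda>t. h (exp t)) \<longlongrightarrow> 0) at_top"
      by (rule filterlim_compose[OF tendsto_zero(2)[OF u0] exp_at_top])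
    moreover have "exp (- (m + 2) * t) * (exp ((m + 2) * t) * h (exp t)) = h (exp t)" for t
    proof -
      have "- (m + 2) * t + (m + 2) * t = 0" by (simp add: algebra_simps)
      then show ?thesis by (simp only: mult.assoc[symmetric] mult_exp_exp exp_zero mult_1_left)
    qed
    ultimately show "((\<lambda>t. exp (- (m + 2) * t) * (exp ((m + 2) * t) * h (exp t))) \<longlongrightarrow> 0) at_top"
      by presburger
  qed (use m_bounds p_gt_1 K_props in auto)
  from filterlim_compose[OF this ln_at_top]
  have "((\<lambda>r. exp (m * ln r) * u (exp (ln r))) \<longlongrightarrow> K) at_top" .
  then show ?thesis
  proof (rule Lim_transform_eventually)
    show "\<forall>\<^sub>F r in at_top. exp (m * ln r) * u (exp (ln r)) = r powr m * u r"
      using eventually_gt_at_top[of 0] by eventually_elim (simp add: powr_def)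
  qed
qed

text \<open>
  Since \<open>r\<^sup>m u\<close> tends to the amplitude of the singular solution, \<open>p u\<^sup>p\<^sup>-\<^sup>1\<close> is eventually at least
  \<open>\<mu> r\<^sup>-\<^sup>4\<close> for any \<open>\<mu> < p K\<^sub>0\<close>; the midpoint between \<open>p K\<^sub>0\<close> and the Hardy-Rellich constant serves.  The
  backward signs make the flux \<open>l\<close> nonnegative, whereas it decreases strictly from a limit that is at
  most \<open>0\<close> at the origin.
\<close>

lemma not_eventually_below:
  assumes crit: "p * K0 n p > ((real n - 4) / 2)\<^sup>2 * (real n / 2)\<^sup>2"
    and R0: "R0 > 0" and below: "\<And>r. r \<ge> R0 \<Longrightarrow> u r \<le> us r"
  shows False
proof -
  interpret D: radial_bilaplacian n "\<lambda>r. us r - u r" "\<lambda>r. us' r - u' r" "\<lambda>r. hs r - h r" "\<lambda>r. hs' r - h' r"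
    "\<lambda>r. us r powr p - u r powr p"
    by (rule radial_bilaplacian_diff[OF us_bilaplacian u_bilaplacian])
  define \<mu> where "\<mu> = (p * K0 n p + ((real n - 4) / 2)\<^sup>2 * (real n / 2)\<^sup>2) / 2"
  have mu: "\<mu> > ((real n - 4) / 2)\<^sup>2 * (real n / 2)\<^sup>2" "\<mu> < p * K0 n p"
  proof -
    have "x < (y + x) / 2" "(y + x) / 2 < y" if "x < y" for x y :: real using that by simp_all
    from this[OF crit] show "\<mu> > ((real n - 4) / 2)\<^sup>2 * (real n / 2)\<^sup>2" "\<mu> < p * K0 n p"
      unfolding \<mu>_def .
  qed
  have lim: "((\<lambda>r. us r - u r) \<longlongrightarrow> 0) at_top" "((\<lambda>r. hs r - h r) \<longlongrightarrow> 0) at_top"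
    using tendsto_diff[OF us_tendsto(1) tendsto_zero(1)[OF u0]] tendsto_diff[OF us_tendsto(2) tendsto_zero(2)[OF u0]]
    by simp_all
  have "((\<lambda>r. p * (r powr m * u r) powr (p - 1)) \<longlongrightarrow> p * K powr (p - 1)) at_top"
    using K_props by (intro tendsto_intros asymptotic_of_below[OF R0 below]) auto
  then have ev: "\<forall>\<^sub>F r in at_top. \<mu> < p * (r powr m * u r) powr (p - 1)"
    using mu K_props by (intro order_tendstoD(1)) auto
  have "\<forall>\<^sub>F r in at_top. 0 \<le> us r - u r \<and> \<mu> * (us r - u r) \<le> r ^ 4 * (us r powr p - u r powr p)"
    using ev eventually_ge_at_top[of R0] eventually_gt_at_top[of 0]
  proof eventually_elim
    case (elim r)
    have m4: "m * (p - 1) = 4" using m_bounds by (simp add: algebra_simps)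
    have "(r powr m * u r) powr (p - 1) = r ^ 4 * u r powr (p - 1)"
      using elim u_pos[of r] by (simp add: powr_mult powr_powr m4 powr_numeral)
    then have "\<mu> * (us r - u r) \<le> p * (r ^ 4 * u r powr (p - 1)) * (us r - u r)"
      using elim(1) below[OF elim(2)] by (intro mult_right_mono) auto
    also have "\<dots> = r ^ 4 * (p * u r powr (p - 1) * (us r - u r))" by (simp add: mult_ac)
    also have "\<dots> \<le> r ^ 4 * (us r powr p - u r powr p)"
      by (intro mult_left_mono powr_tangent(1)[OF p_gt_1]) (use below[OF elim(2)] u_pos[of r] elim in auto)
    finally show ?case using below[OF elim(2)] by simp
  qed
  from D.eventual_signs[OF mu(1) lim this] obtain R where R: "R \<ge> 1"
    and signs: "us' R - u' R \<le> 0" "hs R - h R \<le> 0" "0 \<le> hs' R - h' R"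
    and alt: "us R - u R > 0 \<or> (\<forall>r\<ge>R. us r - u r = 0)" .
  show False
  proof (cases "us R - u R > 0")
    case True
    define l where "l = (\<lambda>r. r ^ (n - 1) * (hs' r - h' r))"
    have inner: "us R - u R \<le> us r - u r" "0 \<le> l r" if r: "0 < r" "r \<le> R" for r
    proof -
      have e: "0 \<le> us x powr p - u x powr p" if "0 < x" "0 \<le> us x - u x" for x
        using that u_pos[of x] p_gt_1 powr_mono2[of p "u x" "us x"] by simp
      show "us R - u R \<le> us r - u r" "0 \<le> l r" unfolding l_def
        by (rule D.backward_positive[OF _ True _ _ _ e r]; use R signs in simp)+
    qed
    have l_anti: "l b < l a" if "0 < a" "a < b" "b \<le> R" for a b
      unfolding l_def
    proof (rule decreasing_of_deriv[OF that(2) D.cont_on(4) D.dl])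
      show "- (x ^ (n - 1) * (us x powr p - u x powr p)) < 0" if x: "a < x" "x < b" for x
      proof -
        have x0: "0 < x" "x \<le> R" using x \<open>0 < a\<close> \<open>b \<le> R\<close> by auto
        have "u x < us x" using inner(1)[OF x0] True by simp
        then have "u x powr p < us x powr p" using u_pos[of x] x0 p_gt_1 by (intro powr_less_mono2) auto
        then show ?thesis using x0 by simp
      qed
    qed (use that in auto)
    define c where "c = l (R / 2)"
    have c: "c > 0" using l_anti[of "R / 2" R] inner(2)[of R] R by (simp add: c_def)
    have "continuous_on {0..} (\<lambda>r. r ^ (n - 1) * h' r)" by (rule H.flux_cont)
    then have "((\<lambda>r. r ^ (n - 1) * h' r) \<longlongrightarrow> 0) (at 0 within {0..})"
      using H.flux_zero by (auto simp: continuous_on_def dest!: bspec[of _ _ 0])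
    then have "\<forall>\<^sub>F r in at 0 within {0..}. - c < r ^ (n - 1) * h' r" using c by (intro order_tendstoD(1)) auto
    then obtain d where d: "d > 0" "\<And>r. r > 0 \<Longrightarrow> r < d \<Longrightarrow> - c < r ^ (n - 1) * h' r"
      unfolding eventually_at by (auto simp: dist_real_def)
    define r where "r = min (d / 2) (R / 4)"
    have r: "0 < r" "r < d" "r < R / 2" "R / 2 \<le> R" using d R by (auto simp: r_def)
    have "c < l r" unfolding c_def using l_anti[of r "R / 2"] r by simp
    moreover have "l r \<le> - (r ^ (n - 1) * h' r)"
    proof -
      have "hs' r \<le> 0" unfolding hs'_def using m_bounds K_props
        by (auto intro!: mult_nonpos_nonneg mult_nonneg_nonneg)
      then have "r ^ (n - 1) * hs' r \<le> 0" using r by (intro mult_nonneg_nonpos) auto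
      then show ?thesis by (simp add: l_def right_diff_distrib)
    qed
    ultimately show False using d(2)[of r] r by simp
  next
    case False
    then have "u r = us r" if "r \<ge> R" for r using alt that by auto
    then show False using not_eventually_equal[of R] R by simp
  qed
qed

lemma oscillation:
  assumes "n \<ge> 13 \<longrightarrow> p < p_crit n"
  shows "oscillates_around_at_top u (u_s n p)"
proof (rule ccontr)
  assume "\<not> ?thesis"
  then obtain R where R: "R > 0" "(\<forall>r\<ge>R. u_s n p r \<le> u r) \<or> (\<forall>r\<ge>R. u r \<le> u_s n p r)"
    by (rule eventually_one_sign)
  note crit = above_hardy_constant[OF U.n_ge supercritical assms]
  from R(2) show False
    using not_eventually_above[OF crit, of R] not_eventually_below[OF crit R(1)] by (auto simp: us_eq)
qed

end

text \<open>
  If \<open>u 0 < 0\<close>, then \<open>- u\<close> is positive everywhere; if \<open>u 0 = 0\<close>, one of \<open>u\<close>, \<open>- u\<close> has data that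
  blow up, unless the solution is trivial.
\<close>

lemma positive_at_origin:
  assumes r: "r \<ge> 0" and pos: "u r > 0"
  shows "u 0 > 0"
proof (rule ccontr)
  assume "\<not> u 0 > 0"
  then consider "u 0 < 0" | "u 0 = 0" by linarith
  then show False
  proof cases
    case 1
    then show False using radial_profile.positive[OF profile_uminus _ r] pos by simp
  next
    case 2
    then have "h 0 \<noteq> 0" using trivial_of_zero_data[OF _ _ r] pos by auto
    then show False
      using no_nonneg_nonpos_data radial_profile.no_nonneg_nonpos_data[OF profile_uminus] 2 by fastforce
  qed
qed

end

lemma radial_profile_of_entire_solution:
  fixes u :: "real ^ 'n::finite \<Rightarrow> real"
  assumes n: "CARD('n) \<ge> 5" and p: "(real CARD('n) + 4) / (real CARD('n) - 4) < p"
    and solution: "entire_solution p u" and radial: "\<And>x. u x = \<phi> (norm x)"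
  shows "\<exists>\<phi>' h h'. radial_profile CARD('n) p \<phi> \<phi>' h h'"
proof -
  obtain j :: 'n where True by simp
  have C4: "C_k 4 u" and eq: "\<And>x. laplacian (laplacian u) x = \<bar>u x\<bar> powr (p - 1) * u x"
    using solution by (auto simp: entire_solution_def)
  have C2u: "C_k 2 u" using C4 C_k_Suc_imp[of 3 u] C_k_Suc_imp[of 2 u] by (simp add: eval_nat_numeral)
  have C2l: "C_k 2 (laplacian u)" using C_k_laplacian[of 2 u] C4 by (simp add: eval_nat_numeral)
  note R1 = radial_laplacian(1-4)[where j=j and \<psi>=\<phi>, OF C2u radial]
    radial_laplacian(5)[where \<psi>=\<phi>, OF C2u radial]
  note R2 = radial_laplacian(1-4)[where j=j and \<psi>="\<lambda>r. laplacian u (r *\<^sub>R axis j 1)", OF C2l R1(3)]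
    radial_laplacian(5)[where \<psi>="\<lambda>r. laplacian u (r *\<^sub>R axis j 1)", OF C2l R1(3)]
  define \<phi>' where "\<phi>' = (\<lambda>r. partial_deriv j u (r *\<^sub>R axis j 1))"
  define h where "h = (\<lambda>r. - laplacian u (r *\<^sub>R axis j 1))"
  define h' where "h' = (\<lambda>r. - partial_deriv j (laplacian u) (r *\<^sub>R axis j 1))"
  have ray: "\<bar>\<phi> r\<bar> powr (p - 1) * \<phi> r = laplacian (laplacian u) (r *\<^sub>R axis j 1)" if "r > 0" for r
    using eq[of "r *\<^sub>R axis j 1"] radial[of "r *\<^sub>R axis j 1"] that by (simp add: norm_axis_1)
  have "radial_poisson CARD('n) \<phi> \<phi>' h"
    by unfold_locales (use n R1 in \<open>auto simp: \<phi>'_def h_def intro: continuous_on_subset\<close>)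
  moreover have "radial_poisson CARD('n) h h' (\<lambda>r. \<bar>\<phi> r\<bar> powr (p - 1) * \<phi> r)"
  proof
    show "CARD('n) \<ge> 5" by fact
    show "continuous_on {0..} h" unfolding h_def by (intro continuous_on_minus R2(5))
    show "continuous_on {0..} h'"
      unfolding h'_def by (intro continuous_on_minus continuous_on_subset[OF R2(4)]) auto
    fix r :: real assume r: "r > 0"
    show "DERIV h r :> h' r"
      unfolding h_def h'_def by (rule DERIV_minus[OF R2(1)[OF r]])
    show "DERIV (\<lambda>r. r ^ (CARD('n) - 1) * h' r) r :>
        - (r ^ (CARD('n) - 1) * (\<bar>\<phi> r\<bar> powr (p - 1) * \<phi> r))"
      using DERIV_minus[OF R2(2)[OF r]] unfolding h'_def ray[OF r] by simp
  qed
  ultimately have "radial_profile CARD('n) p \<phi> \<phi>' h h'"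
    using p by (intro radial_profile.intro)
  then show ?thesis by blast
qed

theorem theorem1:
  fixes n :: nat and p :: real
    and u :: "real ^ 'n::finite \<Rightarrow> real" and \<phi> :: "real \<Rightarrow> real"
  assumes dim: "CARD('n) = n"
    and n_ge: "n \<ge> 5"
    and supercritical: "(real n + 4) / (real n - 4) < p"
    and below_p_crit: "n \<ge> 13 \<longrightarrow> p < p_crit n"
    and solution: "entire_solution p u"
    and radial: "\<forall>x. u x = \<phi> (norm x)"
    and pos_somewhere: "\<exists>x. u x > 0"
  shows "oscillates_around_at_top \<phi> (u_s n p)"
proof -
  obtain \<phi>' h h' where "radial_profile n p \<phi> \<phi>' h h'"
    using radial_profile_of_entire_solution[where u=u and \<phi>=\<phi> and p=p] assms by auto
  then interpret radial_profile n p \<phi> \<phi>' h h' .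
  obtain x where "u x > 0" using pos_somewhere by blast
  then have "\<phi> (norm x) > 0" using radial by simp
  then have "\<phi> 0 > 0" by (rule positive_at_origin[rotated]) simp
  then show ?thesis using below_p_crit by (rule oscillation)
qed

end
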